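(* Let $G$ be a finite simple connected graph which is complete intersection and which has exactly two non-bipartite blocks $B_1,B_2$. Let $y_{1,2}$ be the cut vertex of $B_1$ lying on the unique path from $B_1$ to $B_2$ in the block tree of $G$, and $y_{2,1}$ the cut vertex of $B_2$ lying on that path. Then: each of $B_1,B_2$ contains at most two odd chordless cycles; $B_1$ contains exactly one odd chordless cycle passing through $y_{1,2}$, and $B_2$ contains exactly one odd chordless cycle passing through $y_{2,1}$; and if $B_1$ (resp. $B_2$) contains another odd chordless cycle, then this cycle has distance one from $y_{1,2}$ (resp. $y_{2,1}$), i.e. it does not contain that vertex but contains a vertex adjacent to it.
   Context: For a finite simple graph $G$ with edges $e_1,\dots,e_m$ and a field $K$, the toric ideal $I_G\subseteq K[e_1,\dots,e_m]$ is the kernel of the $K$-algebra map $e_i=\{v_j,v_k\}\mapsto v_jv_k$; $G$ is complete intersection if $I_G$ is generated by $\operatorname{ht}(I_G)$ elements. A block is a maximal biconnected subgraph of $G$. The block tree of $G$ is the bipartite graph whose vertices are the blocks and the cut vertices of $G$, with a block $B$ adjacent to a cut vertex $v$ iff $v\in B$. A cycle is chordless if no edge of $G$ joins two of its vertices other than its own edges. *)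

theory Defs
  imports "HOL-Library.Poly_Mapping" "HOL-Library.Extended_Nat" "HOL-Algebra.Ideal"
begin

definition simple_graph :: "'v set \<Rightarrow> 'v set set \<Rightarrow> bool" where
  "simple_graph V E \<longleftrightarrow> finite V \<and>
     (\<forall>e\<in>E. \<exists>u w. u \<noteq> w \<and> e = {u, w} \<and> u \<in> V \<and> w \<in> V)"

definition reach_in :: "'v set set \<Rightarrow> 'v set \<Rightarrow> 'v \<Rightarrow> 'v \<Rightarrow> bool" where
  "reach_in E S u w \<longleftrightarrow>
     (u, w) \<in> ({(x, y). x \<in> S \<and> y \<in> S \<and> {x, y} \<in> E})\<^sup>* \<and> u \<in> S \<and> w \<in> S"

definition connected_on :: "'v set set \<Rightarrow> 'v set \<Rightarrow> bool" where
  "connected_on E S \<longleftrightarrow> (\<forall>u\<in>S. \<forall>w\<in>S. reach_in E S u w)"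

definition connected_graph :: "'v set \<Rightarrow> 'v set set \<Rightarrow> bool" where
  "connected_graph V E \<longleftrightarrow> connected_on E V"

definition cut_vertex :: "'v set \<Rightarrow> 'v set set \<Rightarrow> 'v \<Rightarrow> bool" where
  "cut_vertex V E x \<longleftrightarrow> x \<in> V \<and>
     (\<exists>u\<in>V - {x}. \<exists>w\<in>V - {x}. reach_in E V u w \<and> \<not> reach_in E (V - {x}) u w)"

text \<open>Biconnected vertex set: the induced subgraph is connected and has no cut vertex
  (this includes single edges and isolated vertices, as usual for blocks).
  A block is a maximal such set; maximal biconnected subgraphs are induced.\<close>
definition biconnected_on :: "'v set set \<Rightarrow> 'v set \<Rightarrow> bool" where
  "biconnected_on E S \<longleftrightarrow> S \<noteq> {} \<and> connected_on E S \<and>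
     (\<forall>x\<in>S. connected_on E (S - {x}))"

definition is_block :: "'v set \<Rightarrow> 'v set set \<Rightarrow> 'v set \<Rightarrow> bool" where
  "is_block V E B \<longleftrightarrow> B \<subseteq> V \<and> biconnected_on E B \<and>
     (\<forall>B'. B \<subset> B' \<and> B' \<subseteq> V \<longrightarrow> \<not> biconnected_on E B')"

definition bipartite_on :: "'v set set \<Rightarrow> 'v set \<Rightarrow> bool" where
  "bipartite_on E S \<longleftrightarrow>
     (\<exists>f :: 'v \<Rightarrow> bool. \<forall>u\<in>S. \<forall>w\<in>S. {u, w} \<in> E \<longrightarrow> f u \<noteq> f w)"

definition block_tree_node :: "'v set \<Rightarrow> 'v set set \<Rightarrow> ('v set + 'v) \<Rightarrow> bool" where
  "block_tree_node V E n \<longleftrightarrow>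
     (case n of Inl B \<Rightarrow> is_block V E B | Inr v \<Rightarrow> cut_vertex V E v)"

definition block_tree_adj :: "'v set \<Rightarrow> 'v set set \<Rightarrow> ('v set + 'v) \<Rightarrow> ('v set + 'v) \<Rightarrow> bool" where
  "block_tree_adj V E n m \<longleftrightarrow> block_tree_node V E n \<and> block_tree_node V E m \<and>
     (case (n, m) of
        (Inl B, Inr v) \<Rightarrow> v \<in> B
      | (Inr v, Inl B) \<Rightarrow> v \<in> B
      | _ \<Rightarrow> False)"

definition block_tree_path :: "'v set \<Rightarrow> 'v set set \<Rightarrow> ('v set + 'v) list \<Rightarrow> bool" where
  "block_tree_path V E p \<longleftrightarrow> p \<noteq> [] \<and> distinct p \<and>
     (\<forall>n\<in>set p. block_tree_node V E n) \<and>
     (\<forall>i. Suc i < length p \<longrightarrow> block_tree_adj V E (p ! i) (p ! Suc i))"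

text \<open>Chordless cycles. A cycle is given by a cyclic list cs of distinct vertices
  (length \<ge> 3, consecutive entries adjacent, last adjacent to first). It is chordless
  if every edge of G between two of its vertices is a cycle edge. Since the vertex set of
  a chordless cycle determines the cycle, we identify a chordless cycle with its vertex set.\<close>
definition cyc_edge :: "'v list \<Rightarrow> 'v \<Rightarrow> 'v \<Rightarrow> bool" where
  "cyc_edge cs u w \<longleftrightarrow> (\<exists>i<length cs.
      {u, w} = {cs ! i, cs ! ((Suc i) mod length cs)})"

definition chordless_cycle :: "'v set set \<Rightarrow> 'v set \<Rightarrow> bool" where
  "chordless_cycle E C \<longleftrightarrow> (\<exists>cs. distinct cs \<and> set cs = C \<and> length cs \<ge> 3 \<and>
      (\<forall>i<length cs. {cs ! i, cs ! ((Suc i) mod length cs)} \<in> E) \<and>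
      (\<forall>u\<in>C. \<forall>w\<in>C. {u, w} \<in> E \<longrightarrow> cyc_edge cs u w))"

definition odd_chordless_cycle :: "'v set set \<Rightarrow> 'v set \<Rightarrow> bool" where
  "odd_chordless_cycle E C \<longleftrightarrow> chordless_cycle E C \<and> odd (card C)"

definition edge_poly_carrier :: "'v set set \<Rightarrow> (('v set \<Rightarrow>\<^sub>0 nat) \<Rightarrow>\<^sub>0 'k::field) set" where
  "edge_poly_carrier E = {p. \<forall>a\<in>Poly_Mapping.keys p. Poly_Mapping.keys a \<subseteq> E}"

definition edge_poly_ring ::
  "'v set set \<Rightarrow> (('v set \<Rightarrow>\<^sub>0 nat) \<Rightarrow>\<^sub>0 'k::field) ring" where
  "edge_poly_ring E = \<lparr>carrier = edge_poly_carrier E, mult = (*), one = 1,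
                        zero = 0, add = (+)\<rparr>"

definition mon_img :: "('v set \<Rightarrow>\<^sub>0 nat) \<Rightarrow> ('v \<Rightarrow>\<^sub>0 nat)" where
  "mon_img a = (\<Sum>e\<in>Poly_Mapping.keys a. \<Sum>w\<in>e. Poly_Mapping.single w (Poly_Mapping.lookup a e))"

text \<open>The K-algebra map K[E] \<rightarrow> K[V], e = {u,w} \<mapsto> u w (linear extension).\<close>
definition toric_map :: "(('v set \<Rightarrow>\<^sub>0 nat) \<Rightarrow>\<^sub>0 'k::field) \<Rightarrow> (('v \<Rightarrow>\<^sub>0 nat) \<Rightarrow>\<^sub>0 'k)" where
  "toric_map p = (\<Sum>a\<in>Poly_Mapping.keys p. Poly_Mapping.single (mon_img a) (Poly_Mapping.lookup p a))"

definition toric_ideal :: "'v set set \<Rightarrow> (('v set \<Rightarrow>\<^sub>0 nat) \<Rightarrow>\<^sub>0 'k::field) set" where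
  "toric_ideal E = {p \<in> edge_poly_carrier E. toric_map p = 0}"

definition prime_height :: "('a, 'b) ring_scheme \<Rightarrow> 'a set \<Rightarrow> enat" where
  "prime_height R P = Sup {enat n | n. \<exists>c :: nat \<Rightarrow> 'a set.
       (\<forall>i\<le>n. primeideal (c i) R) \<and> (\<forall>i<n. c i \<subset> c (Suc i)) \<and> c n = P}"

definition ideal_height :: "('a, 'b) ring_scheme \<Rightarrow> 'a set \<Rightarrow> enat" where
  "ideal_height R I = (INF P \<in> {P. primeideal P R \<and> I \<subseteq> P}. prime_height R P)"

definition complete_intersection_ideal :: "('a, 'b) ring_scheme \<Rightarrow> 'a set \<Rightarrow> bool" where
  "complete_intersection_ideal R I \<longleftrightarrow>
     (\<exists>gs. set gs \<subseteq> carrier R \<and> genideal R (set gs) = I \<and>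
           enat (length gs) = ideal_height R I)"

definition graph_complete_intersection :: "'k::field itself \<Rightarrow> 'v set set \<Rightarrow> bool" where
  "graph_complete_intersection K E \<longleftrightarrow>
     complete_intersection_ideal (edge_poly_ring E :: (('v set \<Rightarrow>\<^sub>0 nat) \<Rightarrow>\<^sub>0 'k) ring)
                                 (toric_ideal E)"

end

theory Submission
  imports Defs "HOL-Library.Function_Algebras" "HOL-Library.Multiset"
begin

text \<open>
  Exponent vectors of binomials in the toric ideal span a lattice of rank \<open>card E - r\<close>, where \<open>r\<close> is the
  rank of the incidence matrix, and this rank bounds the height. Call two monomials of one fibre connected if
  they are linked by monomials sharing variables; choosing one binomial for each component of a fibre
  other than a base component gives vectors that span the lattice, and no generating set of the ideal
  has fewer elements than there are such components. For a complete intersection these vectors are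
  therefore a basis. For a set \<open>D\<close> of degrees closed under
  divisors, the sublattice \<open>lat D\<close> of the binomials with degree in \<open>D\<close> is spanned by part of this
  basis, so these sublattices satisfy the distributive law \<open>lat_distrib\<close>. Everything else is combinatorics.

  An odd closed walk at \<open>y\<close> beyond the block \<open>B\<close> completes each odd closed walk at \<open>y\<close> in \<open>B\<close>
  to a binomial, and distributivity shows that the latter walks have a minimum with respect to
  inclusion of vertex multisets. Since \<open>B\<close> is biconnected, the minimum is a chordless cycle \<open>C0\<close>, it is the only
  odd chordless cycle through \<open>y\<close>, and \<open>C0 - {y}\<close> lies in every odd cycle of \<open>B\<close>. A
  second application of distributivity shows that at most one odd chordless cycle avoids \<open>y\<close>.
\<close>

text \<open>The lattice lives over the rationals and the generators over \<open>K\<close>; they are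
  compared only by counting: components to be joined <= generators = height <= \<open>card E\<close>
  - rank <= dimension of the lattice <= chosen vectors. So an upper bound for the height suffices,
  and it comes from counting polynomials of bounded degree that are independent modulo the primes of
  a chain.

  A basis is wanted because for arbitrary subspaces \<open>X \<inter> (Y + Z)\<close> can exceed
  \<open>X \<inter> Y + X \<inter> Z\<close>, whereas for spans of parts of one basis the two agree.
  Each application takes a vector with an evident decomposition, replaces it by one with smaller
  degrees, and evaluates a linear functional on the new pieces.

  A single odd closed walk gives no binomial: its two alternating halves differ in degree by the
  square of the base vertex. This is where the second non-bipartite block enters: a walk with the
  same base on its side cancels the square.\<close>

abbreviation "lookup \<equiv> Poly_Mapping.lookup"
abbreviation "single \<equiv> Poly_Mapping.single"
abbreviation "keys \<equiv> Poly_Mapping.keys"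

section \<open>Linear algebra on spaces of functions\<close>

definition fscale :: "'f::field \<Rightarrow> ('x \<Rightarrow> 'f) \<Rightarrow> 'x \<Rightarrow> 'f" where
  "fscale k f = (\<lambda>x. k * f x)"

lemma fscale_apply [simp]: "fscale k f x = k * f x"
  by (simp add: fscale_def)

interpretation fv: vector_space fscale
  by unfold_locales (auto simp: fun_eq_iff algebra_simps)

lemma sum_fun_apply: "(\<Sum>i\<in>I. g i) x = (\<Sum>i\<in>I. g i x)"
  by (induction I rule: infinite_finite_induct) auto

definition unit_fun :: "'x \<Rightarrow> 'x \<Rightarrow> 'f::field" where
  "unit_fun x = (\<lambda>z. if z = x then 1 else 0)"

lemma fun_in_span_unit_fun:
  assumes "finite X" "\<And>x. x \<notin> X \<Longrightarrow> f x = 0"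
  shows "f \<in> fv.span (unit_fun ` X)"
proof -
  have "f = (\<Sum>x\<in>X. fscale (f x) (unit_fun x))"
    using assms by (auto simp: fun_eq_iff sum_fun_apply unit_fun_def if_distrib cong: if_cong)
  also have "\<dots> \<in> fv.span (unit_fun ` X)"
    by (intro fv.span_sum fv.span_scale fv.span_base) auto
  finally show ?thesis .
qed

text \<open>For an indexed family, vanishing of all coefficients also excludes repeated vectors: the
  coefficients 1 and -1 on two equal members would be a relation.\<close>

lemma independent_family:
  assumes I: "finite I"
    and ind: "\<And>c. (\<Sum>i\<in>I. fscale (c i) (b i)) = 0 \<Longrightarrow> \<forall>i\<in>I. c i = 0"
  shows "inj_on b I" "fv.independent (b ` I)"
proof -
  show inj: "inj_on b I"
  proof (rule inj_onI, rule ccontr)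
    fix i j assume ij: "i \<in> I" "j \<in> I" "b i = b j" "i \<noteq> j"
    have "(\<Sum>k\<in>I. fscale (if k = i then 1 else if k = j then -1 else 0) (b k))
        = (\<Sum>k\<in>{i,j}. fscale (if k = i then 1 else if k = j then -1 else 0) (b k))"
      using I ij by (intro sum.mono_neutral_right) (auto simp: fun_eq_iff)
    also have "\<dots> = 0" using ij by (auto simp: fun_eq_iff)
    finally show False using ind[of "\<lambda>k. if k = i then 1 else if k = j then -1 else 0"] ij by force
  qed
  show "fv.independent (b ` I)"
  proof (rule fv.independent_if_scalars_zero)
    fix f x assume s: "(\<Sum>x\<in>b ` I. fscale (f x) x) = 0" and "x \<in> b ` I"
    then obtain i where i: "i \<in> I" "x = b i" by auto
    have "(\<Sum>i\<in>I. fscale (f (b i)) (b i)) = 0"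
      using s by (simp add: sum.reindex[OF inj])
    then show "f x = 0" using ind[of "\<lambda>i. f (b i)"] i by auto
  qed (use I in auto)
qed

lemma independent_family_card_le:
  assumes "finite I"
    and "\<And>c. (\<Sum>i\<in>I. fscale (c i) (b i)) = 0 \<Longrightarrow> \<forall>i\<in>I. c i = 0"
    and "finite G" "\<And>i. i \<in> I \<Longrightarrow> b i \<in> fv.span G"
  shows "card I \<le> card G"
proof -
  have "card (b ` I) \<le> card G"
    using independent_family(2)[of I b, OF assms(1,2)] assms(3,4)
    by (intro conjunct2[OF fv.independent_span_bound]) auto
  then show ?thesis
    using independent_family(1)[of I b, OF assms(1,2)] by (simp add: card_image)
qed

text \<open>Coordinates with respect to \<open>B\<close> are unique, so a vector in both spans
  involves only elements common to \<open>S\<close> and \<open>T\<close>. Distributivity rests on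
  this.\<close>

lemma span_Int_independent:
  assumes B: "fv.independent B" "S \<subseteq> B" "T \<subseteq> B" and z: "z \<in> fv.span S" "z \<in> fv.span T"
  shows "z \<in> fv.span (S \<inter> T)"
proof -
  have zB: "z \<in> fv.span B" using fv.span_mono[OF B(2)] z by auto
  have rS: "fv.representation S z = fv.representation B z"
    using fv.representation_extend[OF B(1) z(1) B(2)] by auto
  have rT: "fv.representation T z = fv.representation B z"
    using fv.representation_extend[OF B(1) z(2) B(3)] by auto
  have "(\<Sum>b | fv.representation B z b \<noteq> 0. fscale (fv.representation B z b) b) = z"
    by (rule fv.sum_nonzero_representation_eq[OF B(1) zB])
  moreover have "b \<in> S \<inter> T" if "fv.representation B z b \<noteq> 0" for b
    using that fv.representation_ne_zero[of S z b] fv.representation_ne_zero[of T z b] rS rT by auto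
  ultimately show ?thesis
    using fv.span_sum[of "{b. fv.representation B z b \<noteq> 0}"
        "\<lambda>b. fscale (fv.representation B z b) b" "S \<inter> T"]
    by (auto intro: fv.span_base fv.span_scale)
qed

section \<open>Push-forward of monoid algebras\<close>

lemma poly_mapping_eq_sum_single: "p = (\<Sum>a\<in>keys p. single a (lookup p a))"
proof (rule poly_mapping_eqI)
  fix k
  have "(\<Sum>a\<in>keys p. lookup (single a (lookup p a)) k) = (\<Sum>a\<in>keys p. if a = k then lookup p k else 0)"
    by (intro sum.cong) (auto simp: lookup_single when_def)
  then show "lookup p k = lookup (\<Sum>a\<in>keys p. single a (lookup p a)) k"
    by (auto simp: lookup_sum in_keys_iff)
qed

text \<open>Covers two maps at once: the toric map on polynomials, and the renaming of variables
  inside exponents.\<close>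

definition push :: "('a \<Rightarrow> 'b) \<Rightarrow> ('a \<Rightarrow>\<^sub>0 'k::comm_monoid_add) \<Rightarrow> ('b \<Rightarrow>\<^sub>0 'k)" where
  "push g p = (\<Sum>a\<in>keys p. single (g a) (lookup p a))"

lemma push_zero [simp]: "push g 0 = 0"
  by (simp add: push_def)

lemma push_add: "push g (p + q) = push g p + push g q"
  unfolding push_def
  by (rule setsum_keys_plus_distrib) (auto simp: single_add)

lemma push_sum: "push g (sum h I) = (\<Sum>i\<in>I. push g (h i))"
  by (induction I rule: infinite_finite_induct) (auto simp: push_add)

lemma push_single [simp]: "push g (single a k) = single (g a) k"
  by (cases "k = 0") (auto simp: push_def)

lemma lookup_push: "lookup (push g p) b = (\<Sum>a | a \<in> keys p \<and> g a = b. lookup p a)"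
proof -
  have "lookup (push g p) b = (\<Sum>a\<in>keys p. if g a = b then lookup p a else 0)"
    unfolding push_def lookup_sum by (intro sum.cong) (auto simp: lookup_single when_def)
  also have "\<dots> = (\<Sum>a | a \<in> keys p \<and> g a = b. lookup p a)"
    by (simp add: sum.inter_filter)
  finally show ?thesis .
qed

lemma push_mult:
  fixes p q :: "'a::comm_monoid_add \<Rightarrow>\<^sub>0 'k::comm_semiring_0"
  assumes "\<And>a b. g (a + b) = g a + g b"
  shows "push g (p * q) = push g p * push g q"
proof -
  have "p * q = (\<Sum>a\<in>keys p. \<Sum>b\<in>keys q. single a (lookup p a) * single b (lookup q b))"
    using arg_cong2[where f = "(*)", OF poly_mapping_eq_sum_single[of p] poly_mapping_eq_sum_single[of q]]
    unfolding sum_product .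
  then have "push g (p * q)
      = (\<Sum>a\<in>keys p. \<Sum>b\<in>keys q. single (g a) (lookup p a) * single (g b) (lookup q b))"
    by (simp add: push_sum mult_single assms)
  then show ?thesis by (simp add: push_def sum_product)
qed

lemma push_eq_0_imp:
  assumes "inj_on g A" "keys p \<subseteq> A" "push g p = 0"
  shows "p = 0"
proof (rule poly_mapping_eqI)
  fix a
  show "lookup p a = lookup 0 a"
  proof (cases "a \<in> keys p")
    case True
    then have "{x. x \<in> keys p \<and> g x = g a} = {a}"
      using assms(1,2) by (auto dest: inj_onD)
    then have "lookup (push g p) (g a) = lookup p a" by (simp add: lookup_push)
    then show ?thesis using assms(3) by simp
  qed (simp add: in_keys_iff)
qed

text \<open>Only finitely many variables occur, so they can be renamed to natural numbers. The
  exponents are then linearly ordered compatibly with addition, and leading terms cannot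
  cancel.\<close>

lemma mult_eq_0_poly_mapping:
  fixes p q :: "('v \<Rightarrow>\<^sub>0 nat) \<Rightarrow>\<^sub>0 'k::field"
  assumes "p * q = 0"
  shows "p = 0 \<or> q = 0"
proof -
  define X where "X = (\<Union>a\<in>keys p \<union> keys q. keys a)"
  have "finite X" by (auto simp: X_def)
  then obtain f :: "'v \<Rightarrow> nat" where f: "inj_on f X" using finite_imp_inj_to_nat_seg by metis
  define g :: "('v \<Rightarrow>\<^sub>0 nat) \<Rightarrow> (nat \<Rightarrow>\<^sub>0 nat)" where "g = push f"
  have inj: "inj_on g (keys p \<union> keys q)"
  proof (rule inj_onI)
    fix a b assume ab: "a \<in> keys p \<union> keys q" "b \<in> keys p \<union> keys q" "g a = g b"
    have *: "lookup (push f c) (f v) = lookup c v" if "c \<in> keys p \<union> keys q" "v \<in> X" for c v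
    proof -
      have "keys c \<subseteq> X" using that(1) by (auto simp: X_def)
      then have "{x. x \<in> keys c \<and> f x = f v} = (if v \<in> keys c then {v} else {})"
        using f that(2) by (auto dest: inj_onD)
      then show ?thesis by (auto simp: lookup_push in_keys_iff)
    qed
    show "a = b"
    proof (rule poly_mapping_eqI)
      fix v show "lookup a v = lookup b v"
      proof (cases "v \<in> X")
        case True then show ?thesis using * ab by (metis g_def)
      next
        case False
        then have "v \<notin> keys a" "v \<notin> keys b" using ab by (auto simp: X_def)
        then show ?thesis by (simp add: in_keys_iff)
      qed
    qed
  qed
  have "push g p * push g q = push g (p * q)"
    by (rule push_mult[symmetric]) (simp add: g_def push_add)
  then have "push g p = 0 \<or> push g q = 0" using assms by simp
  then show ?thesis using push_eq_0_imp[OF inj] by (metis Un_upper1 Un_upper2)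
qed

lemma mon_img_add: "mon_img (a + b) = mon_img a + mon_img b"
  unfolding mon_img_def
  by (rule setsum_keys_plus_distrib) (auto simp: single_add sum.distrib)

lemma mon_img_zero [simp]: "mon_img 0 = 0"
  by (simp add: mon_img_def)

lemma toric_map_push: "toric_map = push mon_img"
  by (simp add: fun_eq_iff toric_map_def push_def)

section \<open>The edge ring and its toric ideal\<close>

lemma edge_poly_ring_simps [simp]:
  "carrier (edge_poly_ring E) = edge_poly_carrier E"
  "x \<otimes>\<^bsub>edge_poly_ring E\<^esub> y = x * y" "x \<oplus>\<^bsub>edge_poly_ring E\<^esub> y = x + y"
  "\<one>\<^bsub>edge_poly_ring E\<^esub> = 1" "\<zero>\<^bsub>edge_poly_ring E\<^esub> = 0"
  by (simp_all add: edge_poly_ring_def)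

lemma edge_poly_carrier_closed:
  fixes p q :: "('v set \<Rightarrow>\<^sub>0 nat) \<Rightarrow>\<^sub>0 'k::field"
  shows "0 \<in> edge_poly_carrier E" "1 \<in> edge_poly_carrier E"
    "p \<in> edge_poly_carrier E \<Longrightarrow> q \<in> edge_poly_carrier E \<Longrightarrow> p + q \<in> edge_poly_carrier E"
    "p \<in> edge_poly_carrier E \<Longrightarrow> q \<in> edge_poly_carrier E \<Longrightarrow> p * q \<in> edge_poly_carrier E"
    "p \<in> edge_poly_carrier E \<Longrightarrow> - p \<in> edge_poly_carrier E"
    "single 0 k \<in> edge_poly_carrier E"
proof -
  assume pq: "p \<in> edge_poly_carrier E" "q \<in> edge_poly_carrier E"
  show "p + q \<in> edge_poly_carrier E"
    using pq Poly_Mapping.keys_add[of p q] by (auto simp: edge_poly_carrier_def)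
  show "p * q \<in> edge_poly_carrier E"
    unfolding edge_poly_carrier_def
  proof safe
    fix a e assume a: "a \<in> keys (p * q)" "e \<in> keys a"
    then obtain b c where "a = b + c" "b \<in> keys p" "c \<in> keys q" using keys_mult[of p q] by auto
    then show "e \<in> E" using pq a(2) Poly_Mapping.keys_add[of b c]
      unfolding edge_poly_carrier_def by blast
  qed
qed (auto simp: edge_poly_carrier_def)

lemma edge_poly_carrier_sum:
  "(\<And>i. i \<in> I \<Longrightarrow> f i \<in> edge_poly_carrier E) \<Longrightarrow> sum f I \<in> edge_poly_carrier E"
  by (induction I rule: infinite_finite_induct) (auto simp: edge_poly_carrier_closed)

lemma edge_poly_carrier_power:
  "p \<in> edge_poly_carrier E \<Longrightarrow> p ^ n \<in> edge_poly_carrier E"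
  by (induction n) (auto simp: edge_poly_carrier_closed)

lemma edge_poly_cring: "cring (edge_poly_ring E :: (('v set \<Rightarrow>\<^sub>0 nat) \<Rightarrow>\<^sub>0 'k::field) ring)"
proof (rule cringI)
  show "abelian_group (edge_poly_ring E :: (('v set \<Rightarrow>\<^sub>0 nat) \<Rightarrow>\<^sub>0 'k) ring)"
  proof (rule abelian_groupI)
    fix x assume "x \<in> carrier (edge_poly_ring E :: (('v set \<Rightarrow>\<^sub>0 nat) \<Rightarrow>\<^sub>0 'k) ring)"
    then show "\<exists>y\<in>carrier (edge_poly_ring E). y \<oplus>\<^bsub>edge_poly_ring E\<^esub> x = \<zero>\<^bsub>edge_poly_ring E\<^esub>"
      by (auto intro!: bexI[of _ "- x"] edge_poly_carrier_closed)
  qed (auto simp: edge_poly_carrier_closed algebra_simps)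
  show "comm_monoid (edge_poly_ring E :: (('v set \<Rightarrow>\<^sub>0 nat) \<Rightarrow>\<^sub>0 'k) ring)"
    by (rule comm_monoidI) (auto simp: edge_poly_carrier_closed algebra_simps)
qed (auto simp: algebra_simps)

lemma edge_poly_idealI:
  fixes J :: "(('v set \<Rightarrow>\<^sub>0 nat) \<Rightarrow>\<^sub>0 'k::field) set"
  assumes "J \<subseteq> edge_poly_carrier E" "0 \<in> J" "\<And>p q. p \<in> J \<Longrightarrow> q \<in> J \<Longrightarrow> p + q \<in> J"
    and m: "\<And>p q. p \<in> J \<Longrightarrow> q \<in> edge_poly_carrier E \<Longrightarrow> q * p \<in> J"
  shows "ideal J (edge_poly_ring E)"
proof (rule idealI)
  interpret R: cring "edge_poly_ring E :: (('v set \<Rightarrow>\<^sub>0 nat) \<Rightarrow>\<^sub>0 'k) ring"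
    by (rule edge_poly_cring)
  show "ring (edge_poly_ring E :: (('v set \<Rightarrow>\<^sub>0 nat) \<Rightarrow>\<^sub>0 'k) ring)" by (rule R.ring_axioms)
  have neg: "\<ominus>\<^bsub>edge_poly_ring E\<^esub> p \<in> J" if p: "p \<in> J" for p
  proof -
    have c: "p \<in> edge_poly_carrier E" using p assms(1) by auto
    have "\<ominus>\<^bsub>edge_poly_ring E\<^esub> p = - p"
      by (rule R.minus_equality) (use c in \<open>auto simp: edge_poly_carrier_closed\<close>)
    also have "- p = (- 1) * p" by simp
    also have "\<dots> \<in> J" by (rule m[OF p]) (auto intro: edge_poly_carrier_closed)
    finally show ?thesis .
  qed
  show "subgroup J (add_monoid (edge_poly_ring E))"
    by (rule R.add.subgroupI) (use assms neg in \<open>auto simp: a_inv_def\<close>)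
qed (use m in \<open>auto simp: mult.commute\<close>)

lemma edge_poly_idealD:
  fixes J :: "(('v set \<Rightarrow>\<^sub>0 nat) \<Rightarrow>\<^sub>0 'k::field) set"
  assumes "ideal J (edge_poly_ring E)"
  shows "J \<subseteq> edge_poly_carrier E" "0 \<in> J" "p \<in> J \<Longrightarrow> q \<in> J \<Longrightarrow> p + q \<in> J"
    "p \<in> J \<Longrightarrow> q \<in> edge_poly_carrier E \<Longrightarrow> q * p \<in> J" "p \<in> J \<Longrightarrow> - p \<in> J"
proof -
  interpret J: ideal J "edge_poly_ring E" by fact
  show "J \<subseteq> edge_poly_carrier E" "0 \<in> J" "p \<in> J \<Longrightarrow> q \<in> J \<Longrightarrow> p + q \<in> J"
    using J.a_subset J.additive_subgroup_axioms additive_subgroup.zero_closed[of J]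
      additive_subgroup.a_closed[of J] by fastforce+
  show *: "p \<in> J \<Longrightarrow> q \<in> edge_poly_carrier E \<Longrightarrow> q * p \<in> J" for p q
    using J.I_l_closed by auto
  show "p \<in> J \<Longrightarrow> - p \<in> J"
    using *[of p "- 1"] by (auto simp: edge_poly_carrier_closed)
qed

text \<open>Kernel of a ring homomorphism into a domain.\<close>

lemma toric_ideal_prime:
  "primeideal (toric_ideal E :: (('v set \<Rightarrow>\<^sub>0 nat) \<Rightarrow>\<^sub>0 'k::field) set) (edge_poly_ring E)"
proof (rule primeidealI)
  show "ideal (toric_ideal E :: (('v set \<Rightarrow>\<^sub>0 nat) \<Rightarrow>\<^sub>0 'k) set) (edge_poly_ring E)"
    by (rule edge_poly_idealI)
      (auto simp: toric_ideal_def toric_map_push push_add push_mult[OF mon_img_add]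
        edge_poly_carrier_closed)
  show "cring (edge_poly_ring E :: (('v set \<Rightarrow>\<^sub>0 nat) \<Rightarrow>\<^sub>0 'k) ring)" by (rule edge_poly_cring)
  have "toric_map (1 :: ('v set \<Rightarrow>\<^sub>0 nat) \<Rightarrow>\<^sub>0 'k) = 1"
    using push_single[of mon_img 0 "1 :: 'k"] by (simp add: toric_map_push)
  then have "(1 :: ('v set \<Rightarrow>\<^sub>0 nat) \<Rightarrow>\<^sub>0 'k) \<notin> toric_ideal E" by (auto simp: toric_ideal_def)
  then show "carrier (edge_poly_ring E) \<noteq> (toric_ideal E :: (('v set \<Rightarrow>\<^sub>0 nat) \<Rightarrow>\<^sub>0 'k) set)"
    using edge_poly_carrier_closed(2)[of E] by auto
next
  fix a b :: "('v set \<Rightarrow>\<^sub>0 nat) \<Rightarrow>\<^sub>0 'k"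
  assume "a \<in> carrier (edge_poly_ring E)" "b \<in> carrier (edge_poly_ring E)"
    "a \<otimes>\<^bsub>edge_poly_ring E\<^esub> b \<in> toric_ideal E"
  then show "a \<in> toric_ideal E \<or> b \<in> toric_ideal E"
    using mult_eq_0_poly_mapping
    by (auto simp: toric_ideal_def toric_map_push push_mult[OF mon_img_add])
qed

section \<open>An upper bound for the height by a growth argument\<close>

text \<open>Each exponent is bounded separately, so the admissible monomials in the edges form a box
  with \<open>(d + 1) ^ card E\<close> elements.\<close>

definition exp_bounded :: "nat \<Rightarrow> (('e \<Rightarrow>\<^sub>0 nat) \<Rightarrow>\<^sub>0 'k::zero) \<Rightarrow> bool" where
  "exp_bounded d p \<longleftrightarrow> (\<forall>a\<in>keys p. \<forall>e. lookup a e \<le> d)"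

lemma exp_bounded_mult:
  assumes "exp_bounded d p" "exp_bounded d' q"
  shows "exp_bounded (d + d') (p * q)"
  unfolding exp_bounded_def
proof safe
  fix a e assume "a \<in> keys (p * q)"
  then obtain b c where "a = b + c" "b \<in> keys p" "c \<in> keys q" using keys_mult[of p q] by auto
  then show "lookup a e \<le> d + d'"
    using assms by (auto simp: exp_bounded_def lookup_add intro!: add_mono)
qed

lemma exp_bounded_power:
  assumes "exp_bounded d p" shows "exp_bounded (d * n) (p ^ n)"
proof (induction n)
  case 0 then show ?case by (auto simp: exp_bounded_def)
next
  case (Suc n) then show ?case using exp_bounded_mult[OF assms Suc] by simp
qed

lemma exp_bounded_mono: "exp_bounded d p \<Longrightarrow> d \<le> d' \<Longrightarrow> exp_bounded d' p"
  unfolding exp_bounded_def using order_trans by blast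

lemma ex_exp_bounded: "\<exists>d. exp_bounded d p"
proof -
  let ?S = "\<Union>a\<in>keys p. lookup a ` keys a"
  have "lookup a e \<le> Max (insert 0 ?S)" if "a \<in> keys p" for a e
  proof (cases "e \<in> keys a")
    case True then show ?thesis using that by (intro Max_ge) auto
  qed (simp add: in_keys_iff)
  then show ?thesis unfolding exp_bounded_def by blast
qed

text \<open>Linear independence over the field in the quotient by \<open>P\<close>;
  \<open>single 0 (c i)\<close> is the constant polynomial \<open>c i\<close>.\<close>

definition indep_mod ::
  "'v set set \<Rightarrow> (('v set \<Rightarrow>\<^sub>0 nat) \<Rightarrow>\<^sub>0 'k::field) set \<Rightarrow> nat \<Rightarrow> nat \<Rightarrow> (nat \<Rightarrow> (('v set \<Rightarrow>\<^sub>0 nat) \<Rightarrow>\<^sub>0 'k)) \<Rightarrow> bool"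
  where "indep_mod E P d M b \<longleftrightarrow> (\<forall>i<M. b i \<in> edge_poly_carrier E \<and> exp_bounded d (b i)) \<and>
     (\<forall>c. (\<Sum>i<M. single 0 (c i) * b i) \<in> P \<longrightarrow> (\<forall>i<M. c i = 0))"

text \<open>A lower bound of order \<open>N ^ t\<close> for the Hilbert function of the quotient by
  \<open>P\<close>, which stands for dimension at least \<open>t\<close>. The factor
  \<open>q\<close> may grow along a chain of primes, but not with \<open>N\<close>.\<close>

definition growth :: "'v set set \<Rightarrow> (('v set \<Rightarrow>\<^sub>0 nat) \<Rightarrow>\<^sub>0 'k::field) set \<Rightarrow> nat \<Rightarrow> bool" where
  "growth E P t \<longleftrightarrow> (\<exists>q. \<forall>N. \<exists>b. indep_mod E P (q * N) (N ^ t) b)"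

lemma sum_lessThan_mult:
  "(\<Sum>i<n * k. g i) = (\<Sum>j<n. \<Sum>r<k. g (j * k + r :: nat) :: 'a::comm_monoid_add)"
proof -
  have "(\<Sum>i<n * k. g i) = (\<Sum>j<n. sum g {j * k..<j * k + k})"
    by (rule sum.nat_group[symmetric])
  also have "\<dots> = (\<Sum>j<n. \<Sum>r<k. g (j * k + r))"
  proof (rule sum.cong)
    fix j show "sum g {j * k..<j * k + k} = (\<Sum>r<k. g (j * k + r))"
      by (rule sum.reindex_bij_witness[of _ "\<lambda>r. j * k + r" "\<lambda>i. i - j * k"]) auto
  qed simp
  finally show ?thesis .
qed

text \<open>Powers of an element of \<open>Q - P\<close> turn one independent family modulo \<open>Q\<close> into many
  independent families modulo \<open>P\<close>, so the growth exponent strictly increases down a chain.\<close>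

lemma growth_step:
  fixes P Q :: "(('v set \<Rightarrow>\<^sub>0 nat) \<Rightarrow>\<^sub>0 'k::field) set"
  assumes P: "primeideal P (edge_poly_ring E)" and Q: "primeideal Q (edge_poly_ring E)"
    and PQ: "P \<subset> Q" and gr: "growth E Q t"
  shows "growth E P (Suc t)"
proof -
  note iP = edge_poly_idealD[OF primeideal.axioms(1)[OF P]]
  note iQ = edge_poly_idealD[OF primeideal.axioms(1)[OF Q]]
  obtain f where f: "f \<in> Q" "f \<notin> P" using PQ by auto
  have fc: "f \<in> edge_poly_carrier E" using f iQ by auto
  obtain k where k: "exp_bounded k f" using ex_exp_bounded by blast
  obtain q where q: "\<And>N. \<exists>b. indep_mod E Q (q * N) (N ^ t) b" using gr by (auto simp: growth_def)
  have "\<exists>b. indep_mod E P ((q + k) * N) (N ^ Suc t) b" for N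
  proof -
    define M where "M = N ^ t"
    obtain b where b: "indep_mod E Q (q * N) M b" using q M_def by auto
    have bc: "b i \<in> edge_poly_carrier E" "exp_bounded (q * N) (b i)" if "i < M" for i
      using b that by (auto simp: indep_mod_def)
    define s where "s c = (\<Sum>i<M. single 0 (c i) * b i)" for c
    have sc: "s c \<in> edge_poly_carrier E" for c
      unfolding s_def by (intro edge_poly_carrier_sum edge_poly_carrier_closed bc) auto
    \<comment> \<open>All terms with \<open>j > 0\<close> are multiples of \<open>f\<close>, hence
      in \<open>Q\<close>, so independence modulo \<open>Q\<close> kills the coefficients of the
      term \<open>j = 0\<close>. What remains is divisible by \<open>f\<close>, which can be
      cancelled modulo the prime \<open>P\<close>.\<close>
    have key: "(\<Sum>j<J. f ^ j * s (c j)) \<in> P \<Longrightarrow> \<forall>j<J. \<forall>i<M. c j i = 0" for J c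
    proof (induction J arbitrary: c)
      case (Suc J)
      define r where "r = (\<Sum>j<J. f ^ j * s (c (Suc j)))"
      have rc: "r \<in> edge_poly_carrier E" unfolding r_def
        by (intro edge_poly_carrier_sum edge_poly_carrier_closed edge_poly_carrier_power fc sc)
      have eq: "(\<Sum>j<Suc J. f ^ j * s (c j)) = s (c 0) + r * f"
        by (simp add: sum.lessThan_Suc_shift r_def sum_distrib_left sum_distrib_right mult_ac
            del: sum.lessThan_Suc)
      have inP: "s (c 0) + r * f \<in> P" using Suc.prems eq by simp
      then have "(s (c 0) + r * f) + - (r * f) \<in> Q"
        using PQ iQ(3,4,5) f(1) rc by blast
      then have "s (c 0) \<in> Q" by simp
      then have c0: "\<forall>i<M. c 0 i = 0" using b by (auto simp: indep_mod_def s_def)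
      then have "s (c 0) = 0" by (simp add: s_def)
      then have "r * f \<in> P" using inP by simp
      then have "r \<in> P"
        using primeideal.I_prime[OF P, of r f] rc fc f(2) by auto
      then have "\<forall>j<J. \<forall>i<M. c (Suc j) i = 0" using Suc.IH[of "\<lambda>j. c (Suc j)"] by (simp add: r_def)
      then show ?case using c0 by (auto simp: less_Suc_eq_0_disj)
    qed simp
    \<comment> \<open>The index encodes a pair: the power of \<open>f\<close> is
      \<open>i div M\<close>, the member of the old family is \<open>i mod M\<close>.\<close>
    define b' where "b' i = f ^ (i div M) * b (i mod M)" for i
    have "indep_mod E P ((q + k) * N) (N * M) b'"
      unfolding indep_mod_def
    proof safe
      fix i assume i: "i < N * M"
      then have M0: "M > 0" by (cases M) auto
      have im: "i mod M < M" "i div M < N"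
        using M0 i by (auto simp: less_mult_imp_div_less mult.commute)
      show "b' i \<in> edge_poly_carrier E"
        unfolding b'_def by (intro edge_poly_carrier_closed edge_poly_carrier_power fc bc im)
      have "exp_bounded (k * (i div M) + q * N) (b' i)"
        unfolding b'_def by (intro exp_bounded_mult exp_bounded_power k bc im)
      moreover have "k * (i div M) + q * N \<le> (q + k) * N"
        using im by (simp add: algebra_simps)
      ultimately show "exp_bounded ((q + k) * N) (b' i)" by (rule exp_bounded_mono)
    next
      fix c i assume s: "(\<Sum>i<N * M. single 0 (c i) * b' i) \<in> P" and i: "i < N * M"
      then have M0: "M > 0" by (cases M) auto
      have im: "i mod M < M" "i div M < N"
        using M0 i by (auto simp: less_mult_imp_div_less mult.commute)
      have "(\<Sum>i<N * M. single 0 (c i) * b' i) = (\<Sum>j<N. f ^ j * s (\<lambda>r. c (j * M + r)))"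
        unfolding sum_lessThan_mult s_def sum_distrib_left
        by (intro sum.cong refl) (auto simp: b'_def mult_ac)
      then have "\<forall>j<N. \<forall>r<M. c (j * M + r) = 0" using key[where J = N and c = "\<lambda>j r. c (j * M + r)"] s by simp
      then have "c (i div M * M + i mod M) = 0" using im by blast
      then show "c i = 0" by simp
    qed
    then show ?thesis by (auto simp: M_def)
  qed
  then show ?thesis unfolding growth_def by blast
qed

lemma finite_bounded_monomials:
  assumes "finite E"
  shows "finite {a :: 'e \<Rightarrow>\<^sub>0 nat. keys a \<subseteq> E \<and> (\<forall>e. lookup a e \<le> d)}"
    and "card {a :: 'e \<Rightarrow>\<^sub>0 nat. keys a \<subseteq> E \<and> (\<forall>e. lookup a e \<le> d)} \<le> (d + 1) ^ card E"
proof -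
  let ?S = "{a :: 'e \<Rightarrow>\<^sub>0 nat. keys a \<subseteq> E \<and> (\<forall>e. lookup a e \<le> d)}"
  let ?r = "\<lambda>a::'e \<Rightarrow>\<^sub>0 nat. restrict (lookup a) E"
  have inj: "inj_on ?r ?S"
  proof (rule inj_onI, rule poly_mapping_eqI)
    fix a b k assume ab: "a \<in> ?S" "b \<in> ?S" "?r a = ?r b"
    show "lookup a k = lookup b k"
    proof (cases "k \<in> E")
      case True then show ?thesis using ab(3) by (metis restrict_apply')
    next
      case False
      then have "k \<notin> keys a" "k \<notin> keys b" using ab by auto
      then show ?thesis by (simp add: in_keys_iff)
    qed
  qed
  have sub: "?r ` ?S \<subseteq> (E \<rightarrow>\<^sub>E {..d})" by auto
  have fin: "finite (E \<rightarrow>\<^sub>E {..d})" using assms by (auto intro: finite_PiE)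
  show "finite ?S" by (rule inj_on_finite[OF inj sub fin])
  have "card ?S \<le> card (E \<rightarrow>\<^sub>E {..d})" by (rule card_inj_on_le[OF inj sub fin])
  also have "\<dots> = (d + 1) ^ card E" using assms by (simp add: card_PiE)
  finally show "card ?S \<le> (d + 1) ^ card E" .
qed

text \<open>Since \<open>0 \<in> P\<close>, independence modulo \<open>P\<close> implies
  independence of the polynomials themselves, and these lie in a space spanned by the monomials of
  the box.\<close>

lemma indep_mod_le:
  fixes P :: "(('v set \<Rightarrow>\<^sub>0 nat) \<Rightarrow>\<^sub>0 'k::field) set"
  assumes E: "finite E" and ind: "indep_mod E P d M b" and P0: "0 \<in> P"
  shows "M \<le> (d + 1) ^ card E"
proof -
  let ?S = "{a :: 'v set \<Rightarrow>\<^sub>0 nat. keys a \<subseteq> E \<and> (\<forall>e. lookup a e \<le> d)}"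
  have "card {..<M} \<le> card (unit_fun ` ?S :: (('v set \<Rightarrow>\<^sub>0 nat) \<Rightarrow> 'k) set)"
  proof (rule independent_family_card_le[where b = "\<lambda>i. lookup (b i)"])
    fix c assume s: "(\<Sum>i<M. fscale (c i) (lookup (b i))) = 0"
    have "(\<Sum>i<M. single 0 (c i) * b i) = 0"
    proof (rule poly_mapping_eqI)
      fix a
      have "lookup (single 0 (c i) * b i) a = c i * lookup (b i) a" for i
        by (simp add: mult_map_scale_conv_mult[symmetric] map.rep_eq when_def)
      then have "lookup (\<Sum>i<M. single 0 (c i) * b i) a = (\<Sum>i<M. fscale (c i) (lookup (b i))) a"
        by (simp add: lookup_sum sum_fun_apply)
      then show "lookup (\<Sum>i<M. single 0 (c i) * b i) a = lookup 0 a" using s by simp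
    qed
    then show "\<forall>i\<in>{..<M}. c i = 0" using ind P0 by (auto simp: indep_mod_def)
  next
    show "finite (unit_fun ` ?S :: (('v set \<Rightarrow>\<^sub>0 nat) \<Rightarrow> 'k) set)"
      using finite_bounded_monomials(1)[OF E] by blast
    fix i assume "i \<in> {..<M}"
    then have "keys (b i) \<subseteq> ?S"
      using ind by (auto simp: indep_mod_def edge_poly_carrier_def exp_bounded_def)
    then show "lookup (b i) \<in> fv.span (unit_fun ` ?S)"
      by (intro fun_in_span_unit_fun finite_bounded_monomials(1) E) (auto simp: in_keys_iff)
  qed auto
  also have "\<dots> \<le> card ?S" by (rule card_image_le[OF finite_bounded_monomials(1)[OF E]])
  also have "\<dots> \<le> (d + 1) ^ card E" by (rule finite_bounded_monomials(2)[OF E])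
  finally show ?thesis by simp
qed

lemma growth_le:
  fixes P :: "(('v set \<Rightarrow>\<^sub>0 nat) \<Rightarrow>\<^sub>0 'k::field) set"
  assumes E: "finite E" and gr: "growth E P t" and P0: "0 \<in> P"
  shows "t \<le> card E"
proof (rule ccontr)
  assume "\<not> t \<le> card E"
  then have t: "Suc (card E) \<le> t" by simp
  obtain q where q: "\<And>N. \<exists>b. indep_mod E P (q * N) (N ^ t) b" using gr by (auto simp: growth_def)
  \<comment> \<open>Chosen to exceed \<open>(q + 1) ^ card E\<close>, the constant in the comparison
    of \<open>N ^ Suc (card E)\<close> with \<open>((q + 1) * N) ^ card E\<close>.\<close>
  define N where "N = Suc ((q + 1) ^ card E)"
  have "N ^ Suc (card E) \<le> N ^ t" using t by (intro power_increasing) (auto simp: N_def)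
  also have "N ^ t \<le> (q * N + 1) ^ card E"
    using indep_mod_le[OF E _ P0] q by blast
  also have "\<dots> \<le> ((q + 1) * N) ^ card E" by (intro power_mono) (auto simp: N_def)
  finally have "N * N ^ card E \<le> (q + 1) ^ card E * N ^ card E"
    unfolding power_mult_distrib by simp
  then have "N \<le> (q + 1) ^ card E" by (simp add: N_def del: power_Suc)
  then show False by (simp add: N_def)
qed

text \<open>Each step down a chain ending in \<open>P\<close> raises the growth exponent by one, and
  no exponent exceeds \<open>card E\<close>; so a chain of length \<open>n\<close> satisfies
  \<open>r + n \<le> card E\<close>.\<close>

lemma prime_height_le:
  fixes P :: "(('v set \<Rightarrow>\<^sub>0 nat) \<Rightarrow>\<^sub>0 'k::field) set"
  assumes E: "finite E" and gr: "growth E P r"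
  shows "prime_height (edge_poly_ring E) P \<le> enat (card E - r)"
  unfolding prime_height_def
proof (rule Sup_least, safe)
  fix n and c :: "nat \<Rightarrow> (('v set \<Rightarrow>\<^sub>0 nat) \<Rightarrow>\<^sub>0 'k) set"
  assume c: "\<forall>i\<le>n. primeideal (c i) (edge_poly_ring E)" "\<forall>i<n. c i \<subset> c (Suc i)" and P: "P = c n"
  have "growth E (c (n - k)) (r + k)" if "k \<le> n" for k
    using that
  proof (induction k)
    case 0 then show ?case using gr P by simp
  next
    case (Suc k)
    have S: "Suc (n - Suc k) = n - k" using Suc.prems by simp
    have "growth E (c (n - Suc k)) (Suc (r + k))"
    proof (rule growth_step)
      have "c (n - Suc k) \<subset> c (Suc (n - Suc k))" using Suc.prems c(2) by simp
      then show "c (n - Suc k) \<subset> c (n - k)" by (simp only: S)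
    qed (use Suc c in auto)
    then show ?case by simp
  qed
  from this[of n] have "growth E (c 0) (r + n)" by simp
  moreover have "0 \<in> c 0" using c(1) edge_poly_idealD(2)[OF primeideal.axioms(1)] by blast
  ultimately have "r + n \<le> card E" using growth_le[OF E] by blast
  then show "enat n \<le> enat (card E - r)" by simp
qed

section \<open>The lattice of a graph\<close>

lemma lookup_sum_single:
  assumes "finite X"
  shows "lookup (\<Sum>x\<in>X. single x (g x)) y = (if y \<in> X then g y else 0)"
  using assms by (simp add: lookup_sum lookup_single when_def)

text \<open>Exponent vector of the binomial with terms \<open>a\<close> and \<open>b\<close>;
  rational entries, whatever the coefficient field is.\<close>

definition vec :: "('e \<Rightarrow>\<^sub>0 nat) \<Rightarrow> ('e \<Rightarrow>\<^sub>0 nat) \<Rightarrow> 'e \<Rightarrow> rat" where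
  "vec a b = (\<lambda>e. of_nat (lookup a e) - of_nat (lookup b e))"

lemma vec_add: "vec (a + c) (b + d) = vec a b + vec c d"
  by (simp add: vec_def fun_eq_iff lookup_add)

lemma vec_trans: "vec a c = vec a b + vec b c"
  by (simp add: vec_def fun_eq_iff)

lemma vec_self [simp]: "vec a a = 0"
  by (simp add: vec_def fun_eq_iff)

definition total :: "('v \<Rightarrow>\<^sub>0 nat) \<Rightarrow> nat" where
  "total x = (\<Sum>v\<in>keys x. lookup x v)"

lemma total_add: "total (x + y) = total x + total y"
  unfolding total_def by (rule setsum_keys_plus_distrib) auto

lemma total_single [simp]: "total (single v n) = n"
  by (cases "n = 0") (auto simp: total_def)

lemma mon_img_single: "mon_img (single e n) = (\<Sum>w\<in>e. single w n)"
  by (cases "n = 0") (auto simp: mon_img_def)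

lemma diff_single_add:
  fixes a :: "'e \<Rightarrow>\<^sub>0 nat"
  assumes "e \<in> keys a" shows "a - single e 1 + single e 1 = a"
  using assms
  by (intro poly_mapping_eqI) (auto simp: lookup_add lookup_minus lookup_single when_def in_keys_iff)

lemma keys_diff_nat:
  fixes a b :: "'e \<Rightarrow>\<^sub>0 nat" shows "keys (a - b) \<subseteq> keys a"
  by (auto simp: in_keys_iff lookup_minus)

lemma keys_add_nat:
  fixes a b :: "'e \<Rightarrow>\<^sub>0 nat" shows "keys (a + b) = keys a \<union> keys b"
  by (auto simp: in_keys_iff lookup_add)

definition down_closed :: "('v \<Rightarrow>\<^sub>0 nat) set \<Rightarrow> bool" where
  "down_closed D \<longleftrightarrow> (\<forall>x y. x + y \<in> D \<longrightarrow> x \<in> D)"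

definition inc :: "'v set \<Rightarrow> 'v \<Rightarrow> rat" where
  "inc e = (\<lambda>v. if v \<in> e then 1 else 0)"

lemma inj_inc: "inj inc"
  by (rule injI) (auto simp: inc_def fun_eq_iff split: if_splits)

lemma common_denominator:
  fixes z :: "'e \<Rightarrow> rat"
  assumes "finite X"
  shows "\<exists>n>0. \<forall>x\<in>X. \<exists>k::int. rat_of_nat n * z x = of_int k"
  using assms
proof (induction X rule: finite_induct)
  case empty then show ?case by (auto intro: exI[of _ 1])
next
  case (insert y X)
  then obtain n where n: "n > 0" "\<And>x. x \<in> X \<Longrightarrow> \<exists>k::int. rat_of_nat n * z x = of_int k" by blast
  obtain p q where pq: "quotient_of (z y) = (p, q)" by (cases "quotient_of (z y)")
  have q: "q > 0" "z y = of_int p / of_int q"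
    using pq quotient_of_denom_pos quotient_of_div by auto
  have eq: "rat_of_nat (n * nat q) = of_nat n * of_int q" using q(1) by simp
  have "\<exists>k::int. rat_of_nat (n * nat q) * z x = of_int k" if x: "x \<in> insert y X" for x
  proof (cases "x = y")
    case True
    then have "rat_of_nat (n * nat q) * z x = of_int (int n * p)"
      unfolding eq using q by simp
    then show ?thesis by blast
  next
    case False
    then obtain k :: int where "rat_of_nat n * z x = of_int k" using n(2) x by auto
    then have "rat_of_nat (n * nat q) * z x = of_int (k * q)"
      unfolding eq by (simp add: mult_ac)
    then show ?thesis by blast
  qed
  moreover have "n * nat q > 0" using n(1) q(1) by simp
  ultimately show ?case by blast
qed

locale sgraph =
  fixes V :: "'v set" and E :: "'v set set"
  assumes graph: "simple_graph V E"
begin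

lemma edgeE:
  assumes "e \<in> E"
  obtains u w where "u \<noteq> w" "e = {u, w}" "u \<in> V" "w \<in> V"
  using assms graph unfolding simple_graph_def by blast

lemma finite_V: "finite V"
  using graph by (simp add: simple_graph_def)

lemma finite_E: "finite E"
proof -
  have "E \<subseteq> Pow V" by (auto elim: edgeE)
  then show ?thesis using finite_V finite_subset by blast
qed

lemma finite_edge: "e \<in> E \<Longrightarrow> finite e"
  by (auto elim: edgeE)

lemma lookup_mon_img:
  assumes "keys a \<subseteq> E"
  shows "lookup (mon_img a) v = (\<Sum>e\<in>E. if v \<in> e then lookup a e else 0)"
proof -
  have *: "lookup (\<Sum>w\<in>e. single w (lookup a e)) v = (if v \<in> e then lookup a e else 0)" if "e \<in> E" for e
    using finite_edge[OF that] by (simp add: lookup_sum lookup_single when_def)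
  have "lookup (mon_img a) v = (\<Sum>e\<in>keys a. if v \<in> e then lookup a e else 0)"
    unfolding mon_img_def lookup_sum
    by (rule sum.cong) (use assms * in \<open>auto simp: lookup_sum\<close>)
  also have "\<dots> = (\<Sum>e\<in>E. if v \<in> e then lookup a e else 0)"
    by (rule sum.mono_neutral_left) (use assms finite_E in \<open>auto simp: in_keys_iff\<close>)
  finally show ?thesis .
qed

definition gens :: "('v \<Rightarrow>\<^sub>0 nat) set \<Rightarrow> ('v set \<Rightarrow> rat) set" where
  "gens D = {vec a b | a b. keys a \<subseteq> E \<and> keys b \<subseteq> E \<and> mon_img a = mon_img b \<and> mon_img a \<in> D}"

definition lat :: "('v \<Rightarrow>\<^sub>0 nat) set \<Rightarrow> ('v set \<Rightarrow> rat) set" where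
  "lat D = fv.span (gens D)"

lemma vec_in_lat:
  assumes "keys a \<subseteq> E" "keys b \<subseteq> E" "mon_img a = mon_img b" "mon_img a \<in> D"
  shows "vec a b \<in> lat D"
  unfolding lat_def gens_def using assms by (intro fv.span_base) blast

text \<open>A linear functional that kills the generators kills their span. Used in the
  contrapositive, it extracts an actual binomial from a lattice vector on which some functional is
  nonzero.\<close>

lemma lat_vanish:
  assumes "z \<in> lat D"
    and "\<And>a b. keys a \<subseteq> E \<Longrightarrow> keys b \<subseteq> E \<Longrightarrow> mon_img a = mon_img b \<Longrightarrow> mon_img a \<in> D \<Longrightarrow>
      (\<Sum>e\<in>F. k e * vec a b e) = 0"
  shows "(\<Sum>e\<in>F. k e * z e) = 0"
  using assms(1) unfolding lat_def
proof (induction rule: fv.span_induct_alt)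
  case base then show ?case by simp
next
  case (step c x y)
  have "(\<Sum>e\<in>F. k e * x e) = 0" using step(1) assms(2) by (auto simp: gens_def)
  then have "c * (\<Sum>e\<in>F. k e * x e) = 0" by simp
  then show ?case using step(2)
    by (simp add: sum_distrib_left sum.distrib algebra_simps)
qed

text \<open>After clearing denominators, the positive and negative parts of a kernel vector of the
  incidence matrix are exponents of two monomials with the same image.\<close>

lemma kernel_in_lat:
  assumes z0: "\<And>e. e \<notin> E \<Longrightarrow> z e = 0" and ker: "\<And>v. (\<Sum>e\<in>E. z e * inc e v) = 0"
  shows "z \<in> lat UNIV"
proof -
  obtain n where n: "n > 0" "\<forall>x\<in>E. \<exists>k::int. rat_of_nat n * z x = of_int k"
    using common_denominator[OF finite_E] by blast
  then obtain k :: "'v set \<Rightarrow> int" where k: "\<And>x. x \<in> E \<Longrightarrow> rat_of_nat n * z x = of_int (k x)"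
    by metis
  define a where "a = (\<Sum>e\<in>E. single e (nat (k e)))"
  define b where "b = (\<Sum>e\<in>E. single e (nat (- k e)))"
  have la: "lookup a e = (if e \<in> E then nat (k e) else 0)" for e
    unfolding a_def by (rule lookup_sum_single[OF finite_E])
  have lb: "lookup b e = (if e \<in> E then nat (- k e) else 0)" for e
    unfolding b_def by (rule lookup_sum_single[OF finite_E])
  have ka: "keys a \<subseteq> E" "keys b \<subseteq> E" by (auto simp: in_keys_iff la lb split: if_splits)
  have vab: "vec a b e = of_nat n * z e" for e
  proof (cases "e \<in> E")
    case True
    have "rat_of_nat (nat (k e)) - of_nat (nat (- k e)) = of_int (k e)"
      by (cases "k e \<ge> 0") auto
    then show ?thesis using True k by (simp add: vec_def la lb)
  qed (simp add: vec_def la lb z0)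
  have "mon_img a = mon_img b"
  proof (rule poly_mapping_eqI)
    fix v
    have "rat_of_nat (lookup (mon_img a) v) - of_nat (lookup (mon_img b) v)
        = (\<Sum>e\<in>E. (if v \<in> e then of_nat (lookup a e) else 0) - (if v \<in> e then of_nat (lookup b e) else 0))"
      unfolding lookup_mon_img[OF ka(1)] lookup_mon_img[OF ka(2)] of_nat_sum sum_subtractf
      by (intro arg_cong2[where f = "(-)"] sum.cong) auto
    also have "\<dots> = (\<Sum>e\<in>E. of_nat n * (z e * inc e v))"
      by (rule sum.cong) (use vab in \<open>auto simp: vec_def inc_def\<close>)
    also have "\<dots> = 0" using ker by (simp flip: sum_distrib_left)
    finally show "lookup (mon_img a) v = lookup (mon_img b) v" by simp
  qed
  then have "vec a b \<in> lat UNIV" by (intro vec_in_lat ka) auto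
  then have "fscale (1 / of_nat n) (vec a b) \<in> lat UNIV" unfolding lat_def by (rule fv.span_scale)
  moreover have "fscale (1 / of_nat n) (vec a b) = z" using n(1) by (auto simp: fun_eq_iff vab)
  ultimately show ?thesis by simp
qed

text \<open>\<open>card A\<close> is the rank of the incidence matrix. Since \<open>inc\<close> is
  injective, the basis of its column space can be indexed by edges.\<close>

lemma edge_basis:
  obtains A where "A \<subseteq> E" "\<And>c. (\<Sum>e\<in>A. fscale (c e) (inc e)) = 0 \<Longrightarrow> \<forall>e\<in>A. c e = 0"
    "\<And>e. e \<in> E \<Longrightarrow> inc e \<in> fv.span (inc ` A)"
proof -
  obtain B where B: "B \<subseteq> inc ` E" "fv.independent B" "inc ` E \<subseteq> fv.span B"
    using fv.maximal_independent_subset[of "inc ` E"] by blast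
  define A where "A = {e \<in> E. inc e \<in> B}"
  have AE: "A \<subseteq> E" and BA: "B = inc ` A" using B(1) by (auto simp: A_def)
  have fA: "finite A" using AE finite_E finite_subset by blast
  have inj: "inj_on inc A" using inj_inc by (rule inj_on_subset) auto
  show ?thesis
  proof (rule that[OF AE])
    fix c assume s: "(\<Sum>e\<in>A. fscale (c e) (inc e)) = 0"
    have "(\<Sum>v\<in>inc ` A. fscale (c (inv_into UNIV inc v)) v) = 0"
      using s by (simp add: sum.reindex[OF inj] inv_f_f[OF inj_inc])
    then have "c (inv_into UNIV inc v) = 0" if "v \<in> inc ` A" for v
      using fv.independentD[OF B(2), of "inc ` A" "\<lambda>v. c (inv_into UNIV inc v)" v] fA BA that by auto
    then show "\<forall>e\<in>A. c e = 0" using inv_f_f[OF inj_inc] by (metis imageI)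
  next
    show "inc e \<in> fv.span (inc ` A)" if "e \<in> E" for e using B(3) BA that by auto
  qed
qed

text \<open>The exponent vectors of a set of edges with independent incidence vectors separate the
  monomials in these edges modulo the toric ideal.\<close>

lemma toric_ideal_growth:
  assumes A: "A \<subseteq> E" "\<And>c. (\<Sum>e\<in>A. fscale (c e) (inc e)) = 0 \<Longrightarrow> \<forall>e\<in>A. c e = 0"
  shows "growth E (toric_ideal E :: (('v set \<Rightarrow>\<^sub>0 nat) \<Rightarrow>\<^sub>0 'k::field) set) (card A)"
  unfolding growth_def
\<comment> \<open>The factor 1 suffices: the exponents on \<open>A\<close> range over
  \<open>{..<N}\<close>, which gives \<open>N ^ card A\<close> monomials.\<close>
proof (rule exI[of _ 1], rule allI)
  fix N :: nat
  have fA: "finite A" using A(1) finite_E finite_subset by blast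
  define T where "T = (A \<rightarrow>\<^sub>E {..<N})"
  have fT: "finite T" and cT: "card T = N ^ card A"
    using fA by (auto simp: T_def card_PiE intro: finite_PiE)
  obtain h where h: "bij_betw h {..<N ^ card A} T"
    using ex_bij_betw_nat_finite[OF fT] cT by (auto simp: atLeast0LessThan)
  define m where "m x = (\<Sum>e\<in>A. single e (x e))" for x :: "'v set \<Rightarrow> nat"
  have lm: "lookup (m x) e = (if e \<in> A then x e else 0)" for x e
    unfolding m_def by (rule lookup_sum_single[OF fA])
  have km: "keys (m x) \<subseteq> E" for x using A(1) by (auto simp: in_keys_iff lm split: if_splits)
  have inj: "x = y" if xy: "x \<in> T" "y \<in> T" "mon_img (m x) = mon_img (m y)" for x y
  proof -
    have "(\<Sum>e\<in>A. fscale (of_nat (x e) - of_nat (y e)) (inc e)) = 0"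
    proof (rule ext)
      fix v
      have *: "lookup (mon_img (m z)) v = (\<Sum>e\<in>A. if v \<in> e then z e else 0)" for z
        unfolding lookup_mon_img[OF km]
        by (rule sum.mono_neutral_cong_right) (use A(1) finite_E in \<open>auto simp: lm\<close>)
      have "(\<Sum>e\<in>A. fscale (of_nat (x e) - of_nat (y e)) (inc e)) v
          = (\<Sum>e\<in>A. (if v \<in> e then rat_of_nat (x e) else 0) - (if v \<in> e then of_nat (y e) else 0))"
        unfolding sum_fun_apply by (rule sum.cong) (auto simp: inc_def)
      also have "\<dots> = of_nat (lookup (mon_img (m x)) v) - of_nat (lookup (mon_img (m y)) v)"
        unfolding * of_nat_sum sum_subtractf by (intro arg_cong2[where f = "(-)"] sum.cong) auto
      finally show "(\<Sum>e\<in>A. fscale (of_nat (x e) - of_nat (y e)) (inc e)) v = 0 v" using xy(3) by simp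
    qed
    from A(2)[OF this] have "\<forall>e\<in>A. x e = y e" by simp
    then show ?thesis using xy(1,2) unfolding T_def by (blast intro: PiE_ext)
  qed
  have "indep_mod E (toric_ideal E) (1 * N) (N ^ card A) (\<lambda>i. single (m (h i)) (1::'k))"
    unfolding indep_mod_def
  proof safe
    fix i assume i: "i < N ^ card A"
    then have hi: "h i \<in> T" using h by (auto simp: bij_betw_def)
    show "single (m (h i)) 1 \<in> edge_poly_carrier E" using km by (auto simp: edge_poly_carrier_def)
    have "h i e \<le> N" if "e \<in> A" for e using hi that by (force simp: T_def PiE_def Pi_def)
    then show "exp_bounded (1 * N) (single (m (h i)) (1::'k))" by (auto simp: exp_bounded_def lm)
    fix c :: "nat \<Rightarrow> 'k"
    assume "(\<Sum>i<N ^ card A. single 0 (c i) * single (m (h i)) 1) \<in> toric_ideal E"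
    then have "(\<Sum>j<N ^ card A. single (mon_img (m (h j))) (c j)) = 0"
      by (simp add: toric_ideal_def toric_map_push mult_single push_sum)
    then have "0 = (\<Sum>j<N ^ card A. lookup (single (mon_img (m (h j))) (c j)) (mon_img (m (h i))))"
      by (metis lookup_sum lookup_zero)
    also have "\<dots> = (\<Sum>j<N ^ card A. if j = i then c i else 0)"
    proof (rule sum.cong)
      fix j assume j: "j \<in> {..<N ^ card A}"
      then have "h j \<in> T" using h by (auto simp: bij_betw_def)
      then have "mon_img (m (h j)) = mon_img (m (h i)) \<longleftrightarrow> j = i"
        using inj[OF _ hi] h i j by (auto simp: bij_betw_def inj_on_def)
      then show "lookup (single (mon_img (m (h j))) (c j)) (mon_img (m (h i))) = (if j = i then c i else 0)"
        by (auto simp: lookup_single when_def)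
    qed simp
    finally show "c i = 0" using i by simp
  qed
  then show "\<exists>b. indep_mod E (toric_ideal E :: (('v set \<Rightarrow>\<^sub>0 nat) \<Rightarrow>\<^sub>0 'k) set) (1 * N) (N ^ card A) b"
    by blast
qed

text \<open>Each edge outside the column basis \<open>A\<close> yields a kernel vector with entry 1
  there, entry 0 at the other edges outside \<open>A\<close>, and minus its expansion coefficients
  on \<open>A\<close>. These vectors are independent, so the lattice has dimension at least
  \<open>card E\<close> minus the rank.\<close>

lemma card_le_spanning_lat:
  assumes A: "A \<subseteq> E" "\<And>e. e \<in> E \<Longrightarrow> inc e \<in> fv.span (inc ` A)"
    and G: "finite G" "lat UNIV \<subseteq> fv.span G"
  shows "card (E - A) \<le> card G"
proof -
  have fA: "finite A" using A(1) finite_E finite_subset by blast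
  have inj: "inj_on inc A" using inj_inc by (rule inj_on_subset) auto
  have "\<exists>k. inc e = (\<Sum>f\<in>A. fscale (k f) (inc f))" if "e \<in> E" for e
  proof -
    have "inc e \<in> range (\<lambda>u. \<Sum>v\<in>inc ` A. fscale (u v) v)"
      using A(2)[OF that] fA by (simp add: fv.span_finite)
    then obtain u where "inc e = (\<Sum>v\<in>inc ` A. fscale (u v) v)" by blast
    then show ?thesis by (auto simp: sum.reindex[OF inj])
  qed
  then obtain k where k: "\<And>e. e \<in> E \<Longrightarrow> inc e = (\<Sum>f\<in>A. fscale (k e f) (inc f))" by metis
  define z :: "'v set \<Rightarrow> 'v set \<Rightarrow> rat" where
    "z e x = (if x = e then 1 else if x \<in> A then - k e x else 0)" for e x
  have zl: "z e \<in> lat UNIV" if e: "e \<in> E - A" for e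
  proof (rule kernel_in_lat)
    fix v
    have "(\<Sum>x\<in>E. z e x * inc x v) = (\<Sum>x\<in>insert e A. z e x * inc x v)"
      by (rule sum.mono_neutral_right) (use e A(1) finite_E in \<open>auto simp: z_def\<close>)
    also have "\<dots> = inc e v + (\<Sum>x\<in>A. z e x * inc x v)"
      using e fA by (simp add: z_def)
    also have "(\<Sum>x\<in>A. z e x * inc x v) = (\<Sum>x\<in>A. - (k e x * inc x v))"
      by (rule sum.cong) (use e in \<open>auto simp: z_def\<close>)
    also have "\<dots> = - (\<Sum>f\<in>A. fscale (k e f) (inc f)) v" by (simp add: sum_fun_apply sum_negf)
    finally show "(\<Sum>x\<in>E. z e x * inc x v) = 0" using k[of e] e by simp
  qed (use e A(1) in \<open>auto simp: z_def\<close>)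
  show ?thesis
  proof (rule independent_family_card_le[of "E - A" z])
    fix c assume s: "(\<Sum>e\<in>E - A. fscale (c e) (z e)) = 0"
    show "\<forall>e\<in>E - A. c e = 0"
    proof
      fix x assume x: "x \<in> E - A"
      have "0 = (\<Sum>e\<in>E - A. c e * z e x)" using fun_cong[OF s, of x] by (simp add: sum_fun_apply)
      also have "\<dots> = (\<Sum>e\<in>E - A. if e = x then c x else 0)"
        by (rule sum.cong) (use x in \<open>auto simp: z_def\<close>)
      also have "\<dots> = c x" using x finite_E by simp
      finally show "c x = 0" by simp
    qed
  qed (use finite_E G zl in auto)
qed

section \<open>Fibres and minimal binomials\<close>

definition share :: "(('v set \<Rightarrow>\<^sub>0 nat) \<times> ('v set \<Rightarrow>\<^sub>0 nat)) set" where
  "share = {(a, b). keys a \<subseteq> E \<and> keys b \<subseteq> E \<and> mon_img a = mon_img b \<and> keys a \<inter> keys b \<noteq> {}}"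

lemma share_sym: "(a, b) \<in> share\<^sup>* \<Longrightarrow> (b, a) \<in> share\<^sup>*"
proof -
  have "sym share" by (auto simp: sym_def share_def)
  then show "(a, b) \<in> share\<^sup>* \<Longrightarrow> (b, a) \<in> share\<^sup>*" by (meson sym_rtrancl symD)
qed

lemma share_inv:
  assumes "(a, b) \<in> share\<^sup>*" "keys a \<subseteq> E"
  shows "keys b \<subseteq> E" "mon_img b = mon_img a"
  using assms by (induction rule: rtrancl_induct) (auto simp: share_def)

text \<open>A choice that depends only on the set of monomials reachable from \<open>a\<close>,
  hence only on the connected component.\<close>

definition rep :: "('v set \<Rightarrow>\<^sub>0 nat) \<Rightarrow> ('v set \<Rightarrow>\<^sub>0 nat)" where
  "rep a = (SOME x. (a, x) \<in> share\<^sup>*)"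

lemma rep_share: "(a, rep a) \<in> share\<^sup>*"
  unfolding rep_def by (rule someI[of _ a]) simp

lemma rep_eq:
  assumes "(a, b) \<in> share\<^sup>*" shows "rep a = rep b"
proof -
  have "(a, x) \<in> share\<^sup>* \<longleftrightarrow> (b, x) \<in> share\<^sup>*" for x
    using assms share_sym rtrancl_trans by metis
  then show ?thesis by (simp add: rep_def)
qed

definition base :: "('v \<Rightarrow>\<^sub>0 nat) \<Rightarrow> ('v set \<Rightarrow>\<^sub>0 nat)" where
  "base x = rep (SOME a. keys a \<subseteq> E \<and> mon_img a = x)"

lemma base_props:
  assumes "keys a \<subseteq> E"
  shows "keys (base (mon_img a)) \<subseteq> E" "mon_img (base (mon_img a)) = mon_img a"
    "rep (base (mon_img a)) = base (mon_img a)"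
proof -
  define s where "s = (SOME b. keys b \<subseteq> E \<and> mon_img b = mon_img a)"
  have "keys s \<subseteq> E \<and> mon_img s = mon_img a"
    unfolding s_def by (rule someI[of _ a]) (use assms in simp)
  then show "keys (base (mon_img a)) \<subseteq> E" "mon_img (base (mon_img a)) = mon_img a"
    "rep (base (mon_img a)) = base (mon_img a)"
    using share_inv[OF rep_share[of s]] rep_eq[OF rep_share[of s]]
    by (auto simp: base_def s_def[symmetric])
qed

definition minreps :: "('v set \<Rightarrow>\<^sub>0 nat) set" where
  "minreps = {a. keys a \<subseteq> E \<and> rep a = a \<and> a \<noteq> base (mon_img a)}"

definition minvec :: "('v set \<Rightarrow>\<^sub>0 nat) \<Rightarrow> 'v set \<Rightarrow> rat" where
  "minvec a = vec a (base (mon_img a))"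

text \<open>This functional vanishes on multiples of elements of the toric ideal by non-constant monomials.\<close>

definition fibsum :: "('v set \<Rightarrow>\<^sub>0 nat) \<Rightarrow> (('v set \<Rightarrow>\<^sub>0 nat) \<Rightarrow>\<^sub>0 'k::field) \<Rightarrow> 'k" where
  "fibsum a f = (\<Sum>x\<in>keys f. if (x, a) \<in> share\<^sup>* then lookup f x else 0)"

lemma fibsum_add: "fibsum a (f + g) = fibsum a f + fibsum a g"
  unfolding fibsum_def by (rule setsum_keys_plus_distrib) auto

lemma fibsum_zero [simp]: "fibsum a 0 = 0"
  by (simp add: fibsum_def)

lemma fibsum_sum: "fibsum a (sum f I) = (\<Sum>i\<in>I. fibsum a (f i))"
  by (induction I rule: infinite_finite_induct) (auto simp: fibsum_add)

lemma fibsum_single: "fibsum a (single x k) = (if (x, a) \<in> share\<^sup>* then k else 0)"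
  by (cases "k = 0") (auto simp: fibsum_def)

text \<open>Multiplication by a nonconstant \<open>c\<close> puts a common variable into all terms,
  so each fibre of \<open>g\<close> lands in one component. The sum then runs over no terms or over
  a whole fibre of \<open>g\<close>, and in the latter case it is \<open>k\<close> times a
  coefficient of the toric image, which is zero.\<close>

lemma fibsum_single_mult:
  assumes g: "g \<in> toric_ideal E" and c: "keys c \<subseteq> E"
  shows "fibsum a (single c k * g) = (if c = 0 then k * fibsum a g else 0)"
proof -
  have gE: "keys x \<subseteq> E" if "x \<in> keys g" for x
    using g that by (auto simp: toric_ideal_def edge_poly_carrier_def)
  have "single c k * g = (\<Sum>x\<in>keys g. single (c + x) (k * lookup g x))"
    using arg_cong[OF poly_mapping_eq_sum_single[of g], of "(*) (single c k)"]
    unfolding sum_distrib_left mult_single .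
  then have eq: "fibsum a (single c k * g)
      = (\<Sum>x\<in>keys g. if (c + x, a) \<in> share\<^sup>* then k * lookup g x else 0)"
    by (simp add: fibsum_sum fibsum_single)
  show ?thesis
  proof (cases "c = 0")
    case True
    have "fibsum a (single c k * g) = k * fibsum a g"
      unfolding eq by (simp add: True fibsum_def sum_distrib_left if_distrib cong: if_cong)
    then show ?thesis using True by simp
  next
    case False
    then obtain e where e: "e \<in> keys c" by (metis keys_eq_empty ex_in_conv)
    have sh: "(c + x, c + x') \<in> share" if "x \<in> keys g" "x' \<in> keys g" "mon_img x = mon_img x'" for x x'
      using that gE c e by (auto simp: share_def mon_img_add keys_add_nat)
    show ?thesis
    proof (cases "\<exists>x0\<in>keys g. (c + x0, a) \<in> share\<^sup>*")
      case True
      then obtain x0 where x0: "x0 \<in> keys g" "(c + x0, a) \<in> share\<^sup>*" by blast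
      have iff: "(c + x, a) \<in> share\<^sup>* \<longleftrightarrow> mon_img x = mon_img x0" if x: "x \<in> keys g" for x
      proof
        assume "(c + x, a) \<in> share\<^sup>*"
        then have "mon_img a = mon_img (c + x)" "mon_img a = mon_img (c + x0)"
          using share_inv(2)[of "c + x" a] share_inv(2)[of "c + x0" a] x0 gE x c
          by (auto simp: keys_add_nat)
        then show "mon_img x = mon_img x0" by (simp add: mon_img_add)
      next
        assume "mon_img x = mon_img x0"
        then show "(c + x, a) \<in> share\<^sup>*" using sh[OF x x0(1)] x0(2) by auto
      qed
      have "fibsum a (single c k * g) = (\<Sum>x\<in>keys g. if mon_img x = mon_img x0 then k * lookup g x else 0)"
        unfolding eq by (rule sum.cong) (use iff in auto)
      also have "\<dots> = k * lookup (push mon_img g) (mon_img x0)"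
        by (simp add: lookup_push sum_distrib_left sum.inter_filter if_distrib cong: if_cong)
      also have "\<dots> = 0" using g by (simp add: toric_ideal_def toric_map_push)
      finally show ?thesis using False by simp
    next
      case F: False
      then show ?thesis using False unfolding eq by (auto intro!: sum.neutral)
    qed
  qed
qed

text \<open>Only the constant term of the multiplier survives: the functional factors through the
  toric ideal modulo its product with the ideal of the variables.\<close>

lemma fibsum_mult:
  assumes g: "g \<in> toric_ideal E" and q: "q \<in> edge_poly_carrier E"
  shows "fibsum a (q * g) = lookup q 0 * fibsum a g"
proof -
  have "q * g = (\<Sum>c\<in>keys q. single c (lookup q c) * g)"
    using arg_cong[OF poly_mapping_eq_sum_single[of q], of "\<lambda>q. q * g"] unfolding sum_distrib_right .
  then have "fibsum a (q * g) = (\<Sum>c\<in>keys q. if c = 0 then lookup q c * fibsum a g else 0)"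
    unfolding fibsum_sum using q
    by (auto simp: fibsum_sum fibsum_single_mult[OF g] edge_poly_carrier_def intro!: sum.cong)
  also have "\<dots> = (\<Sum>c\<in>keys q. if c = 0 then lookup q 0 * fibsum a g else 0)"
    by (rule sum.cong) auto
  also have "\<dots> = lookup q 0 * fibsum a g" by (auto simp: in_keys_iff)
  finally show ?thesis .
qed

text \<open>An argument in the style of Nakayama: the functionals \<open>fibsum a\<close> for
  \<open>a \<in> M\<close> map the ideal onto a space of dimension \<open>card M\<close>, and by
  \<open>fibsum_mult\<close> the image is spanned by the images of the generators.\<close>

lemma card_minreps_le:
  fixes gs :: "(('v set \<Rightarrow>\<^sub>0 nat) \<Rightarrow>\<^sub>0 'k::field) list"
  assumes gs: "set gs \<subseteq> edge_poly_carrier E" "genideal (edge_poly_ring E) (set gs) = toric_ideal E"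
    and M: "finite M" "M \<subseteq> minreps"
  shows "card M \<le> length gs"
proof -
  interpret R: cring "edge_poly_ring E :: (('v set \<Rightarrow>\<^sub>0 nat) \<Rightarrow>\<^sub>0 'k) ring" by (rule edge_poly_cring)
  note iI = edge_poly_idealD[OF primeideal.axioms(1)[OF toric_ideal_prime[where ?'k = 'k, of E]]]
  define L :: "(('v set \<Rightarrow>\<^sub>0 nat) \<Rightarrow>\<^sub>0 'k) \<Rightarrow> ('v set \<Rightarrow>\<^sub>0 nat) \<Rightarrow> 'k"
    where "L f = (\<lambda>a. if a \<in> M then fibsum a f else 0)" for f
  \<comment> \<open>An ideal that contains the generators, hence the whole toric ideal.\<close>
  define J where "J = {f \<in> toric_ideal E. L f \<in> fv.span (L ` set gs)}"
  have "ideal J (edge_poly_ring E)"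
  proof (rule edge_poly_idealI)
    show "J \<subseteq> edge_poly_carrier E" using iI(1) by (auto simp: J_def)
    have "L 0 = 0" by (auto simp: L_def fun_eq_iff)
    then show "0 \<in> J" using iI(2) by (auto simp: J_def fv.span_zero)
  next
    fix p q assume "p \<in> J" "q \<in> J"
    moreover have "L (p + q) = L p + L q" by (auto simp: L_def fun_eq_iff fibsum_add)
    ultimately show "p + q \<in> J" using iI(3) by (auto simp: J_def intro: fv.span_add)
  next
    fix p q :: "('v set \<Rightarrow>\<^sub>0 nat) \<Rightarrow>\<^sub>0 'k" assume p: "p \<in> J" and q: "q \<in> edge_poly_carrier E"
    then have "L (q * p) = fscale (lookup q 0) (L p)"
      by (auto simp: J_def L_def fun_eq_iff fibsum_mult)
    then show "q * p \<in> J" using p q iI(4) by (auto simp: J_def intro: fv.span_scale)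
  qed
  moreover have "set gs \<subseteq> J"
    using gs R.genideal_self[of "set gs"] by (auto simp: J_def intro: fv.span_base)
  ultimately have sub: "toric_ideal E \<subseteq> J"
    using R.genideal_minimal gs(2) by metis
  have unit: "unit_fun a \<in> fv.span (L ` set gs)" if a: "a \<in> M" for a
  proof -
    define b where "b = base (mon_img a)"
    have a': "keys a \<subseteq> E" "rep a = a" "a \<noteq> b" using a M(2) by (auto simp: minreps_def b_def)
    have b': "keys b \<subseteq> E" "mon_img b = mon_img a" "rep b = b" using base_props[OF a'(1)] by (auto simp: b_def)
    \<comment> \<open>The binomial joining \<open>a\<close> to the base component. The latter is
      excluded from \<open>minreps\<close>, so only the coordinate \<open>a\<close> sees this
      binomial.\<close>
    define f :: "('v set \<Rightarrow>\<^sub>0 nat) \<Rightarrow>\<^sub>0 'k" where "f = single a 1 + single b (- 1)"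
    have "toric_map f = 0"
      by (simp add: f_def toric_map_push push_add b'(2) flip: single_add)
    moreover have "f \<in> edge_poly_carrier E"
      unfolding f_def by (intro edge_poly_carrier_closed) (use a' b' in \<open>auto simp: edge_poly_carrier_def\<close>)
    ultimately have "f \<in> J" using sub by (auto simp: toric_ideal_def)
    moreover have "L f = unit_fun a"
    proof (rule ext)
      fix x
      show "L f x = unit_fun a x"
      proof (cases "x \<in> M")
        case True
        then have x: "keys x \<subseteq> E" "rep x = x" "x \<noteq> base (mon_img x)" using M(2) by (auto simp: minreps_def)
        have "(a, x) \<in> share\<^sup>* \<longleftrightarrow> a = x" using rep_eq[of a x] a' x by auto
        moreover have "(b, x) \<notin> share\<^sup>*"
          using rep_eq[of b x] b' x share_inv[of b x] by (auto simp: b_def)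
        ultimately show ?thesis using True
          by (auto simp: L_def f_def fibsum_add fibsum_single unit_fun_def)
      qed (use a in \<open>auto simp: L_def unit_fun_def\<close>)
    qed
    ultimately show ?thesis by (simp add: J_def)
  qed
  have "card M \<le> card (L ` set gs)"
  proof (rule independent_family_card_le[of M unit_fun])
    fix c :: "('v set \<Rightarrow>\<^sub>0 nat) \<Rightarrow> 'k" assume s: "(\<Sum>a\<in>M. fscale (c a) (unit_fun a)) = 0"
    show "\<forall>a\<in>M. c a = 0"
    proof
      fix x assume x: "x \<in> M"
      have "0 = (\<Sum>a\<in>M. c a * unit_fun a x)" using fun_cong[OF s, of x] by (simp add: sum_fun_apply)
      also have "\<dots> = (\<Sum>a\<in>M. if a = x then c x else 0)"
        by (rule sum.cong) (auto simp: unit_fun_def)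
      also have "\<dots> = c x" using x M(1) by simp
      finally show "c x = 0" by simp
    qed
  qed (use M unit in auto)
  also have "\<dots> \<le> length gs" by (meson List.finite_set card_image_le card_length order_trans)
  finally show ?thesis .
qed

text \<open>Two monomials of one fibre that share a variable differ by a vector of smaller degree.\<close>

lemma lat_eq_span_minvec:
  assumes D: "down_closed D"
  shows "lat D = fv.span (minvec ` {a \<in> minreps. mon_img a \<in> D})" (is "_ = fv.span ?S")
proof
  define W where "W = fv.span ?S"
  have W: "0 \<in> W" "x \<in> W \<Longrightarrow> y \<in> W \<Longrightarrow> x + y \<in> W" "x \<in> W \<Longrightarrow> y \<in> W \<Longrightarrow> x - y \<in> W" for x y
    unfolding W_def by (auto intro: fv.span_zero fv.span_add fv.span_diff)
  have main: "vec a b \<in> W"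
    if "keys a \<subseteq> E" "keys b \<subseteq> E" "mon_img a = mon_img b" "mon_img a \<in> D" for a b
    using that
  proof (induction "total (mon_img a)" arbitrary: a b rule: less_induct)
    case less
    have one_step: "vec x y \<in> W" if xy: "(x, y) \<in> share" "mon_img x = mon_img a" for x y
    proof -
      obtain e where e: "e \<in> keys x" "e \<in> keys y" and k: "keys x \<subseteq> E" "keys y \<subseteq> E" "mon_img x = mon_img y"
        using xy by (auto simp: share_def)
      define x' y' where "x' = x - single e 1" and "y' = y - single e 1"
      have "x' + single e 1 = x" "y' + single e 1 = y"
        unfolding x'_def y'_def by (rule diff_single_add, rule e)+
      then have xe: "x = x' + single e 1" "y = y' + single e 1" by (simp_all only:)
      have k': "keys x' \<subseteq> E" "keys y' \<subseteq> E"        unfolding x'_def y'_def by (rule order_trans[OF keys_diff_nat], rule k)+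
      have mi: "mon_img x' + mon_img (single e 1) = mon_img a" "mon_img x' = mon_img y'"
        using k(3) xy(2) unfolding xe mon_img_add by auto
      obtain u w where uw: "u \<noteq> w" "e = {u, w}" using e(1) k(1) edgeE by (metis subsetD)
      have "total (mon_img (single e 1)) = 2"
        using uw by (simp add: mon_img_single total_add)
      then have "total (mon_img x') < total (mon_img a)"
        unfolding mi(1)[symmetric] total_add by simp
      moreover have "mon_img x' \<in> D" using D less.prems(4) unfolding mi(1)[symmetric] down_closed_def by blast
      ultimately have "vec x' y' \<in> W" using less.hyps[of x' y'] k' mi(2) by blast
      moreover have "vec x y = vec x' y'" unfolding xe vec_add by simp
      ultimately show ?thesis by simp
    qed
    have path: "vec x y \<in> W" if "(x, y) \<in> share\<^sup>*" "keys x \<subseteq> E" "mon_img x = mon_img a" for x y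
      using that
    proof (induction rule: rtrancl_induct)
      case base show ?case unfolding vec_self by (rule W)
    next
      case (step y z)
      have "mon_img y = mon_img a" using share_inv(2)[OF step(1)] step(4,5) by simp
      then have "vec y z \<in> W" using one_step step.hyps by blast
      moreover have "vec x y \<in> W" using step by blast
      ultimately show ?case using W(2) vec_trans[of x z y] by metis
    qed
    \<comment> \<open>Steps inside the component lead to its representative; a single
      \<open>minvec\<close> then leads to the base component.\<close>
    have tobase: "vec x (base (mon_img a)) \<in> W" if x: "keys x \<subseteq> E" "mon_img x = mon_img a" for x
    proof -
      have r: "keys (rep x) \<subseteq> E" "mon_img (rep x) = mon_img a" "rep (rep x) = rep x"
        using share_inv[OF rep_share x(1)] rep_eq[OF rep_share] x(2) by auto
      have "vec (rep x) (base (mon_img a)) \<in> W"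
      proof (cases "rep x = base (mon_img a)")
        case False
        then have "rep x \<in> {a \<in> minreps. mon_img a \<in> D}" using r less.prems(4) by (auto simp: minreps_def)
        then have "minvec (rep x) \<in> W" unfolding W_def by (intro fv.span_base) blast
        then show ?thesis using r by (simp add: minvec_def)
      qed (simp add: W)
      then show ?thesis
        using path[OF rep_share x] vec_trans[of x "base (mon_img a)" "rep x"] W(2) by metis
    qed
    have "vec a b = vec a (base (mon_img a)) - vec b (base (mon_img a))"
      by (simp add: vec_def fun_eq_iff)
    then show ?case using tobase[of a] tobase[of b] less.prems W(3) by metis
  qed
  show "lat D \<subseteq> fv.span ?S"
    unfolding lat_def by (rule fv.span_minimal) (use main in \<open>auto simp: gens_def W_def\<close>)
  have "minvec a \<in> gens D" if "a \<in> minreps" "mon_img a \<in> D" for a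
    using that base_props[of a] unfolding gens_def minvec_def minreps_def by fastforce
  then show "fv.span ?S \<subseteq> lat D" unfolding lat_def by (intro fv.span_mono) auto
qed

end

section \<open>Distributivity for complete intersections\<close>

locale ci_graph = sgraph V E for V :: "'v set" and E +
  fixes K :: "'k::field itself"
  assumes ci: "graph_complete_intersection K E"
begin

text \<open>The vectors span a space of dimension at least \<open>card (E - A)\<close>, while their
  index set has at most \<open>length gs\<close> elements, which is at most
  \<open>card E - card A\<close>. All these numbers must agree.\<close>

lemma minvec_basis: "inj_on minvec minreps" "fv.independent (minvec ` minreps)"
proof -
  obtain gs :: "(('v set \<Rightarrow>\<^sub>0 nat) \<Rightarrow>\<^sub>0 'k) list" where gs: "set gs \<subseteq> edge_poly_carrier E"
    "genideal (edge_poly_ring E) (set gs) = toric_ideal E"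
    "enat (length gs) = ideal_height (edge_poly_ring E) (toric_ideal E :: (('v set \<Rightarrow>\<^sub>0 nat) \<Rightarrow>\<^sub>0 'k) set)"
    using ci by (auto simp: graph_complete_intersection_def complete_intersection_ideal_def)
  obtain A where A: "A \<subseteq> E" "\<And>c. (\<Sum>e\<in>A. fscale (c e) (inc e)) = 0 \<Longrightarrow> \<forall>e\<in>A. c e = 0"
    "\<And>e. e \<in> E \<Longrightarrow> inc e \<in> fv.span (inc ` A)" using edge_basis by blast
  have "ideal_height (edge_poly_ring E) (toric_ideal E :: (('v set \<Rightarrow>\<^sub>0 nat) \<Rightarrow>\<^sub>0 'k) set)
      \<le> prime_height (edge_poly_ring E) (toric_ideal E :: (('v set \<Rightarrow>\<^sub>0 nat) \<Rightarrow>\<^sub>0 'k) set)"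
    unfolding ideal_height_def by (rule INF_lower) (use toric_ideal_prime in auto)
  also have "\<dots> \<le> enat (card E - card A)"
    by (rule prime_height_le[OF finite_E toric_ideal_growth[OF A(1,2)]])
  finally have len: "length gs \<le> card E - card A" using gs(3) by (metis enat_ord_simps(1))
  have cEA: "card (E - A) = card E - card A"
    using A(1) finite_E by (meson card_Diff_subset finite_subset)
  have M: "finite minreps" "card minreps \<le> length gs"
    using finite_if_finite_subsets_card_bdd[of minreps "length gs"] card_minreps_le[OF gs(1,2)] by blast+
  have lat: "lat UNIV = fv.span (minvec ` minreps)"
    using lat_eq_span_minvec[of UNIV] by (simp add: down_closed_def)
  \<comment> \<open>Any part of the vectors that still spans is this large; so neither a repetition
    nor a redundant vector is possible.\<close>
  have low: "card (E - A) \<le> card G" if "G \<subseteq> minvec ` minreps" "fv.span G = fv.span (minvec ` minreps)" for G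
    using card_le_spanning_lat[OF A(1,3)] that lat M(1) by (metis finite_imageI finite_subset order_refl)
  have "card minreps \<le> card (minvec ` minreps)" using low[of "minvec ` minreps"] M(2) len cEA by simp
  then show "inj_on minvec minreps" using M(1) by (metis card_image_le eq_card_imp_inj_on le_antisym)
  show "fv.independent (minvec ` minreps)"
  proof
    assume "fv.dependent (minvec ` minreps)"
    then obtain x where x: "x \<in> minvec ` minreps" "x \<in> fv.span (minvec ` minreps - {x})"
      by (auto simp: fv.dependent_def)
    then have "fv.span (minvec ` minreps - {x}) = fv.span (minvec ` minreps)"
      using fv.span_redundant[OF x(2)] by (simp add: insert_absorb)
    then have "card (E - A) \<le> card (minvec ` minreps - {x})" by (intro low) auto
    also have "\<dots> < card (minvec ` minreps)" using x(1) M(1) by (intro card_Diff1_less) auto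
    also have "\<dots> \<le> card minreps" by (rule card_image_le[OF M(1)])
    finally show False using M(2) len cEA by simp
  qed
qed

text \<open>Each of the sublattices is spanned by the basis vectors whose degree lies in its degree
  set, and for sets of basis vectors intersection distributes over union. Injectivity of
  \<open>minvec\<close> lets the intersection be formed on indices.\<close>

theorem lat_distrib:
  assumes D: "down_closed D" "down_closed D1" "down_closed D2"
    and z: "z1 + z2 \<in> lat D" "z1 \<in> lat D1" "z2 \<in> lat D2"
  obtains a c where "a \<in> lat (D \<inter> D1)" "c \<in> lat (D \<inter> D2)" "z1 + z2 = a + c"
proof -
  define F where "F D = {a \<in> minreps. mon_img a \<in> D}" for D
  have FM: "F D \<subseteq> minreps" for D by (auto simp: F_def)
  have lat: "lat D = fv.span (minvec ` F D)" if "down_closed D" for D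
    using lat_eq_span_minvec[OF that] by (simp add: F_def)
  have dc: "down_closed (D \<inter> D1)" "down_closed (D \<inter> D2)" using D by (auto simp: down_closed_def)
  have "z1 \<in> fv.span (minvec ` F D1 \<union> minvec ` F D2)" "z2 \<in> fv.span (minvec ` F D1 \<union> minvec ` F D2)"
    using z(2,3) lat D fv.span_mono[of "minvec ` F D1" "minvec ` F D1 \<union> minvec ` F D2"]
      fv.span_mono[of "minvec ` F D2" "minvec ` F D1 \<union> minvec ` F D2"] by auto
  then have zU: "z1 + z2 \<in> fv.span (minvec ` F D1 \<union> minvec ` F D2)" by (rule fv.span_add)
  have "z1 + z2 \<in> fv.span (minvec ` F D \<inter> (minvec ` F D1 \<union> minvec ` F D2))"
    by (rule span_Int_independent[OF minvec_basis(2)]) (use FM z(1) lat D zU in auto)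
  also have "minvec ` F D \<inter> (minvec ` F D1 \<union> minvec ` F D2)
      = minvec ` F (D \<inter> D1) \<union> minvec ` F (D \<inter> D2)"
    using minvec_basis(1) by (auto simp: F_def inj_on_def)
  finally show ?thesis
    using that unfolding fv.span_Un lat[OF dc(1)] lat[OF dc(2)] by blast
qed

end

section \<open>Walks and their alternating monomials\<close>

text \<open>Every second edge of a walk, beginning with the first. For an odd closed walk
  \<open>y # zs @ [y]\<close> the two alternating halves are \<open>alt\<close> of the whole list
  and \<open>alt zs\<close>.\<close>

fun alt :: "'v list \<Rightarrow> ('v set \<Rightarrow>\<^sub>0 nat)" where
  "alt (a # b # xs) = single {a, b} 1 + alt xs"
| "alt xs = 0"

definition vsum :: "'v list \<Rightarrow> ('v \<Rightarrow>\<^sub>0 nat)" where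
  "vsum xs = (\<Sum>x\<leftarrow>xs. single x 1)"

lemma vsum_simps [simp]:
  "vsum [] = 0" "vsum (x # xs) = single x 1 + vsum xs" "vsum (xs @ ys) = vsum xs + vsum ys"
  by (simp_all add: vsum_def)

lemma lookup_vsum: "lookup (vsum xs) v = count (mset xs) v"
  by (induction xs) (auto simp: lookup_add lookup_single when_def)

lemma keys_vsum: "keys (vsum xs) = set xs"
  by (auto simp: in_keys_iff lookup_vsum)

lemma keys_alt_subset: "e \<in> keys (alt xs) \<Longrightarrow> e \<subseteq> set xs"
  by (induction xs rule: alt.induct) (auto simp: keys_add_nat)

text \<open>The end \<open>b\<close> may equal \<open>a\<close>; this covers a cycle traversed from
  \<open>a\<close>, whose two halves have no common edge.\<close>

lemma alt_disjoint:
  "distinct (a # ds) \<Longrightarrow> b \<notin> set ds \<Longrightarrow> keys (alt (a # ds @ [b])) \<inter> keys (alt ds) = {}"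
proof (induction ds arbitrary: a rule: alt.induct)
  case (1 d d' ds)
  have IH: "keys (alt (d' # ds @ [b])) \<inter> keys (alt ds) = {}" using 1 by auto
  have "{a, d} \<notin> keys (alt ds)" using keys_alt_subset[of "{a, d}" ds] 1(2) by auto
  moreover have "{d, d'} \<notin> keys (alt (d' # ds @ [b]))"
    using keys_alt_subset[of "{d, d'}" "d' # ds @ [b]"] 1(2,3) by auto
  moreover have "{a, d} \<noteq> {d, d'}" using 1(2) by (auto simp: doubleton_eq_iff)
  ultimately show ?case using IH by (auto simp: keys_add_nat)
qed auto

definition walk :: "'v set set \<Rightarrow> 'v set \<Rightarrow> 'v list \<Rightarrow> bool" where
  "walk E S xs \<longleftrightarrow> xs \<noteq> [] \<and> set xs \<subseteq> S \<and> successively (\<lambda>u v. {u, v} \<in> E) xs"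

lemma walk_rev: "walk E S xs \<Longrightarrow> walk E S (rev xs)"
  by (auto simp: walk_def insert_commute)

lemma walk_append:
  "walk E S xs \<Longrightarrow> walk E S ys \<Longrightarrow> {last xs, hd ys} \<in> E \<Longrightarrow> walk E S (xs @ ys)"
  by (auto simp: walk_def successively_append_iff)

lemma walk_join:
  assumes "walk E S xs" "walk E S ys" "last xs = hd ys"
  shows "walk E S (xs @ tl ys)"
  using assms
  by (cases ys; cases "tl ys") (auto simp: walk_def successively_append_iff)

lemma walk_infix: "walk E S (xs @ ys @ zs) \<Longrightarrow> ys \<noteq> [] \<Longrightarrow> walk E S ys"
  by (auto simp: walk_def successively_append_iff)

lemma walk_mono: "walk E S xs \<Longrightarrow> S \<subseteq> T \<Longrightarrow> walk E T xs"
  by (auto simp: walk_def)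

lemma reach_in_walk:
  assumes "reach_in E S u v"
  shows "\<exists>xs. walk E S xs \<and> hd xs = u \<and> last xs = v"
proof -
  have uS: "u \<in> S" and r: "(u, v) \<in> {(x, y). x \<in> S \<and> y \<in> S \<and> {x, y} \<in> E}\<^sup>*"
    using assms by (auto simp: reach_in_def)
  from r show ?thesis
  proof (induction rule: rtrancl_induct)
    case base
    have "walk E S [u]" using uS by (simp add: walk_def)
    then show ?case by (intro exI[of _ "[u]"]) auto
  next
    case (step y z)
    then obtain xs where xs: "walk E S xs" "hd xs = u" "last xs = y" by blast
    have "walk E S (xs @ [z])" using xs step(2) by (intro walk_append) (auto simp: walk_def)
    then show ?case using xs by (intro exI[of _ "xs @ [z]"]) (auto simp: walk_def)
  qed
qed

text \<open>The base is listed at both ends, so an even list length means an odd number of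
  edges.\<close>

definition odd_closed :: "'v set set \<Rightarrow> 'v set \<Rightarrow> 'v \<Rightarrow> 'v list \<Rightarrow> bool" where
  "odd_closed E S y w \<longleftrightarrow> walk E S w \<and> hd w = y \<and> last w = y \<and> even (length w)"

lemma odd_closedE:
  assumes "odd_closed E S y w"
  obtains zs where "w = y # zs @ [y]" "even (length zs)"
proof -
  obtain zs0 where w: "w = y # zs0" using assms by (cases w) (auto simp: odd_closed_def walk_def)
  then have "zs0 \<noteq> []" using assms by (auto simp: odd_closed_def)
  moreover have "last zs0 = y" using assms w \<open>zs0 \<noteq> []\<close> by (simp add: odd_closed_def)
  ultimately obtain zs where "zs0 = zs @ [y]" by (metis append_butlast_last_id)
  then show ?thesis using that[of zs] assms w by (auto simp: odd_closed_def)
qed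

text \<open>An inner visit of \<open>y\<close> splits the walk into two closed walks at
  \<open>y\<close>, and exactly one of them is odd.\<close>

lemma odd_closed_strip:
  assumes "odd_closed E S y w"
  shows "\<exists>w'. odd_closed E S y w' \<and> mset w' \<subseteq># mset w \<and> count (mset w') y = 2"
  using assms
proof (induction "length w" arbitrary: w rule: less_induct)
  case less
  obtain zs where w: "w = y # zs @ [y]" "even (length zs)" using odd_closedE[OF less.prems] .
  show ?case
  proof (cases "y \<in> set zs")
    case False
    then have "count (mset w) y = 2" using w by (simp add: count_eq_zero_iff)
    then show ?thesis using less.prems by blast
  next
    case True
    then obtain as bs where z: "zs = as @ y # bs" by (meson split_list)
    have wk: "walk E S (y # as @ [y])" "walk E S (y # bs @ [y])"
      using less.prems walk_infix[of E S "[]" "y # as @ [y]" "bs @ [y]"]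
        walk_infix[of E S "y # as" "y # bs @ [y]" "[]"]
      unfolding w z by (auto simp: odd_closed_def)
    have "\<exists>w'. odd_closed E S y w' \<and> length w' < length w \<and> mset w' \<subseteq># mset w"
    proof (cases "even (length as)")
      case True
      then have "odd_closed E S y (y # as @ [y])" using wk by (simp add: odd_closed_def)
      then show ?thesis using w z by (intro exI[of _ "y # as @ [y]"]) (auto simp: subseteq_mset_def)
    next
      case False
      then have "odd_closed E S y (y # bs @ [y])" using wk w z by (simp add: odd_closed_def)
      then show ?thesis using w z by (intro exI[of _ "y # bs @ [y]"]) (auto simp: subseteq_mset_def)
    qed
    then show ?thesis using less.hyps by (meson subset_mset.order_trans)
  qed
qed

context sgraph
begin

lemma no_loop: "{x, x} \<notin> E"
  by (auto elim: edgeE simp: doubleton_eq_iff)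

lemma mon_img_edge:
  assumes "{a, b} \<in> E" shows "mon_img (single {a, b} 1) = single a 1 + single b 1"
proof -
  have "a \<noteq> b" using assms no_loop by auto
  then show ?thesis by (simp add: mon_img_single)
qed

lemma keys_alt:
  "successively (\<lambda>u v. {u, v} \<in> E) xs \<Longrightarrow> keys (alt xs) \<subseteq> E"
  by (induction xs rule: alt.induct) (auto simp: keys_add_nat successively_Cons)

lemma mon_img_alt:
  "successively (\<lambda>u v. {u, v} \<in> E) xs \<Longrightarrow> even (length xs) \<Longrightarrow> mon_img (alt xs) = vsum xs"
proof (induction xs rule: alt.induct)
  case (1 a b xs)
  then have "{a, b} \<in> E" "successively (\<lambda>u v. {u, v} \<in> E) xs" by (auto simp: successively_Cons)
  then show ?case using 1 by (simp add: mon_img_add mon_img_edge add.assoc del: One_nat_def)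
qed auto

lemma odd_closed_alt:
  assumes "odd_closed E S y (y # zs @ [y])"
  shows "keys (alt (y # zs @ [y])) \<subseteq> E" "keys (alt zs) \<subseteq> E"
    "mon_img (alt (y # zs @ [y])) = vsum (y # zs @ [y])" "mon_img (alt zs) = vsum zs"
proof -
  have s: "successively (\<lambda>u v. {u, v} \<in> E) (y # zs @ [y])" and ev: "even (length (y # zs @ [y]))"
    using assms by (auto simp: odd_closed_def walk_def)
  then have s': "successively (\<lambda>u v. {u, v} \<in> E) zs"
    by (auto simp: successively_append_iff successively_Cons)
  show "keys (alt (y # zs @ [y])) \<subseteq> E" "keys (alt zs) \<subseteq> E"
    using keys_alt[OF s] keys_alt[OF s'] by auto
  show "mon_img (alt (y # zs @ [y])) = vsum (y # zs @ [y])" by (rule mon_img_alt[OF s ev])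
  show "mon_img (alt zs) = vsum zs" by (rule mon_img_alt[OF s']) (use ev in auto)
qed

lemma edge_subset_keys_mon_img:
  assumes "keys f \<subseteq> E" "e \<in> keys f" shows "e \<subseteq> keys (mon_img f)"
proof
  fix v assume v: "v \<in> e"
  have "lookup f e \<le> lookup (mon_img f) v"
    unfolding lookup_mon_img[OF assms(1)]
    using member_le_sum[of e E "\<lambda>e. if v \<in> e then lookup f e else 0"] assms finite_E v by auto
  then show "v \<in> keys (mon_img f)" using assms(2) by (auto simp: in_keys_iff)
qed

lemma edge_at:
  assumes f: "keys f \<subseteq> E" and s: "lookup (mon_img f) s > 0"
  obtains t g where "{s, t} \<in> keys f" "keys g \<subseteq> keys f"
    "mon_img f = mon_img g + single s 1 + single t 1"
proof -
  have "\<exists>e\<in>E. (if s \<in> e then lookup f e else 0) \<noteq> 0"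
  proof (rule ccontr)
    assume "\<not> ?thesis"
    then have "(\<Sum>e\<in>E. if s \<in> e then lookup f e else 0) = 0" by (intro sum.neutral) auto
    then show False using s unfolding lookup_mon_img[OF f] by linarith
  qed
  then obtain e where e: "e \<in> E" "s \<in> e" "e \<in> keys f" by (auto simp: in_keys_iff split: if_splits)
  then obtain t where t: "e = {s, t}" by (metis edgeE insert_commute insert_iff singletonD)
  define g where "g = f - single e 1"
  have "g + single e 1 = f" unfolding g_def by (rule diff_single_add[OF e(3)])
  then have "mon_img f = mon_img g + mon_img (single e 1)" by (metis mon_img_add)
  then have "mon_img f = mon_img g + single s 1 + single t 1"
    using mon_img_edge[of s t] e t by (simp add: add.assoc)
  moreover have "keys g \<subseteq> keys f" unfolding g_def by (rule keys_diff_nat)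
  ultimately show ?thesis using that e t by blast
qed

text \<open>The surplus at \<open>s\<close> forces an edge of \<open>f'\<close> from
  \<open>s\<close> to some \<open>t\<close>. If \<open>t\<close> is not \<open>y\<close>, equality
  of degrees forces an edge of \<open>f\<close> from \<open>t\<close> to some \<open>s2\<close>;
  removing both edges moves the surplus to \<open>s2\<close>. The walk begins and ends with edges of
  \<open>f'\<close>, hence is odd, and uses up degree of \<open>f'\<close> only.\<close>

lemma alternating_walk:
  assumes "keys f \<subseteq> E" "keys f' \<subseteq> E" "\<And>e. e \<in> keys f \<union> keys f' \<Longrightarrow> e \<subseteq> S"
    and "mon_img f' = mon_img f + single s 1 + single y j"
  shows "\<exists>xs. walk E S xs \<and> hd xs = s \<and> last xs = y \<and> even (length xs) \<and>
    (\<forall>v. count (mset xs) v \<le> lookup (mon_img f') v)"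
  using assms
proof (induction "total (mon_img f')" arbitrary: f f' s rule: less_induct)
  case less
  have "lookup (mon_img f') s > 0" using less.prems(4) by (simp add: lookup_add)
  then obtain t g' where t: "{s, t} \<in> keys f'" and g': "keys g' \<subseteq> keys f'"
    "mon_img f' = mon_img g' + single s 1 + single t 1" using edge_at[OF less.prems(2)] by blast
  have st: "{s, t} \<in> E" "s \<in> S" "t \<in> S" using t less.prems(2,3) by blast+
  have eq: "mon_img g' + single t 1 = mon_img f + single y j"
  proof -
    have "(mon_img g' + single t 1) + single s 1 = (mon_img f + single y j) + single s 1"
      using less.prems(4) unfolding g'(2) by (simp only: ac_simps)
    then show ?thesis by (simp only: add_right_cancel)
  qed
  show ?case
  proof (cases "t = y")
    case True
    have "walk E S [s, y]" using st True by (simp add: walk_def)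
    moreover have "count (mset [s, y]) v \<le> lookup (mon_img f') v" for v
      unfolding g'(2) True by (simp add: lookup_add lookup_single when_def)
    ultimately show ?thesis by (intro exI[of _ "[s, y]"]) auto
  next
    case False
    have "lookup (mon_img f) t > 0"
      using arg_cong[OF eq, of "\<lambda>x. lookup x t"] False by (simp add: lookup_add lookup_single when_def)
    then obtain s2 g where s2: "{t, s2} \<in> keys f" and g: "keys g \<subseteq> keys f"
      "mon_img f = mon_img g + single t 1 + single s2 1" using edge_at[OF less.prems(1)] by blast
    have eq2: "mon_img g' = mon_img g + single s2 1 + single y j"
    proof -
      have "mon_img g' + single t 1 = (mon_img g + single s2 1 + single y j) + single t 1"
        using eq unfolding g(2) by (simp only: ac_simps)
      then show ?thesis by (simp only: add_right_cancel)
    qed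
    have tot: "total (mon_img g') < total (mon_img f')" unfolding g'(2) by (simp add: total_add)
    have kg: "keys g \<subseteq> E" "keys g' \<subseteq> E" "\<And>e. e \<in> keys g \<union> keys g' \<Longrightarrow> e \<subseteq> S"
      using less.prems(1-3) g(1) g'(1) by blast+
    obtain xs where xs: "walk E S xs" "hd xs = s2" "last xs = y" "even (length xs)"
      "\<And>v. count (mset xs) v \<le> lookup (mon_img g') v" using less.hyps[OF tot kg eq2] by blast
    have "walk E S (s # t # xs)"
      using xs st s2 less.prems(1) by (auto simp: walk_def successively_Cons)
    moreover have "count (mset (s # t # xs)) v \<le> lookup (mon_img f') v" for v
      unfolding g'(2) using xs(5)[of v] by (simp add: lookup_add lookup_single when_def)
    ultimately show ?thesis using xs by (intro exI[of _ "s # t # xs"]) (auto simp: walk_def)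
  qed
qed

text \<open>Otherwise the parity of walks from \<open>y\<close> would be a proper 2-colouring of
  \<open>B\<close>.\<close>

lemma odd_closed_exists:
  assumes conn: "connected_on E B" and nb: "\<not> bipartite_on E B" and y: "y \<in> B"
  shows "\<exists>w. odd_closed E B y w"
proof (rule ccontr)
  assume no: "\<not> ?thesis"
  define f where "f u \<longleftrightarrow> (\<exists>xs. walk E B xs \<and> hd xs = y \<and> last xs = u \<and> even (length xs))" for u
  have ex: "\<exists>xs. walk E B xs \<and> hd xs = y \<and> last xs = u" if "u \<in> B" for u
    using conn y that reach_in_walk unfolding connected_on_def by metis
  have "f u \<noteq> f w" if uw: "u \<in> B" "w \<in> B" "{u, w} \<in> E" for u w
  proof
    assume eq: "f u = f w"
    have "\<exists>xs ys. walk E B xs \<and> hd xs = y \<and> last xs = u \<and> walk E B ys \<and> hd ys = y \<and> last ys = w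
        \<and> even (length xs) = even (length ys)"
      using eq ex[OF uw(1)] ex[OF uw(2)] unfolding f_def by metis
    then obtain xs ys where x: "walk E B xs" "hd xs = y" "last xs = u" "walk E B ys" "hd ys = y"
      "last ys = w" "even (length xs) = even (length ys)" by blast
    have ne: "xs \<noteq> []" "ys \<noteq> []" using x by (auto simp: walk_def)
    have "walk E B (xs @ rev ys)"
      using x uw ne by (intro walk_append walk_rev) (auto simp: hd_rev)
    then have "odd_closed E B y (xs @ rev ys)"
      using x ne by (auto simp: odd_closed_def last_rev)
    then show False using no by blast
  qed
  then have "bipartite_on E B" unfolding bipartite_on_def by blast
  then show False using nb by blast
qed

end

section \<open>The minimum odd closed walk at a cut vertex\<close>

context ci_graph
begin

text \<open>An odd closed walk \<open>t\<close> on the far side of \<open>y\<close> completes every odd closed walk at \<open>y\<close> in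
  \<open>B\<close> to a binomial. Two of these differ by a vector supported in \<open>B\<close>, so distributivity yields
  one below both of them.\<close>

lemma odd_closed_meet:
  assumes BZ: "B \<inter> Z = {y}" and sep: "\<And>e. e \<in> E \<Longrightarrow> e \<subseteq> B \<union> Z \<Longrightarrow> e \<subseteq> B \<or> e \<subseteq> Z"
    and w: "odd_closed E B y w" and w': "odd_closed E B y w'" and t0: "odd_closed E Z y t0"
  shows "\<exists>w''. odd_closed E B y w'' \<and> mset w'' \<subseteq># mset w \<and> mset w'' \<subseteq># mset w'"
proof -
  obtain t where t: "odd_closed E Z y t" "count (mset t) y = 2" using odd_closed_strip[OF t0] by blast
  obtain zs where wz: "w = y # zs @ [y]" using odd_closedE[OF w] .
  obtain zs' where wz': "w' = y # zs' @ [y]" using odd_closedE[OF w'] .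
  obtain ts where tt: "t = y # ts @ [y]" using odd_closedE[OF t(1)] .
  have yts: "y \<notin> set ts" using t(2) by (simp add: tt count_eq_zero_iff)
  have sets: "set w \<subseteq> B" "set w' \<subseteq> B" "set t \<subseteq> Z"
    using w w' t by (auto simp: odd_closed_def walk_def)
  note aw = odd_closed_alt[OF w[unfolded wz], folded wz]
  note aw' = odd_closed_alt[OF w'[unfolded wz'], folded wz']
  note at = odd_closed_alt[OF t(1)[unfolded tt], folded tt]
  have ecase: "\<exists>u v. u \<noteq> v \<and> e = {u, v}" if "e \<in> E" for e using that edgeE by metis
  have notboth: "\<not> (e \<subseteq> B \<and> e \<subseteq> Z)" if "e \<in> E" for e
  proof
    assume "e \<subseteq> B \<and> e \<subseteq> Z"
    then have "e \<subseteq> {y}" using BZ by auto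
    then show False using ecase[OF that] by auto
  qed
  \<comment> \<open>The divisors of the degree of the binomial that completes \<open>u\<close> by
    \<open>t\<close>. The ends of \<open>t\<close> are left out, so \<open>y\<close> is allowed as
    often as it occurs in \<open>u\<close>.\<close>
  define D where "D u = {x :: 'v \<Rightarrow>\<^sub>0 nat. \<forall>v. lookup x v \<le> count (mset u + mset ts) v}" for u
  define D2 where "D2 = {x :: 'v \<Rightarrow>\<^sub>0 nat. keys x \<subseteq> B}"
  have dc: "down_closed (D u)" for u
    unfolding down_closed_def D_def by (auto simp: lookup_add intro: add_leD1)
  have dc2: "down_closed D2" unfolding down_closed_def D2_def by (auto simp: keys_add_nat)
  \<comment> \<open>\<open>z1\<close> completes \<open>w'\<close> and \<open>z1 + z2\<close>
    completes \<open>w\<close>. In the difference \<open>z2\<close> the walk \<open>t\<close>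
    cancels, so its degree is supported in \<open>B\<close>.\<close>
  define z1 where "z1 = vec (alt w' + alt ts) (alt zs' + alt t)"
  define z2 where "z2 = vec (alt w + alt zs') (alt zs + alt w')"
  have z12: "z1 + z2 = vec (alt w + alt ts) (alt zs + alt t)"
    by (auto simp: z1_def z2_def vec_def lookup_add fun_eq_iff)
  have m: "mon_img (alt w + alt ts) = vsum w + vsum ts" "mon_img (alt w' + alt ts) = vsum w' + vsum ts"
    "mon_img (alt w + alt zs') = vsum w + vsum zs'"
    by (simp_all only: mon_img_add aw aw' at)
  have m': "mon_img (alt zs + alt t) = vsum w + vsum ts" "mon_img (alt zs' + alt t) = vsum w' + vsum ts"
    "mon_img (alt zs + alt w') = vsum w + vsum zs'"
    unfolding mon_img_add aw aw' at unfolding wz wz' tt vsum_simps by (simp_all only: ac_simps)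
  have 1: "z1 + z2 \<in> lat (D w)"
    unfolding z12 by (rule vec_in_lat)
      (simp_all only: keys_add_nat m m' aw at Un_subset_iff simp_thms, simp add: D_def lookup_add lookup_vsum)
  have 2: "z1 \<in> lat (D w')"
    unfolding z1_def by (rule vec_in_lat)
      (simp_all only: keys_add_nat m m' aw' at Un_subset_iff simp_thms, simp add: D_def lookup_add lookup_vsum)
  have 3: "z2 \<in> lat D2"
    unfolding z2_def by (rule vec_in_lat)
      (simp_all only: keys_add_nat m m' aw aw' Un_subset_iff simp_thms,
        use sets in \<open>auto simp: D2_def keys_add_nat keys_vsum wz'\<close>)
  obtain a c where ac: "a \<in> lat (D w \<inter> D w')" "c \<in> lat (D w \<inter> D2)" "z1 + z2 = a + c"
    using lat_distrib[OF dc dc dc2 1 2 3] .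
  \<comment> \<open>Summing over the edges from \<open>y\<close> into \<open>Z\<close> kills vectors
    with degree in \<open>B\<close>, but gives -2 on \<open>z1 + z2\<close>: \<open>alt t\<close>
    has degree 2 at \<open>y\<close> and \<open>alt ts\<close> degree 0. So the sum is nonzero on
    the piece \<open>a\<close>.\<close>
  define F where "F = {e \<in> E. y \<in> e \<and> e \<subseteq> Z}"
  have fF: "finite F" using finite_E by (auto simp: F_def)
  have F0: "lookup f e = 0" if "keys f \<subseteq> E" "keys (mon_img f) \<subseteq> B" "e \<in> F" for f e
  proof (rule ccontr)
    assume "lookup f e \<noteq> 0"
    then have "e \<subseteq> B" using edge_subset_keys_mon_img[OF that(1), of e] that(2) by (auto simp: in_keys_iff)
    then show False using notboth that(3) by (auto simp: F_def)
  qed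
  have FZ: "(\<Sum>e\<in>F. lookup f e) = lookup (mon_img f) y" if "keys f \<subseteq> E" "keys (mon_img f) \<subseteq> Z" for f
    unfolding lookup_mon_img[OF that(1)]
    using edge_subset_keys_mon_img[OF that(1)] that(2) finite_E
    by (intro sum.mono_neutral_cong_left) (auto simp: F_def in_keys_iff)
  have "(\<Sum>e\<in>F. 1 * c e) = 0"
    by (rule lat_vanish[OF ac(2)]) (use F0 in \<open>auto simp: D2_def vec_def intro!: sum.neutral\<close>)
  moreover have "(\<Sum>e\<in>F. 1 * (z1 + z2) e) \<noteq> 0"
  proof -
    have "(\<Sum>e\<in>F. 1 * (z1 + z2) e) = (\<Sum>e\<in>F. rat_of_nat (lookup (alt ts) e) - of_nat (lookup (alt t) e))"
    proof (rule sum.cong)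
      fix e assume e: "e \<in> F"
      have "lookup (alt w) e = 0" "lookup (alt zs) e = 0"
        using F0[OF aw(1) _ e] F0[OF aw(2) _ e] sets(1) unfolding aw(3,4) keys_vsum by (auto simp: wz)
      then show "1 * (z1 + z2) e = of_nat (lookup (alt ts) e) - of_nat (lookup (alt t) e)"
        by (simp add: z12 vec_def lookup_add)
    qed simp
    also have "\<dots> = of_nat (\<Sum>e\<in>F. lookup (alt ts) e) - of_nat (\<Sum>e\<in>F. lookup (alt t) e)"
      by (simp add: sum_subtractf)
    also have "(\<Sum>e\<in>F. lookup (alt ts) e) = lookup (mon_img (alt ts)) y"
      by (rule FZ[OF at(2)]) (use sets(3) in \<open>unfold at(4) keys_vsum, auto simp: tt\<close>)
    also have "(\<Sum>e\<in>F. lookup (alt t) e) = lookup (mon_img (alt t)) y"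
      by (rule FZ[OF at(1)]) (use sets(3) in \<open>unfold at(3) keys_vsum, auto\<close>)
    also have "lookup (mon_img (alt ts)) y = 0" using yts at by (simp add: lookup_vsum count_eq_zero_iff)
    also have "lookup (mon_img (alt t)) y = 2" using t(2) at by (simp add: lookup_vsum)
    finally show ?thesis by simp
  qed
  ultimately have "(\<Sum>e\<in>F. 1 * a e) \<noteq> 0" unfolding ac(3) by (simp add: sum.distrib)
  then obtain f0 f0' where f0: "keys f0 \<subseteq> E" "keys f0' \<subseteq> E" "mon_img f0 = mon_img f0'"
    "mon_img f0 \<in> D w \<inter> D w'" "(\<Sum>e\<in>F. 1 * vec f0 f0' e) \<noteq> 0"
    using lat_vanish[OF ac(1), where F = F and k = "\<lambda>_. 1"] by metis
  have "(\<Sum>e\<in>F. 1 * vec f0 f0' e) = of_nat (\<Sum>e\<in>F. lookup f0 e) - of_nat (\<Sum>e\<in>F. lookup f0' e)"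
    by (simp add: vec_def sum_subtractf)
  then have "(\<Sum>e\<in>F. lookup f0 e) \<noteq> (\<Sum>e\<in>F. lookup f0' e)" using f0(5) by (metis diff_self)
  \<comment> \<open>Roles are chosen so that \<open>f'\<close> has fewer edges from \<open>y\<close>
    into \<open>Z\<close>; as the total degrees agree, it has more edges at \<open>y\<close> inside
    \<open>B\<close>.\<close>
  then obtain f f' where f: "keys f \<subseteq> E" "keys f' \<subseteq> E" "mon_img f = mon_img f'"
    "mon_img f' \<in> D w \<inter> D w'" "(\<Sum>e\<in>F. lookup f' e) < (\<Sum>e\<in>F. lookup f e)"
    using f0 by (metis linorder_neqE_nat)
  define r where "r f = (\<Sum>e\<in>{e \<in> E. e \<subseteq> B}. single e (lookup f e))" for f :: "'v set \<Rightarrow>\<^sub>0 nat"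
  have lr: "lookup (r f) e = (if e \<in> E \<and> e \<subseteq> B then lookup f e else 0)" for f e
    unfolding r_def using lookup_sum_single[of "{e \<in> E. e \<subseteq> B}" "lookup f" e] finite_E by auto
  have kr: "keys (r f) \<subseteq> E" "e \<in> keys (r f) \<Longrightarrow> e \<subseteq> B" for f e
    by (auto simp: in_keys_iff lr split: if_splits)
  have kBZ: "keys (mon_img f') \<subseteq> B \<union> Z"
  proof
    fix v assume "v \<in> keys (mon_img f')"
    then have "lookup (mon_img f') v > 0" by (simp add: in_keys_iff)
    moreover have "lookup (mon_img f') v \<le> count (mset w + mset ts) v" using f(4) by (auto simp: D_def)
    ultimately have "count (mset w + mset ts) v > 0" by linarith
    then have "v \<in> set w \<union> set ts" by (metis Un_iff count_greater_zero_iff set_mset_mset set_mset_union)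
    then show "v \<in> B \<union> Z" using sets by (auto simp: tt)
  qed
  \<comment> \<open>Restriction to the edges inside \<open>B\<close> preserves the degrees on
    \<open>B\<close> except at \<open>y\<close>, where just the edges of \<open>F\<close> are
    lost.\<close>
  have deg: "lookup (mon_img (r g)) v + (if v = y then \<Sum>e\<in>F. lookup g e else 0)
      = (if v \<in> B then lookup (mon_img g) v else 0)" if g: "keys g \<subseteq> E" "keys (mon_img g) \<subseteq> B \<union> Z" for g v
  proof -
    have gs: "e \<subseteq> B \<or> e \<subseteq> Z" if "e \<in> E" "lookup g e \<noteq> 0" for e
      using sep[OF that(1)] edge_subset_keys_mon_img[OF g(1), of e] g(2) that(2) by (auto simp: in_keys_iff)
    have Fs: "(if v = y then \<Sum>e\<in>F. lookup g e else 0)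
        = (\<Sum>e\<in>E. if v = y \<and> y \<in> e \<and> e \<subseteq> Z then lookup g e else 0)"
      unfolding F_def by (simp add: sum.inter_filter finite_E)
    have yB: "y \<in> B" "v \<in> B \<Longrightarrow> v \<in> Z \<Longrightarrow> v = y" using BZ by auto
    show ?thesis
    proof (cases "v \<in> B")
      case True
      have "lookup (mon_img (r g)) v + (if v = y then \<Sum>e\<in>F. lookup g e else 0)
        = (\<Sum>e\<in>E. (if v \<in> e then lookup (r g) e else 0) + (if v = y \<and> y \<in> e \<and> e \<subseteq> Z then lookup g e else 0))"
        unfolding Fs lookup_mon_img[OF kr(1)] sum.distrib ..
      also have "\<dots> = (\<Sum>e\<in>E. if v \<in> e then lookup g e else 0)"
      proof (rule sum.cong)
        fix e assume e: "e \<in> E"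
        show "(if v \<in> e then lookup (r g) e else 0) + (if v = y \<and> y \<in> e \<and> e \<subseteq> Z then lookup g e else 0)
          = (if v \<in> e then lookup g e else 0)"
          using gs[OF e] notboth[OF e] e yB True by (auto simp: lr)
      qed simp
      finally show ?thesis using True lookup_mon_img[OF g(1)] by simp
    next
      case False
      have "lookup (mon_img (r g)) v = 0"
        unfolding lookup_mon_img[OF kr(1)] using False by (intro sum.neutral) (auto simp: lr)
      then show ?thesis using False yB by auto
    qed
  qed
  \<comment> \<open>The surplus at \<open>y\<close>, positive by the choice of \<open>f'\<close>.
    One unit starts the alternating walk and the other \<open>j - 1\<close> go into its end term, so
    the walk closes up at \<open>y\<close>.\<close>
  define j where "j = (\<Sum>e\<in>F. lookup f e) - (\<Sum>e\<in>F. lookup f' e)"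
  have "mon_img (r f') = mon_img (r f) + single y 1 + single y (j - 1)"
  proof (rule poly_mapping_eqI)
    fix v
    show "lookup (mon_img (r f')) v = lookup (mon_img (r f) + single y 1 + single y (j - 1)) v"
    proof (cases "v = y")
      case True
      have "y \<in> B" using BZ by auto
      then have "lookup (mon_img (r f)) y + (\<Sum>e\<in>F. lookup f e)
          = lookup (mon_img (r f')) y + (\<Sum>e\<in>F. lookup f' e)"
        using deg[OF f(1), of y] deg[OF f(2), of y] kBZ f(3) by simp
      then have "lookup (mon_img (r f')) y = lookup (mon_img (r f)) y + 1 + (j - 1)"
        using f(5) unfolding j_def by linarith
      then show ?thesis using True by (simp add: lookup_add)
    next
      case False
      then have "lookup (mon_img (r f)) v = lookup (mon_img (r f')) v"
        using deg[OF f(1), of v] deg[OF f(2), of v] kBZ f(3) by simp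
      then show ?thesis using False by (simp add: lookup_add lookup_single when_def)
    qed
  qed
  then obtain xs where xs: "walk E B xs" "hd xs = y" "last xs = y" "even (length xs)"
    "\<And>v. count (mset xs) v \<le> lookup (mon_img (r f')) v"
    using alternating_walk[of "r f" "r f'" B y y "j - 1"] kr by blast
  \<comment> \<open>On \<open>B\<close> the summand \<open>mset ts\<close> contributes nothing to
    the bound: \<open>ts\<close> lies in \<open>Z\<close> and omits \<open>y\<close>.\<close>
  have "count (mset xs) v \<le> count (mset u) v" if u: "u = w \<or> u = w'" for u v
  proof (cases "v \<in> B")
    case True
    have "v \<notin> set ts" using True BZ yts sets by (auto simp: tt)
    then have "count (mset u + mset ts) v = count (mset u) v" by (simp add: count_eq_zero_iff)
    moreover have "lookup (mon_img (r f')) v \<le> lookup (mon_img f') v"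
      using deg[OF f(2) kBZ, of v] True by (simp split: if_splits)
    moreover have "lookup (mon_img f') v \<le> count (mset u + mset ts) v" using f(4) u by (auto simp: D_def)
    ultimately show ?thesis
      using xs(5)[of v] by linarith
  next
    case False
    then have "v \<notin> set xs" using xs(1) by (auto simp: walk_def)
    then have "count (mset xs) v = 0" by (simp add: count_eq_zero_iff)
    then show ?thesis by linarith
  qed
  then have "mset xs \<subseteq># mset w" "mset xs \<subseteq># mset w'" by (auto simp: subseteq_mset_def)
  then show ?thesis using xs by (auto simp: odd_closed_def)
qed

text \<open>A shortest walk works: its lower bound with any \<open>w\<close> is no shorter, hence
  has the same multiset.\<close>

lemma minimum_odd_closed:
  assumes BZ: "B \<inter> Z = {y}" and sep: "\<And>e. e \<in> E \<Longrightarrow> e \<subseteq> B \<union> Z \<Longrightarrow> e \<subseteq> B \<or> e \<subseteq> Z"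
    and ex: "odd_closed E B y w1" "odd_closed E Z y t0"
  obtains w0 where "odd_closed E B y w0" "\<And>w. odd_closed E B y w \<Longrightarrow> mset w0 \<subseteq># mset w"
proof -
  obtain w0 where w0: "odd_closed E B y w0" "\<And>w. odd_closed E B y w \<Longrightarrow> length w0 \<le> length w"
    using ex_has_least_nat[of "odd_closed E B y" w1 length] ex(1) by blast
  show ?thesis
  proof (rule that[OF w0(1)])
    fix w assume w: "odd_closed E B y w"
    obtain w'' where w'': "odd_closed E B y w''" "mset w'' \<subseteq># mset w0" "mset w'' \<subseteq># mset w"
      using odd_closed_meet[OF BZ sep w0(1) w ex(2)] by blast
    have "size (mset w0) \<le> size (mset w'')" using w0(2)[OF w''(1)] by simp
    then have "mset w'' = mset w0" using w''(2) mset_subset_size[of "mset w''" "mset w0"]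
      by (metis linorder_not_less subset_mset.le_imp_less_or_eq)
    then show "mset w0 \<subseteq># mset w" using w''(3) by simp
  qed
qed

end

text \<open>Go along \<open>P\<close>, around \<open>w\<close> and back; the edges of
  \<open>P\<close> are counted twice, so the parity is kept.\<close>

lemma odd_closed_shift:
  assumes P: "walk E S P" "hd P = y" "last P = t" and w: "odd_closed E S t w"
  shows "\<exists>w'. odd_closed E S y w'"
proof -
  obtain ds where ds: "w = t # ds @ [t]" "even (length ds)" using odd_closedE[OF w] .
  have "walk E S (t # ds @ [t])" using w ds by (simp add: odd_closed_def)
  from walk_join[OF P(1) this] have w1: "walk E S (P @ ds @ [t])" using P by simp
  have Pn: "P \<noteq> []" using P by (auto simp: walk_def)
  have "walk E S ((P @ ds @ [t]) @ tl (rev P))"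
    by (rule walk_join[OF w1 walk_rev[OF P(1)]]) (use P Pn in \<open>auto simp: hd_rev\<close>)
  moreover have "last ((P @ ds @ [t]) @ tl (rev P)) = y"
  proof (cases "tl (rev P) = []")
    case True
    then have "P = [last P]" using Pn by (cases P rule: rev_cases) auto
    then have "t = y" using P by (metis list.sel(1))
    then show ?thesis using True by simp
  next
    case False
    then have "last (tl (rev P)) = last (rev P)" by (simp add: last_tl)
    then show ?thesis using False P Pn by (simp add: last_rev)
  qed
  moreover have "even (length ((P @ ds @ [t]) @ tl (rev P)))" using ds Pn by (cases P) auto
  ultimately have "odd_closed E S y ((P @ ds @ [t]) @ tl (rev P))" using P Pn by (simp add: odd_closed_def)
  then show ?thesis by blast
qed

section \<open>Chordless cycles\<close>

text \<open>Replaces indices modulo the length by the list closed up with its head, so that cycles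
  can be handled as walks.\<close>

lemma cyclic_nth_iff_successively:
  assumes "xs \<noteq> []"
  shows "(\<forall>i<length xs. Q (xs ! i) (xs ! (Suc i mod length xs))) \<longleftrightarrow> successively Q (xs @ [hd xs])"
proof -
  have *: "(xs @ [hd xs]) ! Suc i = xs ! (Suc i mod length xs)" if "i < length xs" for i
    using that assms by (cases "Suc i = length xs") (auto simp: nth_append hd_conv_nth)
  show ?thesis unfolding successively_conv_nth using * by (auto simp: nth_append)
qed

lemma successively_rotate:
  assumes "successively Q ((xs @ ys) @ [hd (xs @ ys)])"
  shows "successively Q ((ys @ xs) @ [hd (ys @ xs)])"
  using assms by (cases "xs = []"; cases "ys = []") (auto simp: successively_append_iff)

lemma successively_all:
  "(\<And>a b. a \<in> set xs \<Longrightarrow> b \<in> set xs \<Longrightarrow> Q a b) \<Longrightarrow> successively Q xs"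
  by (induction xs rule: induct_list012) auto

text \<open>The cycle is rotated to start at \<open>x\<close>. The negated
  \<open>successively\<close> says that \<open>{u, v}\<close> is one of the consecutive pairs, so
  that it is no chord.\<close>

lemma chordless_cycleE:
  assumes "chordless_cycle E C" "x \<in> C"
  obtains zs where "distinct (x # zs)" "set (x # zs) = C" "length zs \<ge> 2" "walk E C (x # zs @ [x])"
    "\<And>u v. u \<in> C \<Longrightarrow> v \<in> C \<Longrightarrow> {u, v} \<in> E \<Longrightarrow> \<not> successively (\<lambda>a b. {u, v} \<noteq> {a, b}) (x # zs @ [x])"
proof -
  obtain cs where cs: "distinct cs" "set cs = C" "length cs \<ge> 3"
    "\<forall>i<length cs. {cs ! i, cs ! (Suc i mod length cs)} \<in> E"
    "\<forall>u\<in>C. \<forall>v\<in>C. {u, v} \<in> E \<longrightarrow> cyc_edge cs u v"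
    using assms(1) unfolding chordless_cycle_def by blast
  obtain as bs where x: "cs = as @ x # bs" using assms(2) cs(2) by (metis split_list)
  have ne: "cs \<noteq> []" using x by simp
  have s: "successively (\<lambda>u v. {u, v} \<in> E) (cs @ [hd cs])"
    using cs(4) cyclic_nth_iff_successively[OF ne, of "\<lambda>u v. {u, v} \<in> E"] by blast
  show ?thesis
  proof (rule that[of "bs @ as"])
    show "distinct (x # bs @ as)" "set (x # bs @ as) = C" "length (bs @ as) \<ge> 2"
      using cs(1-3) x by auto
    have "successively (\<lambda>u v. {u, v} \<in> E) (((x # bs) @ as) @ [hd ((x # bs) @ as)])"
      using s unfolding x by (rule successively_rotate)
    then show "walk E C (x # (bs @ as) @ [x])" using cs(2) x by (auto simp: walk_def)
    fix u v assume uv: "u \<in> C" "v \<in> C" "{u, v} \<in> E"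
    show "\<not> successively (\<lambda>a b. {u, v} \<noteq> {a, b}) (x # (bs @ as) @ [x])"
    proof
      assume "successively (\<lambda>a b. {u, v} \<noteq> {a, b}) (x # (bs @ as) @ [x])"
      then have "successively (\<lambda>a b. {u, v} \<noteq> {a, b}) (((x # bs) @ as) @ [hd ((x # bs) @ as)])" by simp
      then have "successively (\<lambda>a b. {u, v} \<noteq> {a, b}) (cs @ [hd cs])"
        unfolding x by (rule successively_rotate)
      then have "\<not> cyc_edge cs u v"
        using cyclic_nth_iff_successively[OF ne, of "\<lambda>a b. {u, v} \<noteq> {a, b}"] unfolding cyc_edge_def by blast
      then show False using cs(5) uv by blast
    qed
  qed
qed

lemma chordless_cycleI:
  assumes "distinct (x # zs)" "length zs \<ge> 2" "walk E S (x # zs @ [x])"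
    "\<And>u v. u \<in> set (x # zs) \<Longrightarrow> v \<in> set (x # zs) \<Longrightarrow> {u, v} \<in> E \<Longrightarrow>
      \<not> successively (\<lambda>a b. {u, v} \<noteq> {a, b}) (x # zs @ [x])"
  shows "chordless_cycle E (set (x # zs))"
  unfolding chordless_cycle_def
proof (intro exI conjI ballI impI)
  show "distinct (x # zs)" "set (x # zs) = set (x # zs)" "3 \<le> length (x # zs)" using assms by auto
  show "\<forall>i<length (x # zs). {(x # zs) ! i, (x # zs) ! (Suc i mod length (x # zs))} \<in> E"
    using assms(3) cyclic_nth_iff_successively[of "x # zs" "\<lambda>u v. {u, v} \<in> E"] by (simp add: walk_def)
  fix u v assume "u \<in> set (x # zs)" "v \<in> set (x # zs)" "{u, v} \<in> E"
  then have "\<not> successively (\<lambda>a b. {u, v} \<noteq> {a, b}) ((x # zs) @ [hd (x # zs)])" using assms(4) by simp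
  then show "cyc_edge (x # zs) u v"
    using cyclic_nth_iff_successively[of "x # zs" "\<lambda>a b. {u, v} \<noteq> {a, b}"] unfolding cyc_edge_def by blast
qed

lemma chordless_cycle_nbrs:
  assumes "distinct (x # zs)" "set (x # zs) = C" "length zs \<ge> 2" "walk E C (x # zs @ [x])"
    "\<And>u v. u \<in> C \<Longrightarrow> v \<in> C \<Longrightarrow> {u, v} \<in> E \<Longrightarrow> \<not> successively (\<lambda>a b. {u, v} \<noteq> {a, b}) (x # zs @ [x])"
  shows "{v \<in> C. {x, v} \<in> E} = {hd zs, last zs}" "hd zs \<noteq> last zs"
proof -
  obtain z zs' where z: "zs = z # zs'" "zs' \<noteq> []" using assms(3) by (cases zs; cases "tl zs") auto
  show "hd zs \<noteq> last zs" using assms(1) z by auto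
  have "v = hd zs \<or> v = last zs" if v: "v \<in> C" "{x, v} \<in> E" for v
  proof (rule ccontr)
    assume n: "\<not> ?thesis"
    have "successively (\<lambda>a b. {x, v} \<noteq> {a, b}) zs"
      by (rule successively_all) (use assms(1) in \<open>auto simp: doubleton_eq_iff\<close>)
    then have "successively (\<lambda>a b. {x, v} \<noteq> {a, b}) (x # zs @ [x])"
      using n z by (auto simp: successively_append_iff successively_Cons doubleton_eq_iff)
    then show False using assms(5)[OF _ v(1) v(2)] assms(2) by auto
  qed
  moreover have "{x, hd zs} \<in> E" "{x, last zs} \<in> E"
    using assms(4) z by (auto simp: walk_def successively_append_iff successively_Cons insert_commute)
  moreover have "hd zs \<in> C" "last zs \<in> C" using assms(2) z by auto
  ultimately show "{v \<in> C. {x, v} \<in> E} = {hd zs, last zs}" by blast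
qed

lemma chordless_cycle_card_nbrs:
  assumes "chordless_cycle E C" "x \<in> C"
  shows "card {v \<in> C. {x, v} \<in> E} = 2"
proof -
  obtain zs where z: "distinct (x # zs)" "set (x # zs) = C" "length zs \<ge> 2" "walk E C (x # zs @ [x])"
    "\<And>u v. u \<in> C \<Longrightarrow> v \<in> C \<Longrightarrow> {u, v} \<in> E \<Longrightarrow> \<not> successively (\<lambda>a b. {u, v} \<noteq> {a, b}) (x # zs @ [x])"
    using chordless_cycleE[OF assms] by metis
  show ?thesis using chordless_cycle_nbrs[OF z] by simp
qed

text \<open>Vertices have exactly two neighbours on either cycle, so \<open>C'\<close> already
  contains the neighbours in \<open>C\<close> of each of its vertices, and a tour of
  \<open>C\<close> never leaves it.\<close>

lemma chordless_cycle_subset_eq: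
  assumes C: "chordless_cycle E C" and C': "chordless_cycle E C'" and sub: "C' \<subseteq> C"
  shows "C' = C"
proof -
  have fin: "finite C" using C by (auto simp: chordless_cycle_def)
  have closed: "v \<in> C'" if "x \<in> C'" "v \<in> C" "{x, v} \<in> E" for x v
  proof -
    have "{v \<in> C'. {x, v} \<in> E} = {v \<in> C. {x, v} \<in> E}"
      by (rule card_subset_eq)
        (use fin sub that chordless_cycle_card_nbrs[OF C] chordless_cycle_card_nbrs[OF C'] in auto)
    then show ?thesis using that by blast
  qed
  obtain x where x: "x \<in> C'" using C' by (force simp: chordless_cycle_def)
  then obtain zs where z: "set (x # zs) = C" "walk E C (x # zs @ [x])"
    using chordless_cycleE[OF C] sub by (metis subsetD)
  have cl: "set zs \<subseteq> C'"
    if "successively (\<lambda>u v. {u, v} \<in> E) (x # zs)" "set (x # zs) \<subseteq> C" "x \<in> C'" for x zs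
    using that
  proof (induction zs arbitrary: x)
    case (Cons a zs)
    then have "a \<in> C'" using closed by auto
    then show ?case using Cons by auto
  qed simp
  have "successively (\<lambda>u v. {u, v} \<in> E) (x # zs)"
    using walk_infix[of E C "[]" "x # zs" "[x]"] z(2) by (simp add: walk_def)
  then have "set zs \<subseteq> C'" using cl z(1) x by blast
  then show ?thesis using x z(1) sub by auto
qed

lemma odd_chordless_closed_walk:
  assumes "odd_chordless_cycle E C" "x \<in> C"
  obtains zs where "distinct (x # zs)" "set (x # zs) = C" "odd_closed E C x (x # zs @ [x])"
proof -
  obtain zs where z: "distinct (x # zs)" "set (x # zs) = C" "walk E C (x # zs @ [x])"
    using chordless_cycleE[of E C x] assms by (metis odd_chordless_cycle_def)
  have "card C = Suc (length zs)" using distinct_card[OF z(1)] z(2) by simp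
  then have "even (length zs)" using assms(1) by (simp add: odd_chordless_cycle_def)
  then show ?thesis using that z by (simp add: odd_closed_def)
qed

context sgraph
begin

text \<open>The incidence matrix of an odd cycle has trivial kernel: the entries of a kernel vector
  change sign from each edge to the next, and a full tour has an odd number of sign changes. Edges
  not inside \<open>C\<close> are excluded by the degree.\<close>

lemma odd_cycle_lat_zero:
  assumes C: "odd_chordless_cycle E C" and z: "z \<in> lat {x. keys x \<subseteq> C}" and e: "e \<in> E"
  shows "z e = 0"
proof -
  have "(\<Sum>e\<in>{e}. 1 * z e) = 0"
  proof (rule lat_vanish[OF z])
    fix f f' assume f: "keys f \<subseteq> E" "keys f' \<subseteq> E" "mon_img f = mon_img f'" "mon_img f \<in> {x. keys x \<subseteq> C}"
    have out: "vec f f' e = 0" if "\<not> e \<subseteq> C" for e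
    proof -
      have "e \<notin> keys f" "e \<notin> keys f'"
        using that edge_subset_keys_mon_img[OF f(1), of e] edge_subset_keys_mon_img[OF f(2), of e] f(3,4)
        by auto
      then show ?thesis by (simp add: vec_def in_keys_iff)
    qed
    have bd: "(\<Sum>e\<in>E. if v \<in> e then vec f f' e else 0) = 0" for v
    proof -
      have "(\<Sum>e\<in>E. if v \<in> e then vec f f' e else 0)
        = (\<Sum>e\<in>E. of_nat (if v \<in> e then lookup f e else 0) - of_nat (if v \<in> e then lookup f' e else 0))"
        by (rule sum.cong) (auto simp: vec_def)
      also have "\<dots> = of_nat (lookup (mon_img f) v) - of_nat (lookup (mon_img f') v)"
        unfolding lookup_mon_img[OF f(1)] lookup_mon_img[OF f(2)] sum_subtractf by simp
      finally show ?thesis using f(3) by simp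
    qed
    have flip: "vec f f' {x, p} + vec f f' {x, q} = 0"
      if x: "x \<in> C" and pq: "p \<in> C" "q \<in> C" "{x, p} \<in> E" "{x, q} \<in> E" "p \<noteq> q" for x p q
    proof -
      have fin: "finite C" using C by (auto simp: odd_chordless_cycle_def chordless_cycle_def)
      have N: "{v \<in> C. {x, v} \<in> E} = {p, q}"
        by (rule sym, rule card_subset_eq)
          (use fin pq x C chordless_cycle_card_nbrs[of E C x] in \<open>auto simp: odd_chordless_cycle_def\<close>)
      have "0 = (\<Sum>e\<in>E. if x \<in> e then vec f f' e else 0)" using bd by simp
      also have "\<dots> = (\<Sum>e\<in>{{x, p}, {x, q}}. vec f f' e)"
      proof (rule sum.mono_neutral_cong_right)
        show "\<forall>e\<in>E - {{x, p}, {x, q}}. (if x \<in> e then vec f f' e else 0) = 0"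
        proof
          fix e assume e: "e \<in> E - {{x, p}, {x, q}}"
          show "(if x \<in> e then vec f f' e else 0) = 0"
          proof (cases "x \<in> e \<and> e \<subseteq> C")
            case True
            then obtain v where "e = {x, v}" using e edgeE by (metis Diff_iff insertE insert_commute singletonD)
            then have "v \<in> {v \<in> C. {x, v} \<in> E}" using True e by auto
            then show ?thesis using N e \<open>e = {x, v}\<close> by auto
          qed (use out in auto)
        qed
      qed (use pq finite_E in auto)
      also have "\<dots> = vec f f' {x, p} + vec f f' {x, q}"
        using pq(5) by (simp add: doubleton_eq_iff)
      finally show ?thesis by simp
    qed
    have zero: "vec f f' {x, v} = 0" if xv: "x \<in> C" "v \<in> C" "{x, v} \<in> E" for x v
    proof -
      obtain zs where zs: "distinct (x # zs)" "set (x # zs) = C" "length zs \<ge> 2" "walk E C (x # zs @ [x])"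
        "\<And>u v. u \<in> C \<Longrightarrow> v \<in> C \<Longrightarrow> {u, v} \<in> E \<Longrightarrow> \<not> successively (\<lambda>a b. {u, v} \<noteq> {a, b}) (x # zs @ [x])"
        using chordless_cycleE[of E C x] C xv by (metis odd_chordless_cycle_def)
      have "card C = Suc (length zs)" using distinct_card[OF zs(1)] zs(2) by simp
      then have ev: "even (length zs)" using C by (simp add: odd_chordless_cycle_def)
      define n us where "n = length zs" and "us = x # zs @ [x]"
      have lus: "length us = n + 2" by (simp add: us_def n_def)
      have uC: "us ! i \<in> C" if "i < n + 2" for i
        using that zs(4) lus nth_mem[of i us] by (auto simp: walk_def us_def)
      have uE: "{us ! i, us ! Suc i} \<in> E" if "i < n + 1" for i
        using zs(4) that lus successively_nth[of "\<lambda>u v. {u, v} \<in> E" us i] by (auto simp: walk_def us_def)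
      have ucs: "us ! i = (x # zs) ! i" if "i < n + 1" for i
        using that by (auto simp: us_def n_def nth_append nth_Cons split: nat.split)
      have ulast: "us ! (n + 1) = (x # zs) ! 0" by (simp add: us_def n_def nth_append)
      have ne: "us ! i \<noteq> us ! Suc (Suc i)" if i: "i < n" for i
      proof (cases "i = n - 1")
        case True
        have "i \<noteq> 0" using True zs(3) by (simp add: n_def)
        moreover have "us ! Suc (Suc i) = (x # zs) ! 0" using True i ulast by simp
        ultimately show ?thesis
          using ucs[of i] i nth_eq_iff_index_eq[OF zs(1), of i 0] by (simp add: n_def)
      next
        case False
        then show ?thesis
          using ucs[of i] ucs[of "Suc (Suc i)"] i nth_eq_iff_index_eq[OF zs(1), of i "Suc (Suc i)"]
          by (simp add: n_def)
      qed
      define d where "d i = vec f f' {us ! i, us ! Suc i}" for i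
      \<comment> \<open>The edges of the tour are numbered 0 to \<open>n\<close> with
        \<open>n\<close> even, so the first and the last, which meet at \<open>x\<close>, get equal
        entries; \<open>flip\<close> at \<open>x\<close> makes them opposite.\<close>
      have d: "i < n + 1 \<Longrightarrow> d i = (- 1) ^ i * d 0" for i
      proof (induction i)
        case (Suc i)
        have "vec f f' {us ! Suc i, us ! i} + vec f f' {us ! Suc i, us ! Suc (Suc i)} = 0"
          using Suc.prems uC[of i] uC[of "Suc i"] uC[of "Suc (Suc i)"] uE[of i] uE[of "Suc i"] ne[of i]
          by (intro flip) (auto simp: insert_commute)
        then have "d (Suc i) = - d i" by (simp add: d_def insert_commute add_eq_0_iff)
        then show ?case using Suc by simp
      qed simp
      have nb: "{v \<in> C. {x, v} \<in> E} = {hd zs, last zs}" "hd zs \<noteq> last zs"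
        using chordless_cycle_nbrs[OF zs] by auto
      have zne: "zs \<noteq> []" using zs(3) by auto
      have ends: "us ! Suc 0 = hd zs" "us ! n = last zs" "us ! 0 = x" "us ! Suc n = x"
        using zs(3) ulast last_conv_nth[of zs, OF zne]
        by (auto simp: us_def n_def hd_conv_nth nth_append nth_Cons split: nat.split)
      have "d n = d 0" using d[of n] ev by (simp add: n_def)
      then have eq: "vec f f' {x, last zs} = vec f f' {x, hd zs}"
        by (simp add: d_def ends insert_commute)
      have "vec f f' {x, hd zs} + vec f f' {x, last zs} = 0"
        by (rule flip) (use nb xv in auto)
      then have "vec f f' {x, hd zs} = 0" "vec f f' {x, last zs} = 0" using eq by auto
      moreover have "v \<in> {hd zs, last zs}" using nb(1) xv by blast
      ultimately show ?thesis by auto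
    qed
    obtain x v where "e = {x, v}" using e by (auto elim: edgeE)
    then have "vec f f' e = 0" using zero[of x v] out[of e] e by (cases "e \<subseteq> C") auto
    then show "(\<Sum>e\<in>{e}. 1 * vec f f' e) = 0" by simp
  qed
  then show ?thesis by simp
qed

section \<open>Minimum odd closed walks in biconnected graphs\<close>

text \<open>A repeated vertex \<open>x\<close> contradicts minimality once some odd closed walk is
  shorter or visits \<open>x\<close> only once. Connectedness of \<open>B - {x}\<close> gives the
  latter, by a path from \<open>y\<close> to the loop at \<open>x\<close> that avoids
  \<open>x\<close>.\<close>

lemma min_walk_distinct:
  assumes Bx: "\<And>x. x \<in> B \<Longrightarrow> connected_on E (B - {x})"
    and w0: "odd_closed E B y w0" and min: "\<And>w. odd_closed E B y w \<Longrightarrow> mset w0 \<subseteq># mset w"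
  obtains zs where "w0 = y # zs @ [y]" "distinct (y # zs)"
proof -
  have cnt: "count (mset w0) v \<le> count (mset w) v" if "odd_closed E B y w" for w v
    using min[OF that] by (simp add: subseteq_mset_def)
  have len: "length w0 \<le> length w" if "odd_closed E B y w" for w
    using size_mset_mono[OF min[OF that]] by simp
  obtain zs where z: "w0 = y # zs @ [y]" "even (length zs)" using odd_closedE[OF w0] .
  have wk: "walk E B w0" using w0 by (simp add: odd_closed_def)
  obtain w' where "odd_closed E B y w'" "count (mset w') y = 2" using odd_closed_strip[OF w0] by blast
  then have "count (mset w0) y \<le> 2" using cnt[of w' y] by simp
  then have yz: "y \<notin> set zs" by (simp add: z count_eq_zero_iff)
  have "distinct zs"
  proof (rule ccontr)
    assume "\<not> distinct zs"
    then obtain x a b c where dup: "zs = a @ [x] @ b @ [x] @ c" using not_distinct_decomp by blast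
    \<comment> \<open>Splitting at the first two visits keeps \<open>x\<close> out of
      \<open>as\<close> and \<open>bs\<close>, so the walks built from them below meet
      \<open>x\<close> exactly once.\<close>
    then obtain as rest where as: "zs = as @ x # rest" "x \<notin> set as" using split_list_first[of x zs] by auto
    have "count (mset zs) x \<ge> 2" unfolding dup by simp
    moreover have "count (mset as) x = 0" using as(2) by (simp add: count_eq_zero_iff)
    moreover have "count (mset zs) x = count (mset as) x + 1 + count (mset rest) x" unfolding as(1) by simp
    ultimately have "count (mset rest) x > 0" by linarith
    then have "x \<in> set rest" by (simp add: count_greater_zero_iff)
    then obtain bs cs where bs: "rest = bs @ x # cs" "x \<notin> set bs" using split_list_first[of x rest] by blast
    have w0': "w0 = y # as @ x # bs @ x # cs @ [y]" using z as bs by simp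
    have xB: "x \<in> B" "y \<in> B" using wk by (auto simp: walk_def w0')
    have xy: "x \<noteq> y" using yz as by auto
    have pre: "walk E B (y # as @ [x])"
      using walk_infix[of E B "[]" "y # as @ [x]" "bs @ x # cs @ [y]"] wk by (simp add: w0')
    show False
    proof (cases "even (length bs)")
      \<comment> \<open>The loop at \<open>x\<close> has an even number of edges and can be cut
        out.\<close>
      case False
      have "walk E B (x # cs @ [y])"
        using walk_infix[of E B "y # as @ x # bs" "x # cs @ [y]" "[]"] wk by (simp add: w0')
      from walk_join[OF pre this] have "walk E B (y # as @ x # cs @ [y])" by simp
      moreover have "even (length (y # as @ x # cs @ [y]))" using w0 False by (simp add: odd_closed_def w0')
      ultimately have "odd_closed E B y (y # as @ x # cs @ [y])" by (simp add: odd_closed_def)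
      from len[OF this] show False by (simp add: w0')
    next
      \<comment> \<open>The loop at \<open>x\<close> is odd. From its first vertex \<open>t\<close>
        one reaches \<open>x\<close> by one edge or around the rest of the loop, and these routes
        differ in parity; so one of the two walks \<open>N1\<close> and \<open>N2\<close> is
        odd.\<close>
      case True
      have bs0: "bs \<noteq> []"
        using wk no_loop[of x] by (auto simp: w0' walk_def successively_append_iff successively_Cons)
      then obtain t bs' where t: "bs = t # bs'" by (cases bs) auto
      have tB: "t \<in> B - {x}" using wk bs t by (auto simp: walk_def w0')
      have "reach_in E (B - {x}) y t" using Bx[OF xB(1)] tB xB xy unfolding connected_on_def by blast
      then obtain P where P: "walk E (B - {x}) P" "hd P = y" "last P = t" using reach_in_walk by metis
      have Pn: "P \<noteq> []" "x \<notin> set P" "walk E B P" using P by (auto simp: walk_def)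
      have m1: "walk E B (t # bs' @ [x])"
        using walk_infix[of E B "y # as @ [x]" "t # bs' @ [x]" "cs @ [y]"] wk by (simp add: w0' t)
      have m2: "walk E B [t, x]"
        using walk_rev[OF walk_infix[of E B "y # as" "[x, t]" "bs' @ x # cs @ [y]"]] wk by (simp add: w0' t)
      have ret: "walk E B (x # rev as @ [y])" using walk_rev[OF pre] by simp
      have "walk E B (P @ bs' @ [x])" using walk_join[OF Pn(3) m1] P by simp
      from walk_join[OF this ret] have N1: "walk E B (P @ bs' @ x # rev as @ [y])" by simp
      have "walk E B (P @ [x])" using walk_join[OF Pn(3) m2] P by simp
      from walk_join[OF this ret] have N2: "walk E B (P @ x # rev as @ [y])" by simp
      have c1: "count (mset (P @ bs' @ x # rev as @ [y])) x = 1"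
        "count (mset (P @ x # rev as @ [y])) x = 1"
        using Pn bs as xy t by (simp_all add: count_eq_zero_iff)
      have c0: "count (mset w0) x \<ge> 2" by (simp add: w0')
      have "odd (length bs')" using True t by simp
      then have "even (length (P @ bs' @ x # rev as @ [y])) \<or> even (length (P @ x # rev as @ [y]))" by auto
      then show False
      proof
        assume "even (length (P @ bs' @ x # rev as @ [y]))"
        then have "odd_closed E B y (P @ bs' @ x # rev as @ [y])" using N1 P Pn by (simp add: odd_closed_def)
        from cnt[OF this, of x] show False using c0 c1 by linarith
      next
        assume "even (length (P @ x # rev as @ [y]))"
        then have "odd_closed E B y (P @ x # rev as @ [y])" using N2 P Pn by (simp add: odd_closed_def)
        from cnt[OF this, of x] show False using c0 c1 by linarith
      qed
    qed
  qed
  then show ?thesis using that z yz by simp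
qed

text \<open>If parity permits, the chord replaces \<open>M\<close> and shortens the walk. Otherwise
  \<open>M\<close> and the chord form an odd cycle; reached along \<open>L\<close> it gives a walk
  that misses \<open>R\<close>, and reached from the other end one that misses \<open>L\<close>
  apart from \<open>y\<close>, though both must contain the minimum. The two exceptions are the
  edges of the closed walk itself.\<close>

lemma min_walk_no_chord:
  assumes w0: "odd_closed E B y (y # zs @ [y])" and d: "distinct (y # zs)"
    and min: "\<And>w. odd_closed E B y w \<Longrightarrow> mset (y # zs @ [y]) \<subseteq># mset w"
    and dec: "y # zs = L @ u # M @ v # R" and uv: "{u, v} \<in> E"
  shows "M = [] \<or> L = [] \<and> R = []"
proof (rule ccontr)
  assume n: "\<not> ?thesis"
  define w where "w = y # zs @ [y]"
  have w: "w = L @ u # M @ v # R @ [y]" using dec unfolding w_def by (metis append_Cons append_assoc)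
  have wk: "walk E B w" and ev: "even (length w)" using w0 by (auto simp: odd_closed_def w_def)
  have hy: "hd (L @ [u]) = y" using dec by (cases L) auto
  have dd: "distinct (L @ u # M @ v # R)" using d dec by simp
  have len: "length w \<le> length w'" if "odd_closed E B y w'" for w'
    using size_mset_mono[OF min[OF that]] by (simp add: w_def)
  have sub: "set w \<subseteq> set w'" if "odd_closed E B y w'" for w'
    using set_mset_mono[OF min[OF that]] by (simp add: w_def)
  have vu: "{v, u} \<in> E" using uv by (simp add: insert_commute)
  have pre: "walk E B (L @ [u])"
    using walk_infix[of E B "[]" "L @ [u]" "M @ v # R @ [y]"] wk by (simp add: w)
  have post: "walk E B (v # R @ [y])"
    using walk_infix[of E B "L @ u # M" "v # R @ [y]" "[]"] wk by (simp add: w)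
  show False
  proof (cases "even (length M)")
    case True
    have "walk E B ((L @ [u]) @ v # R @ [y])" by (rule walk_append[OF pre post]) (use uv in simp)
    moreover have "even (length ((L @ [u]) @ v # R @ [y]))" using ev True by (simp add: w)
    moreover have "hd ((L @ [u]) @ v # R @ [y]) = y" using hy by (cases L) auto
    ultimately have "odd_closed E B y ((L @ [u]) @ v # R @ [y])" by (simp add: odd_closed_def)
    from len[OF this] show False using n by (simp add: w)
  next
    case False
    have p1: "walk E B (L @ u # M @ [v])"
      using walk_infix[of E B "[]" "L @ u # M @ [v]" "R @ [y]"] wk by (simp add: w)
    have "walk E B ((L @ u # M @ [v]) @ rev (L @ [u]))"
      by (rule walk_append[OF p1 walk_rev[OF pre]]) (use vu in \<open>simp add: hd_rev\<close>)
    moreover have "hd ((L @ u # M @ [v]) @ rev (L @ [u])) = y" using hy by (cases L) auto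
    moreover have "last ((L @ u # M @ [v]) @ rev (L @ [u])) = y" using hy by (cases L) (auto simp: last_rev)
    ultimately have o1: "odd_closed E B y ((L @ u # M @ [v]) @ rev (L @ [u]))"
      using False by (simp add: odd_closed_def)
    have R: "R = []"
    proof (rule ccontr)
      assume "R \<noteq> []"
      then have "hd R \<in> set R" by simp
      moreover have "hd R \<in> set (L @ u # M @ [v])" using sub[OF o1] \<open>hd R \<in> set R\<close> by (auto simp: w)
      ultimately show False using dd by auto
    qed
    have p2: "walk E B (rev (u # M @ v # [y]))"
      using walk_rev[OF walk_infix[of E B L "u # M @ v # [y]" "[]"]] wk by (simp add: w R)
    have "walk E B (rev (u # M @ v # [y]) @ [v, y])"
      by (rule walk_append[OF p2]) (use post uv R in auto)
    then have o2: "odd_closed E B y (rev (u # M @ v # [y]) @ [v, y])"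
      using False by (simp add: odd_closed_def)
    obtain L' where L: "L = y # L'" using n R dec by (cases L) auto
    have "L' = []"
    proof (rule ccontr)
      assume "L' \<noteq> []"
      then have h: "hd L' \<in> set L'" by simp
      then have "hd L' \<in> set (rev (u # M @ v # [y]) @ [v, y])" using sub[OF o2] by (auto simp: w L)
      then show False using dd h by (auto simp: L R)
    qed
    \<comment> \<open>Now \<open>L\<close> is \<open>[y]\<close>, and the walk is a list of length
      \<open>length M + 4\<close>, which is odd.\<close>
    then show False using ev False by (simp add: w L R)
  qed
qed

lemma min_walk_chordless:
  assumes w0: "odd_closed E B y (y # zs @ [y])" and d: "distinct (y # zs)"
    and min: "\<And>w. odd_closed E B y w \<Longrightarrow> mset (y # zs @ [y]) \<subseteq># mset w"
  shows "odd_chordless_cycle E (set (y # zs))"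
proof -
  have ev: "even (length zs)" and wk: "walk E B (y # zs @ [y])" using w0 by (auto simp: odd_closed_def)
  have "zs \<noteq> []" using wk no_loop[of y] by (auto simp: walk_def)
  then have l2: "length zs \<ge> 2" using ev by (cases zs; cases "tl zs") auto
  have main: "\<not> successively (\<lambda>a b. {u, v} \<noteq> {a, b}) (y # zs @ [y])"
    if dec: "y # zs = L @ u # M @ v # R" and uv: "{u, v} \<in> E" for L u M v R
  proof -
    have w: "y # zs @ [y] = L @ u # M @ v # R @ [y]" using dec by (metis append_Cons append_assoc)
    from min_walk_no_chord[OF w0 d min dec uv] show ?thesis
    proof
      assume "M = []"
      then show ?thesis unfolding w by (simp add: successively_append_iff)
    next
      assume LR: "L = [] \<and> R = []"
      then have "u = y" using dec by simp
      then show ?thesis unfolding w using LR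
        by (auto simp: successively_append_iff successively_Cons insert_commute)
    qed
  qed
  have "chordless_cycle E (set (y # zs))"
  proof (rule chordless_cycleI[OF d l2 wk])
    fix u v assume uv: "u \<in> set (y # zs)" "v \<in> set (y # zs)" "{u, v} \<in> E"
    have "u \<noteq> v" using uv no_loop by auto
    obtain L X where X: "y # zs = L @ u # X" using uv(1) by (metis split_list)
    then have "v \<in> set L \<or> v \<in> set X" using uv(2) \<open>u \<noteq> v\<close> by (metis Un_iff set_ConsD set_append)
    then show "\<not> successively (\<lambda>a b. {u, v} \<noteq> {a, b}) (y # zs @ [y])"
    proof
      assume "v \<in> set X"
      then obtain M R where "X = M @ v # R" by (metis split_list)
      then show ?thesis using main X uv(3) by blast
    next
      assume "v \<in> set L"
      then obtain M R where L: "L = M @ v # R" by (metis split_list)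
      have "y # zs = M @ v # R @ u # X" using X L by simp
      from main[OF this] have "\<not> successively (\<lambda>a b. {v, u} \<noteq> {a, b}) (y # zs @ [y])"
        using uv(3) by (simp add: insert_commute)
      then show ?thesis by (simp add: insert_commute)
    qed
  qed
  moreover have "card (set (y # zs)) = Suc (length zs)" using distinct_card[OF d] by simp
  ultimately show ?thesis using ev by (simp add: odd_chordless_cycle_def)
qed

text \<open>If \<open>C\<close> missed \<open>x\<close>, a path from \<open>y\<close> to
  \<open>C\<close> inside \<open>B - {x}\<close>, a tour of \<open>C\<close> and the way back would
  be an odd closed walk without \<open>x\<close>.\<close>

lemma min_walk_subset_cycle:
  assumes Bx: "\<And>x. x \<in> B \<Longrightarrow> connected_on E (B - {x})" and y: "y \<in> B"
    and min: "\<And>w. odd_closed E B y w \<Longrightarrow> mset w0 \<subseteq># mset w"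
    and C: "odd_chordless_cycle E C" "C \<subseteq> B" and x: "x \<in> set w0" "x \<noteq> y" "x \<in> B"
  shows "x \<in> C"
proof (rule ccontr)
  assume xC: "x \<notin> C"
  obtain t where t: "t \<in> C" using C(1) by (force simp: odd_chordless_cycle_def chordless_cycle_def)
  obtain ds where ds: "odd_closed E C t (t # ds @ [t])" using odd_chordless_closed_walk[OF C(1) t] .
  have sub: "C \<subseteq> B - {x}" using C(2) xC by auto
  have ds': "odd_closed E (B - {x}) t (t # ds @ [t])"
    using ds walk_mono[OF _ sub] by (auto simp: odd_closed_def)
  have "reach_in E (B - {x}) y t"
    using Bx[OF x(3)] sub t y x(2) unfolding connected_on_def by blast
  then obtain P where P: "walk E (B - {x}) P" "hd P = y" "last P = t" using reach_in_walk by metis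
  obtain w where o: "odd_closed E (B - {x}) y w" using odd_closed_shift[OF P ds'] by blast
  then have "odd_closed E B y w" using walk_mono[of E "B - {x}" _ B] by (auto simp: odd_closed_def)
  from set_mset_mono[OF min[OF this]] have "x \<in> set w" using x(1) by auto
  then show False using o by (auto simp: odd_closed_def walk_def)
qed

end

section \<open>Odd chordless cycles that avoid the cut vertex\<close>

context ci_graph
begin

text \<open>The odd cycle through \<open>y\<close> and the two walks going once around \<open>C1\<close> and \<open>C2\<close> give lattice vectors whose
  difference avoids \<open>y\<close>; as the lattice of an odd cycle is trivial, distributivity moves the vector
  for \<open>C1\<close> into \<open>C1 \<inter> C2\<close>.\<close>

lemma far_cycle_subset:
  assumes w0: "odd_closed E S y (y # zs @ [y])"
    and C1: "odd_chordless_cycle E C1" "y \<notin> C1" "set zs \<subseteq> C1"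
    and C2: "odd_chordless_cycle E C2" "y \<notin> C2" "set zs \<subseteq> C2"
  shows "C1 \<subseteq> C2"
proof
  fix r assume r: "r \<in> C1"
  show "r \<in> C2"
  proof (rule ccontr)
    assume r2: "r \<notin> C2"
    have "zs \<noteq> []" using w0 no_loop[of y] by (auto simp: odd_closed_def walk_def)
    then obtain a zs' where az: "zs = a # zs'" by (cases zs) auto
    have a: "a \<in> C1" "a \<in> C2" using az C1(3) C2(3) by auto
    have yaE: "{y, a} \<in> E" using w0 by (auto simp: odd_closed_def walk_def az)
    obtain d1 where d1: "distinct (a # d1)" "set (a # d1) = C1" "odd_closed E C1 a (a # d1 @ [a])"
      using odd_chordless_closed_walk[OF C1(1) a(1)] .
    obtain d2 where d2: "distinct (a # d2)" "set (a # d2) = C2" "odd_closed E C2 a (a # d2 @ [a])"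
      using odd_chordless_closed_walk[OF C2(1) a(2)] .
    define w u1 u2 where "w = y # zs @ [y]" and "u1 = a # d1 @ [a]" and "u2 = a # d2 @ [a]"
    note A0 = odd_closed_alt[OF w0, folded w_def]
    note A1 = odd_closed_alt[OF d1(3), folded u1_def]
    note A2 = odd_closed_alt[OF d2(3), folded u2_def]
    \<comment> \<open>The halves of \<open>w\<close> differ by the square of \<open>y\<close>, those
      of a tour by the square of \<open>a\<close>; the doubled edge \<open>{y, a}\<close> supplies
      both, so \<open>w\<close> and a tour together give a binomial.\<close>
    define s where "s = single {y, a} (1::nat) + single {y, a} 1"
    have s: "keys s \<subseteq> E" "mon_img s = single y 1 + single a 1 + (single y 1 + single a 1)"
      using yaE mon_img_edge[OF yaE] by (auto simp: s_def keys_add_nat mon_img_add)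
    define D :: "'v set \<Rightarrow> ('v \<Rightarrow>\<^sub>0 nat) set" where "D X = {x. keys x \<subseteq> X}" for X
    have dc: "down_closed (D X)" for X by (auto simp: down_closed_def D_def keys_add_nat)
    \<comment> \<open>\<open>z1\<close> joins \<open>w\<close> to a tour of \<open>C2\<close> and
      \<open>z1 + z2\<close> joins it to a tour of \<open>C1\<close>. The difference pairs the two
      tours and does not involve \<open>y\<close>.\<close>
    define z1 where "z1 = vec (alt w + alt u2) (alt zs + (s + alt d2))"
    define z2 where "z2 = vec (alt u1 + alt d2) (alt d1 + alt u2)"
    have z12: "z1 + z2 = vec (alt w + alt u1) (alt zs + (s + alt d1))"
      by (auto simp: z1_def z2_def vec_def lookup_add fun_eq_iff)
    have m: "mon_img (alt w + alt u2) = vsum w + vsum u2" "mon_img (alt w + alt u1) = vsum w + vsum u1"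
      "mon_img (alt u1 + alt d2) = vsum u1 + vsum d2"
      by (simp_all only: mon_img_add A0 A1 A2)
    have m': "mon_img (alt zs + (s + alt d2)) = vsum w + vsum u2"
      "mon_img (alt zs + (s + alt d1)) = vsum w + vsum u1"
      "mon_img (alt d1 + alt u2) = vsum u1 + vsum d2"
      unfolding mon_img_add A0 A1 A2 s(2) unfolding w_def u1_def u2_def vsum_simps
      by (simp_all only: ac_simps add_0_left add_0_right)
    have sets: "set w \<subseteq> C1 \<union> {y}" "set w \<subseteq> C2 \<union> {y}" "set u1 \<subseteq> C1" "set u2 \<subseteq> C2" "set d2 \<subseteq> C2"
      using C1(3) C2(3) d1(2) d2(2) by (auto simp: w_def u1_def u2_def)
    have 1: "z1 + z2 \<in> lat (D (C1 \<union> {y}))"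
      unfolding z12 by (rule vec_in_lat)
        (simp_all only: keys_add_nat m m' A0 A1 s(1) Un_subset_iff simp_thms,
          use sets in \<open>auto simp: D_def keys_add_nat keys_vsum\<close>)
    have 2: "z1 \<in> lat (D (C2 \<union> {y}))"
      unfolding z1_def by (rule vec_in_lat)
        (simp_all only: keys_add_nat m m' A0 A2 s(1) Un_subset_iff simp_thms,
          use sets in \<open>auto simp: D_def keys_add_nat keys_vsum\<close>)
    have 3: "z2 \<in> lat (D (C1 \<union> C2))"
      unfolding z2_def by (rule vec_in_lat)
        (simp_all only: keys_add_nat m m' A1 A2 Un_subset_iff simp_thms,
          use sets in \<open>auto simp: D_def keys_add_nat keys_vsum\<close>)
    obtain p q where pq: "p \<in> lat (D (C1 \<union> {y}) \<inter> D (C2 \<union> {y}))" "q \<in> lat (D (C1 \<union> {y}) \<inter> D (C1 \<union> C2))"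
      "z1 + z2 = p + q" using lat_distrib[OF dc dc dc 1 2 3] .
    \<comment> \<open>An edge at \<open>r\<close> serves as test coordinate: \<open>p\<close> has no
      degree at \<open>r\<close>, \<open>q\<close> vanishes as a vector of an odd cycle, yet
      \<open>alt u1\<close> makes the entry of \<open>z1 + z2\<close> positive.\<close>
    have "lookup (mon_img (alt u1)) r > 0"
      unfolding A1(3) lookup_vsum using r d1(2) by (auto simp: u1_def)
    then obtain t where e: "{r, t} \<in> keys (alt u1)" using edge_at[OF A1(1)] by metis
    have eE: "{r, t} \<in> E" using e A1(1) by blast
    have ry: "r \<noteq> y" "r \<noteq> a" using r r2 C1(2) a(2) by auto
    have "(\<Sum>e\<in>{{r, t}}. 1 * p e) = 0"
    proof (rule lat_vanish[OF pq(1)])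
      fix f f' assume f: "keys f \<subseteq> E" "keys f' \<subseteq> E" "mon_img f = mon_img f'"
        "mon_img f \<in> D (C1 \<union> {y}) \<inter> D (C2 \<union> {y})"
      have "r \<notin> keys (mon_img f)" using f(4) r2 ry by (auto simp: D_def)
      then have "{r, t} \<notin> keys f" "{r, t} \<notin> keys f'"
        using edge_subset_keys_mon_img[OF f(1)] edge_subset_keys_mon_img[OF f(2)] f(3) by auto
      then show "(\<Sum>e\<in>{{r, t}}. 1 * vec f f' e) = 0" by (simp add: vec_def in_keys_iff)
    qed
    then have p0: "p {r, t} = 0" by simp
    \<comment> \<open>Because \<open>y \<notin> C2\<close>, the sets \<open>C1 \<union> {y}\<close>
      and \<open>C1 \<union> C2\<close> meet only in \<open>C1\<close>.\<close>
    have "D (C1 \<union> {y}) \<inter> D (C1 \<union> C2) \<subseteq> {x. keys x \<subseteq> C1}" using C2(2) by (auto simp: D_def)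
    then have "q \<in> lat {x. keys x \<subseteq> C1}"
      using pq(2) fv.span_mono[of "gens (D (C1 \<union> {y}) \<inter> D (C1 \<union> C2))" "gens {x. keys x \<subseteq> C1}"]
      unfolding lat_def gens_def by blast
    then have q0: "q {r, t} = 0" by (rule odd_cycle_lat_zero[OF C1(1) _ eE])
    have "r \<notin> set w" using r2 ry C2(3) by (auto simp: w_def)
    then have "{r, t} \<notin> keys (alt w)" "{r, t} \<notin> keys (alt zs)"
      using keys_alt_subset[of "{r, t}" w] keys_alt_subset[of "{r, t}" zs] by (auto simp: w_def)
    moreover have "{r, t} \<notin> keys s" using ry by (auto simp: s_def keys_add_nat doubleton_eq_iff)
    moreover have "{r, t} \<notin> keys (alt d1)"
      using alt_disjoint[OF d1(1), of a] d1(1) e unfolding u1_def by auto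
    ultimately have "(z1 + z2) {r, t} = of_nat (lookup (alt u1) {r, t})"
      unfolding z12 vec_def lookup_add by (simp add: in_keys_iff)
    then have "(z1 + z2) {r, t} \<noteq> 0" using e by (simp add: in_keys_iff)
    then show False unfolding pq(3) using p0 q0 by simp
  qed
qed

text \<open>What lies beyond \<open>y\<close> enters only through \<open>Z\<close> and an odd closed
  walk in it, so one statement serves both blocks.\<close>

theorem odd_cycles_at_cut_vertex:
  assumes Bc: "connected_on E B" and Bx: "\<And>x. x \<in> B \<Longrightarrow> connected_on E (B - {x})"
    and nb: "\<not> bipartite_on E B"
    and BZ: "B \<inter> Z = {y}" and sep: "\<And>e. e \<in> E \<Longrightarrow> e \<subseteq> B \<union> Z \<Longrightarrow> e \<subseteq> B \<or> e \<subseteq> Z"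
    and t: "odd_closed E Z y t"
  shows "card {C. C \<subseteq> B \<and> odd_chordless_cycle E C} \<le> 2"
    and "card {C. C \<subseteq> B \<and> odd_chordless_cycle E C \<and> y \<in> C} = 1"
    and "\<And>C. C \<subseteq> B \<Longrightarrow> odd_chordless_cycle E C \<Longrightarrow> y \<notin> C \<Longrightarrow> \<exists>u\<in>C. {u, y} \<in> E"
proof -
  have y: "y \<in> B" using BZ by auto
  obtain w1 where "odd_closed E B y w1" using odd_closed_exists[OF Bc nb y] by blast
  then obtain w0 where w0: "odd_closed E B y w0" and min: "\<And>w. odd_closed E B y w \<Longrightarrow> mset w0 \<subseteq># mset w"
    using minimum_odd_closed[OF BZ sep _ t] by metis
  obtain zs where z: "w0 = y # zs @ [y]" "distinct (y # zs)" using min_walk_distinct[OF Bx w0 min] .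
  define C0 where "C0 = set (y # zs)"
  have C0: "odd_chordless_cycle E C0"
    unfolding C0_def by (rule min_walk_chordless) (use w0 min z in auto)
  have C0B: "C0 \<subseteq> B" using w0 by (auto simp: C0_def odd_closed_def walk_def z)
  have thr: "C = C0" if C: "odd_chordless_cycle E C" "C \<subseteq> B" "y \<in> C" for C
  proof -
    obtain ds where ds: "set (y # ds) = C" "odd_closed E C y (y # ds @ [y])"
      using odd_chordless_closed_walk[OF C(1,3)] by metis
    have "odd_closed E B y (y # ds @ [y])" using ds(2) walk_mono C(2) by (auto simp: odd_closed_def)
    from set_mset_mono[OF min[OF this]] have "C0 \<subseteq> C" using ds(1) by (auto simp: C0_def z)
    then show ?thesis using chordless_cycle_subset_eq C0 C(1) by (metis odd_chordless_cycle_def)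
  qed
  have far: "set zs \<subseteq> C" if C: "odd_chordless_cycle E C" "C \<subseteq> B" for C
  proof
    fix x assume x: "x \<in> set zs"
    show "x \<in> C"
      by (rule min_walk_subset_cycle[OF Bx y min C]) (use x z C0B in \<open>auto simp: C0_def\<close>)
  qed
  have far_eq: "C1 = C2" if "odd_chordless_cycle E C1" "C1 \<subseteq> B" "y \<notin> C1"
      "odd_chordless_cycle E C2" "C2 \<subseteq> B" "y \<notin> C2" for C1 C2
    using far_cycle_subset[OF w0[unfolded z]] far that by (meson subset_antisym)
  have "{C. C \<subseteq> B \<and> odd_chordless_cycle E C \<and> y \<in> C} = {C0}"
  proof -
    have "y \<in> C0" by (simp add: C0_def)
    then show ?thesis using thr C0 C0B by blast
  qed
  then show "card {C. C \<subseteq> B \<and> odd_chordless_cycle E C \<and> y \<in> C} = 1" by simp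
  show "card {C. C \<subseteq> B \<and> odd_chordless_cycle E C} \<le> 2"
  proof (cases "\<exists>C. C \<subseteq> B \<and> odd_chordless_cycle E C \<and> y \<notin> C")
    case True
    then obtain C1 where C1: "C1 \<subseteq> B" "odd_chordless_cycle E C1" "y \<notin> C1" by blast
    have "{C. C \<subseteq> B \<and> odd_chordless_cycle E C} \<subseteq> {C0, C1}" using thr far_eq C1 by blast
    then have "card {C. C \<subseteq> B \<and> odd_chordless_cycle E C} \<le> card {C0, C1}" by (intro card_mono) auto
    also have "\<dots> \<le> 2" by (simp add: card_insert_le_m1)
    finally show ?thesis .
  next
    case False
    then have "{C. C \<subseteq> B \<and> odd_chordless_cycle E C} \<subseteq> {C0}" using thr by blast
    then have "card {C. C \<subseteq> B \<and> odd_chordless_cycle E C} \<le> card {C0}" by (intro card_mono) auto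
    then show ?thesis by simp
  qed
  fix C assume C: "C \<subseteq> B" "odd_chordless_cycle E C" "y \<notin> C"
  have wk: "walk E B (y # zs @ [y])" using w0 by (simp add: odd_closed_def z)
  then have "zs \<noteq> []" using no_loop[of y] by (auto simp: walk_def)
  \<comment> \<open>The vertex after \<open>y\<close> on \<open>C0\<close> is a neighbour of
    \<open>y\<close>, and it belongs to every odd chordless cycle of \<open>B\<close>: this is
    distance one.\<close>
  then have "hd zs \<in> C" "{hd zs, y} \<in> E"
    using far[OF C(2,1)] wk by (auto simp: walk_def successively_Cons insert_commute)
  then show "\<exists>u\<in>C. {u, y} \<in> E" by blast
qed

end

section \<open>Blocks\<close>

lemma reach_in_mono: "reach_in E S u v \<Longrightarrow> S \<subseteq> T \<Longrightarrow> reach_in E T u v"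
  unfolding reach_in_def
  using rtrancl_mono[of "{(x, y). x \<in> S \<and> y \<in> S \<and> {x, y} \<in> E}" "{(x, y). x \<in> T \<and> y \<in> T \<and> {x, y} \<in> E}"]
  by blast

lemma reach_in_trans: "reach_in E S u v \<Longrightarrow> reach_in E S v w \<Longrightarrow> reach_in E S u w"
  unfolding reach_in_def by auto

lemma reach_in_edge: "u \<in> S \<Longrightarrow> v \<in> S \<Longrightarrow> {u, v} \<in> E \<Longrightarrow> reach_in E S u v"
  unfolding reach_in_def by auto

lemma reach_in_refl: "u \<in> S \<Longrightarrow> reach_in E S u u"
  unfolding reach_in_def by auto

lemma connected_on_Un:
  assumes "connected_on E S" "connected_on E T" "x \<in> S" "x \<in> T"
  shows "connected_on E (S \<union> T)"
  unfolding connected_on_def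
proof (intro ballI)
  fix u v assume "u \<in> S \<union> T" "v \<in> S \<union> T"
  then have "reach_in E (S \<union> T) u x" "reach_in E (S \<union> T) x v"
    using assms reach_in_mono[of E S _ _ "S \<union> T"] reach_in_mono[of E T _ _ "S \<union> T"]
    unfolding connected_on_def by (metis Un_iff Un_upper1 Un_upper2)+
  then show "reach_in E (S \<union> T) u v" by (rule reach_in_trans)
qed

lemma walk_connected: "walk E S xs \<Longrightarrow> connected_on E (set xs)"
proof (induction xs rule: induct_list012)
  case (2 x) then show ?case by (simp add: connected_on_def reach_in_refl)
next
  case (3 x y zs)
  have "connected_on E {x, y}"
    using 3(3) by (auto simp: connected_on_def walk_def insert_commute intro: reach_in_refl reach_in_edge)
  moreover have "connected_on E (set (y # zs))" using 3 by (auto simp: walk_def)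
  ultimately have "connected_on E ({x, y} \<union> set (y # zs))" by (rule connected_on_Un[where x = y]) auto
  then show ?case by (simp add: insert_absorb)
qed (simp add: walk_def)

lemma walk_reach:
  assumes "walk E S xs" "v \<in> set xs"
  shows "reach_in E S (hd xs) v"
proof -
  have "reach_in E (set xs) (hd xs) v"
    using walk_connected[OF assms(1)] assms by (auto simp: connected_on_def walk_def)
  then show ?thesis using assms(1) by (auto simp: walk_def intro: reach_in_mono)
qed

lemma reach_in_distinct_walk:
  assumes "reach_in E S u v"
  obtains xs where "walk E S xs" "hd xs = u" "last xs = v" "distinct xs"
proof -
  define P where "P xs \<longleftrightarrow> walk E S xs \<and> hd xs = u \<and> last xs = v" for xs
  have "\<exists>xs. P xs" using reach_in_walk[OF assms] by (simp add: P_def)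
  then obtain xs where xs: "P xs" and min: "\<And>ys. P ys \<Longrightarrow> length xs \<le> length ys"
    using ex_has_least_nat[of P _ length] by blast
  have "distinct xs"
  proof (rule ccontr)
    assume "\<not> distinct xs"
    then obtain a x b c where d: "xs = a @ [x] @ b @ [x] @ c" using not_distinct_decomp by blast
    have "walk E S (a @ [x])" "walk E S (x # c)"
      using xs walk_infix[of E S "[]" "a @ [x]" "b @ [x] @ c"] walk_infix[of E S "a @ [x] @ b" "x # c" "[]"]
      by (auto simp: P_def d)
    from walk_join[OF this] have "walk E S (a @ x # c)" by simp
    moreover have "hd (a @ x # c) = u" "last (a @ x # c) = v" using xs by (cases a; auto simp: P_def d)+
    ultimately have "P (a @ x # c)" by (simp add: P_def)
    from min[OF this] show False by (simp add: d)
  qed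
  then show ?thesis using that xs by (auto simp: P_def)
qed

lemma biconnected_Diff:
  "biconnected_on E B \<Longrightarrow> connected_on E (B - {x})"
  by (cases "x \<in> B") (auto simp: biconnected_on_def)

text \<open>If two blocks shared two vertices, one of these would still join them after the deletion
  of any vertex; the union would be biconnected, against maximality.\<close>

lemma block_Int:
  assumes B: "is_block V E B" and B': "is_block V E B'" and ne: "B \<noteq> B'"
    and u: "u \<in> B" "u \<in> B'" and v: "v \<in> B" "v \<in> B'"
  shows "u = v"
proof (rule ccontr)
  assume uv: "u \<noteq> v"
  have bc: "biconnected_on E B" "biconnected_on E B'" using B B' by (auto simp: is_block_def)
  have "biconnected_on E (B \<union> B')"
    unfolding biconnected_on_def
  proof (intro conjI ballI)
    show "connected_on E (B \<union> B')"
      using bc u by (intro connected_on_Un[of E B B' u]) (auto simp: biconnected_on_def)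
    fix x
    obtain p where "p \<in> B" "p \<in> B'" "p \<noteq> x" using u v uv by metis
    then have "connected_on E ((B - {x}) \<union> (B' - {x}))"
      by (intro connected_on_Un[of E _ _ p] biconnected_Diff bc) auto
    then show "connected_on E (B \<union> B' - {x})" by (simp add: Un_Diff)
  qed (use u in auto)
  moreover have "B \<union> B' \<subseteq> V" using B B' by (auto simp: is_block_def)
  ultimately have "\<not> B \<subset> B \<union> B'" "\<not> B' \<subset> B \<union> B'" using B B' unfolding is_block_def by blast+
  then show False using ne by blast
qed

text \<open>A path that leaves \<open>B\<close> at \<open>y\<close> and returns at \<open>u\<close>
  is an ear, and adding an ear preserves biconnectedness. Walking in \<open>V - (B - {y})\<close>
  ensures that the path meets \<open>B\<close> only in \<open>y\<close>.\<close>

lemma block_no_ear: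
  assumes B: "is_block V E B" and y: "y \<in> B" and u: "u \<in> B" "u \<noteq> y"
    and r: "reach_in E (V - (B - {y})) y z" and z: "z \<noteq> y" "{z, u} \<in> E"
  shows False
proof -
  have bc: "biconnected_on E B" and BV: "B \<subseteq> V" using B by (auto simp: is_block_def)
  obtain xs where xs: "walk E (V - (B - {y})) xs" "hd xs = y" "last xs = z" "distinct xs"
    using reach_in_distinct_walk[OF r] .
  have xn: "xs \<noteq> []" and xV: "set xs \<subseteq> V - (B - {y})" using xs by (auto simp: walk_def)
  have yx: "y \<in> set xs" "z \<in> set xs" using xs xn hd_in_set last_in_set by metis+
  have xw: "walk E UNIV xs" using xs(1) by (auto simp: walk_def)
  \<comment> \<open>Deleting a vertex of the ear leaves an initial piece attached to
    \<open>B\<close> at \<open>y\<close> and a final piece attached at \<open>u\<close>; this is the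
    final piece.\<close>
  have suf: "connected_on E (set (bs @ [u]))" if "xs = as @ bs" "bs \<noteq> []" for as bs
  proof -
    have "walk E UNIV bs" using walk_infix[of E UNIV as bs "[]"] xw that by simp
    moreover have "last bs = z" using xs that by simp
    ultimately have "walk E UNIV (bs @ [u])" using z by (intro walk_append) (auto simp: walk_def)
    then show ?thesis by (rule walk_connected)
  qed
  have "biconnected_on E (B \<union> set xs)"
    unfolding biconnected_on_def
  proof (intro conjI ballI)
    show "connected_on E (B \<union> set xs)"
      using bc walk_connected[OF xw] y yx
      by (intro connected_on_Un[of E _ _ y]) (auto simp: biconnected_on_def)
    fix x assume x: "x \<in> B \<union> set xs"
    consider "x \<in> B" "x \<noteq> y" | "x = y" | "x \<notin> B" by blast
    then show "connected_on E (B \<union> set xs - {x})"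
    proof cases
      case 1
      then have "x \<notin> set xs" using xV by auto
      then have "B \<union> set xs - {x} = (B - {x}) \<union> set xs" by auto
      moreover have "connected_on E ((B - {x}) \<union> set xs)"
        using 1 y yx by (intro connected_on_Un[of E _ _ y] biconnected_Diff bc walk_connected[OF xw]) auto
      ultimately show ?thesis by simp
    next
      case 2
      obtain bs where bs: "xs = y # bs" using xs xn by (cases xs) auto
      have bn: "bs \<noteq> []" using xs z bs by auto
      have "B \<union> set xs - {x} = (B - {y}) \<union> set (bs @ [u])" using 2 u xs(4) bs by auto
      moreover have "connected_on E ((B - {y}) \<union> set (bs @ [u]))"
        using u suf[of "[y]" bs] bs bn by (intro connected_on_Un[of E _ _ u] biconnected_Diff bc) auto
      ultimately show ?thesis by simp
    next
      case 3
      then obtain as bs where ab: "xs = as @ x # bs" using x by (metis UnE split_list)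
      have an: "as \<noteq> []" "hd as = y" using xs 3 y ab by (cases as; auto)+
      have "walk E UNIV as" using walk_infix[of E UNIV "[]" as "x # bs"] xw an ab by simp
      then have c1: "connected_on E (B \<union> set as)"
        using bc y an hd_in_set[of as]
        by (intro connected_on_Un[of E _ _ y] walk_connected) (auto simp: biconnected_on_def)
      show ?thesis
      proof (cases "bs = []")
        case True
        then have "B \<union> set xs - {x} = B \<union> set as" using ab xs(4) 3 by auto
        then show ?thesis using c1 by simp
      next
        case False
        have "B \<union> set xs - {x} = (B \<union> set as) \<union> set (bs @ [u])" using ab xs(4) 3 u by auto
        moreover have "connected_on E ((B \<union> set as) \<union> set (bs @ [u]))"
          using u suf[of "as @ [x]" bs] ab False by (intro connected_on_Un[of E _ _ u] c1) auto
        ultimately show ?thesis by simp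
      qed
    qed
  qed (use y in auto)
  moreover have "B \<subset> B \<union> set xs" using yx(2) xV z(1) by auto
  moreover have "B \<union> set xs \<subseteq> V" using xV BV by auto
  ultimately show False using B unfolding is_block_def by blast
qed

section \<open>Paths in the block tree and the far side of a cut vertex\<close>

lemma block_tree_adj_sym: "block_tree_adj V E n m \<Longrightarrow> block_tree_adj V E m n"
  by (auto simp: block_tree_adj_def split: sum.splits)

lemma block_tree_path_rev:
  assumes "block_tree_path V E p"
  shows "block_tree_path V E (rev p)"
proof -
  have "block_tree_adj V E (rev p ! i) (rev p ! Suc i)" if i: "Suc i < length p" for i
  proof -
    define k where "k = length p - Suc (Suc i)"
    have k: "Suc k < length p" "rev p ! i = p ! Suc k" "rev p ! Suc i = p ! k"
      using i by (auto simp: k_def rev_nth Suc_diff_Suc)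
    have "block_tree_adj V E (p ! k) (p ! Suc k)" using assms k(1) by (simp add: block_tree_path_def)
    then show ?thesis unfolding k by (rule block_tree_adj_sym)
  qed
  then show ?thesis using assms by (simp add: block_tree_path_def)
qed

context sgraph
begin

text \<open>\<open>Z\<close> is what \<open>y\<close> reaches without the rest of \<open>B1\<close>.
  An edge between \<open>Z - {y}\<close> and \<open>B1 - {y}\<close> would close an ear of
  \<open>B1\<close>; all blocks on the path after \<open>B1\<close> lie in \<open>Z\<close>, and the
  last of them supplies the odd closed walk.\<close>

lemma far_side:
  assumes B1: "is_block V E B1" and B2: "is_block V E B2" "\<not> bipartite_on E B2"
    and path: "block_tree_path V E p" "hd p = Inl B1" "last p = Inl B2" and B12: "B1 \<noteq> B2"
    and y: "p ! 1 = Inr y"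
  obtains Z t where "B1 \<inter> Z = {y}" "\<And>e. e \<in> E \<Longrightarrow> e \<subseteq> B1 \<union> Z \<Longrightarrow> e \<subseteq> B1 \<or> e \<subseteq> Z" "odd_closed E Z y t"
proof -
  have pn: "p \<noteq> []" and pd: "distinct p" and padj: "\<And>i. Suc i < length p \<Longrightarrow> block_tree_adj V E (p ! i) (p ! Suc i)"
    using path(1) by (auto simp: block_tree_path_def)
  have p0: "p ! 0 = Inl B1" using path(2) pn by (simp add: hd_conv_nth)
  have "length p \<noteq> 1" using path(2,3) B12 by (cases p) auto
  then have len: "length p \<ge> 2" using pn by (cases p; cases "tl p") auto
  have yB: "y \<in> B1" using padj[of 0] len p0 y by (auto simp: block_tree_adj_def)
  have BV: "B1 \<subseteq> V" using B1 by (simp add: is_block_def)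
  define Z where "Z = {v. reach_in E (V - (B1 - {y})) y v}"
  have yZ: "y \<in> Z" using yB BV by (auto simp: Z_def intro: reach_in_refl)
  have ZV: "Z \<subseteq> V - (B1 - {y})" by (auto simp: Z_def reach_in_def)
  have ear: "q \<notin> B1 - {y}" if "v \<in> Z" "v \<noteq> y" "{v, q} \<in> E" for v q
    using block_no_ear[OF B1 yB, of q v] that by (auto simp: Z_def)
  have closed: "q \<in> Z" if "v \<in> Z" "v \<noteq> y" "{v, q} \<in> E" "q \<in> V" for v q
  proof -
    have "reach_in E (V - (B1 - {y})) v q" using that ear[OF that(1-3)] ZV by (intro reach_in_edge) auto
    then show ?thesis using that(1) reach_in_trans by (auto simp: Z_def)
  qed
  have absorb: "S \<subseteq> Z" if S: "connected_on E S" "S \<subseteq> V - {y}" "v \<in> S" "v \<in> Z" for S v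
  proof
    fix q assume "q \<in> S"
    then have "(v, q) \<in> {(x, y). x \<in> S \<and> y \<in> S \<and> {x, y} \<in> E}\<^sup>*"
      using S(1,3) by (auto simp: connected_on_def reach_in_def)
    then show "q \<in> Z"
      by (induction rule: rtrancl_induct) (use S closed in blast)+
  qed
  have along: "1 \<le> k \<Longrightarrow> k < length p \<Longrightarrow> (\<forall>v. p ! k = Inr v \<longrightarrow> v \<in> Z) \<and> (\<forall>B. p ! k = Inl B \<longrightarrow> B \<subseteq> Z)" for k
  proof (induction k rule: nat_induct_at_least[of 1])
    case base then show ?case using y yZ by auto
  next
    case (Suc k)
    have adj: "block_tree_adj V E (p ! k) (p ! Suc k)" using padj Suc.prems by blast
    show ?case
    proof (cases "p ! k")
      case (Inl B)
      then have BZ: "B \<subseteq> Z" using Suc by auto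
      obtain v where v: "p ! Suc k = Inr v" "v \<in> B"
        using adj Inl by (cases "p ! Suc k") (auto simp: block_tree_adj_def)
      then show ?thesis using BZ by auto
    next
      case (Inr v)
      then have vZ: "v \<in> Z" using Suc by auto
      obtain B where B: "p ! Suc k = Inl B" "v \<in> B" "is_block V E B"
        using adj Inr by (cases "p ! Suc k") (auto simp: block_tree_adj_def block_tree_node_def)
      \<comment> \<open>The path never returns to \<open>B1\<close>, so the new block differs from
        it and shares at most one vertex with it.\<close>
      have "p ! Suc k \<noteq> p ! 0"
        using pd Suc.prems pn nth_eq_iff_index_eq[of p "Suc k" 0] by auto
      then have ne: "B1 \<noteq> B" using B(1) p0 by auto
      have bc: "biconnected_on E B" and BV': "B \<subseteq> V" using B(3) by (auto simp: is_block_def)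
      have "B \<subseteq> Z"
      \<comment> \<open>A block entered through \<open>y\<close> meets \<open>B1\<close> only there.
        If it is entered elsewhere, what is left of it after deleting \<open>y\<close> is still
        connected and is absorbed from \<open>v\<close>.\<close>
      proof (cases "v = y")
        case True
        have "B \<inter> (B1 - {y}) = {}" using block_Int[OF B1 B(3) ne yB] B(2) True by auto
        then have sub: "B \<subseteq> V - (B1 - {y})" using BV' by auto
        have "reach_in E B y b" if "b \<in> B" for b
          using bc B(2) True that by (auto simp: biconnected_on_def connected_on_def)
        then show ?thesis using reach_in_mono[OF _ sub] by (auto simp: Z_def)
      next
        case False
        have "B - {y} \<subseteq> Z" by (rule absorb[OF biconnected_Diff[OF bc]]) (use BV' B(2) vZ False in auto)
        then show ?thesis using yZ by auto
      qed
      then show ?thesis using B(1) by auto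
    qed
  qed
  have "p ! (length p - 1) = Inl B2" using path(3) pn by (simp add: last_conv_nth)
  then have B2Z: "B2 \<subseteq> Z" using along[of "length p - 1"] len by auto
  have bc2: "biconnected_on E B2" using B2 by (simp add: is_block_def)
  then obtain b where b: "b \<in> B2" by (auto simp: biconnected_on_def)
  obtain w where w: "odd_closed E B2 b w"
    using odd_closed_exists[OF _ B2(2) b] bc2 by (auto simp: biconnected_on_def)
  have wZ: "odd_closed E Z b w" using w B2Z walk_mono by (auto simp: odd_closed_def)
  obtain P where P: "walk E (V - (B1 - {y})) P" "hd P = y" "last P = b"
    using reach_in_walk[of E "V - (B1 - {y})" y b] b B2Z by (auto simp: Z_def)
  have "walk E Z P" using P walk_reach[OF P(1)] by (auto simp: walk_def Z_def)
  then obtain t where t: "odd_closed E Z y t" using odd_closed_shift P wZ by metis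
  show ?thesis
  proof (rule that[OF _ _ t])
    show "B1 \<inter> Z = {y}" using yB yZ ZV by auto
    fix e assume e: "e \<in> E" "e \<subseteq> B1 \<union> Z"
    show "e \<subseteq> B1 \<or> e \<subseteq> Z"
    proof (rule ccontr)
      assume n: "\<not> ?thesis"
      then obtain v q where vq: "v \<in> e" "v \<notin> B1" "q \<in> e" "q \<notin> Z" by blast
      then have "v \<in> Z" "v \<noteq> y" "q \<in> B1 - {y}" using e yB yZ by auto
      moreover have "e = {v, q}" using vq e yB \<open>v \<in> Z\<close> by (auto elim!: edgeE)
      ultimately show False using ear e(1) by blast
    qed
  qed
qed

end

theorem theorem6p4:
  fixes V :: "'v set" and E :: "'v set set" and K :: "'k::field itself"
    and B1 B2 :: "'v set" and y12 y21 :: 'v and p :: "('v set + 'v) list"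
  assumes graph: "simple_graph V E"
    and conn: "connected_graph V E"
    and ci: "graph_complete_intersection K E"
    and B1: "is_block V E B1" "\<not> bipartite_on E B1"
    and B2: "is_block V E B2" "\<not> bipartite_on E B2"
    and B12: "B1 \<noteq> B2"
    and only: "\<And>B. is_block V E B \<Longrightarrow> \<not> bipartite_on E B \<Longrightarrow> B = B1 \<or> B = B2"
    and path: "block_tree_path V E p" "hd p = Inl B1" "last p = Inl B2"
    and y12: "p ! 1 = Inr y12"
    and y21: "p ! (length p - 2) = Inr y21"
  shows "card {C. C \<subseteq> B1 \<and> odd_chordless_cycle E C} \<le> 2
       \<and> card {C. C \<subseteq> B2 \<and> odd_chordless_cycle E C} \<le> 2
       \<and> card {C. C \<subseteq> B1 \<and> odd_chordless_cycle E C \<and> y12 \<in> C} = 1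
       \<and> card {C. C \<subseteq> B2 \<and> odd_chordless_cycle E C \<and> y21 \<in> C} = 1
       \<and> (\<forall>C. C \<subseteq> B1 \<and> odd_chordless_cycle E C \<and> y12 \<notin> C \<longrightarrow> (\<exists>u\<in>C. {u, y12} \<in> E))
       \<and> (\<forall>C. C \<subseteq> B2 \<and> odd_chordless_cycle E C \<and> y21 \<notin> C \<longrightarrow> (\<exists>u\<in>C. {u, y21} \<in> E))"
proof -
  interpret ci_graph V E K by unfold_locales (fact graph, fact ci)
  have b: "biconnected_on E B1" "biconnected_on E B2" using B1(1) B2(1) by (simp_all add: is_block_def)
  have bc: "connected_on E B1" "\<And>x. connected_on E (B1 - {x})"
    "connected_on E B2" "\<And>x. connected_on E (B2 - {x})"
    using b biconnected_Diff[OF b(1)] biconnected_Diff[OF b(2)] by (simp_all add: biconnected_on_def)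
  have pn: "p \<noteq> []" using path(1) by (simp add: block_tree_path_def)
  have "length p \<noteq> 1" using path(2,3) B12 by (cases p) auto
  then have len: "length p \<ge> 2" using pn by (cases p; cases "tl p") auto
  obtain Z1 t1 where Z1: "B1 \<inter> Z1 = {y12}" "\<And>e. e \<in> E \<Longrightarrow> e \<subseteq> B1 \<union> Z1 \<Longrightarrow> e \<subseteq> B1 \<or> e \<subseteq> Z1"
    "odd_closed E Z1 y12 t1" using far_side[OF B1(1) B2 path B12 y12] by metis
  note R1 = odd_cycles_at_cut_vertex[OF bc(1,2) B1(2) Z1]
  \<comment> \<open>Reversing the path exchanges the blocks and turns \<open>y21\<close> into the
    second entry, so the same argument applies to \<open>B2\<close>.\<close>
  have "rev p ! 1 = Inr y21" using y21 len by (simp add: rev_nth numeral_2_eq_2)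
  moreover have "hd (rev p) = Inl B2" "last (rev p) = Inl B1"
    using path(2,3) pn by (simp_all add: hd_rev last_rev)
  ultimately obtain Z2 t2 where Z2: "B2 \<inter> Z2 = {y21}" "\<And>e. e \<in> E \<Longrightarrow> e \<subseteq> B2 \<union> Z2 \<Longrightarrow> e \<subseteq> B2 \<or> e \<subseteq> Z2"
    "odd_closed E Z2 y21 t2"
    using far_side[OF B2(1) B1 block_tree_path_rev[OF path(1)]] B12 by metis
  note R2 = odd_cycles_at_cut_vertex[OF bc(3,4) B2(2) Z2]
  show ?thesis by (intro conjI allI impI; (elim conjE)?) (use R1 R2 in simp_all)
qed

end
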